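(* Let $(G,P)$ be a quasi-lattice ordered group, let $A$ be a $C^*$-algebra, and let $X$ be a compactly aligned product system over $P$ of right-Hilbert $A$--$A$ bimodules. Suppose that each pair in $P$ has a least upper bound. Suppose that each $\phi_p:A\to\mathcal{L}(X_p)$ is injective with $\phi_p(A)\subset\mathcal{K}(X_p)$. Let $\psi:X\to B$ be a representation of $X$ in a $C^*$-algebra $B$. Then $\psi$ is CNP-covariant if and only if $\psi^{(p)}\circ\phi_p=\psi_e$ for all $p\in P$.
   Context: BIMODULES. A right-Hilbert $A$--$A$ bimodule over a $C^*$-algebra $A$ is a right Hilbert $A$-module $X$ (with $A$-valued inner product $\langle\cdot,\cdot\rangle_A$, linear in the second variable) together with a $*$-homomorphism $\phi:A\to\mathcal{L}(X)$ into the adjointable operators (not assumed nondegenerate); write $a\cdot x=\phi(a)x$. $\mathcal{K}(X)=\overline{\mathrm{span}}\{x\otimes y^* : x,y\in X\}$, where $(x\otimes y^* )(z)=x\cdot\langle y,z\rangle_A$. ${}_AA_A$ denotes $A$ with $\langle a,b\rangle_A=a^*b$ and actions by multiplication; $\mathcal{K}({}_AA_A)\cong A$, with $a$ corresponding to left multiplication by $a$. $\otimes_A$ is the balanced (internal) tensor product, with left action $a\mapsto\phi(a)\otimes 1$. QUASI-LATTICE ORDERED GROUPS. $(G,P)$ is a quasi-lattice ordered group if $G$ is a discrete group, $P$ is a subsemigroup of $G$ with $P\cap P^{-1}=\{e\}$, and, for the partial order $p\le q \iff p^{-1}q\in P$, any two $p,q\in G$ having a common upper bound in $P$ have a least upper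 bound $p\vee q\in P$. Write $p\vee q=\infty$ if there is no common upper bound in $P$, and $p\vee q<\infty$ otherwise. PRODUCT SYSTEMS. A product system over $P$ of right-Hilbert $A$--$A$ bimodules is a semigroup $X=\bigsqcup_{p\in P}X_p$ such that: each $X_p$ is a right-Hilbert $A$--$A$ bimodule (left action $\phi_p:A\to\mathcal{L}(X_p)$, inner product $\langle\cdot,\cdot\rangle_A^p$); $X_e={}_AA_A$; for $p,q\in P\setminus\{e\}$ there is an isomorphism $M_{p,q}:X_p\otimes_A X_q\to X_{pq}$ with $M_{p,q}(x\otimes_A y)=xy$; and multiplication by elements of $X_e=A$ implements the left and right actions of $A$ on each $X_p$. For $p\neq e$ and $q\in P$, $\iota_p^{pq}:\mathcal{L}(X_p)\to\mathcal{L}(X_{pq})$ is the homomorphism characterised by $\iota_p^{pq}(S)(xy)=(Sx)y$ for $x\in X_p$, $y\in X_q$; $\iota_e^q:\mathcal{K}(X_e)\cong A\to\mathcal{L}(X_q)$ is $\phi_q$; and $\iota_p^r=0$ if $p\not\le r$. $X$ is compactly aligned if whenever $p\vee q<\infty$, $S\in\mathcal{K}(X_p)$ and $T\in\mathcal{K}(X_q)$, we have $\iota_p^{p\vee q}(S)\iota_q^{p\vee q}(T)\in\mathcal{K}(X_{p\vee q})$. THE MODULES $\widetilde{X}_q$. For a right Hilbert $A$-module $Y$ and an ideal $I$ of $A$, $Y\cdot I=\{y\cdot a:y\in Y,a\in I\}$, a closed sub-bimodule when $Y$ is a bimodule. Put $I_e=A$ and $I_p=\bigcap_{e<r\le p}\ker(\phi_r)$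 for $p \in P\setminus\{e\}$. For $q\in P$, $\widetilde{X}_q=\bigoplus_{p\le q}X_p\cdot I_{p^{-1}q}$ (Hilbert module direct sum over $p\in P$, $p\le q$), with left action $\widetilde{\phi}_q:A\to\mathcal{L}(\widetilde{X}_q)$, $(\widetilde{\phi}_q(a)x)(p)=\phi_p(a)x(p)$. For $p\ne e$, $\widetilde{\iota}_p^{\,q}:\mathcal{L}(X_p)\to\mathcal{L}(\widetilde{X}_q)$ is given by $(\widetilde{\iota}_p^{\,q}(S)x)(r)=\iota_p^r(S)x(r)$ for $r\le q$; and $\widetilde{\iota}_e^{\,q}:\mathcal{K}(X_e)\cong A\to\mathcal{L}(\widetilde{X}_q)$ is $\widetilde{\phi}_q$. REPRESENTATIONS. A representation of $X$ in a $C^*$-algebra $B$ is a map $\psi:X\to B$, with $\psi_p=\psi|_{X_p}$, such that each $\psi_p$ is linear and $\psi_e$ is a $*$-homomorphism; $\psi_p(x)\psi_q(y)=\psi_{pq}(xy)$ for $x\in X_p,y\in X_q$; and $\psi_e(\langle x,y\rangle_A^p)=\psi_p(x)^*\psi_p(y)$ for $x,y\in X_p$. Then $\psi^{(p)}:\mathcal{K}(X_p)\to B$ is the homomorphism with $\psi^{(p)}(x\otimes y^* )=\psi_p(x)\psi_p(y)^*$. $\psi$ is Nica covariant if for all $p,q\in P$, $S\in\mathcal{K}(X_p)$, $T\in\mathcal{K}(X_q)$: $\psi^{(p)}(S)\psi^{(q)}(T)=\psi^{(p\vee q)}(\iota_p^{p\vee q}(S)\iota_q^{p\vee q}(T))$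 if $p\vee q<\infty$, and $=0$ otherwise. A statement $\mathcal{P}(s)$ ($s\in P$) holds for large $s$ if for every $q\in P$ there is $r\in P$ with $q\le r$ such that $\mathcal{P}(s)$ holds for all $s\ge r$. $\psi$ satisfies (CP) if $\sum_{p\in F}\psi^{(p)}(T_p)=0$ for every finite $F\subset P$ and all $T_p\in\mathcal{K}(X_p)$ ($p\in F$) such that $\sum_{p\in F}\widetilde{\iota}_p^{\,s}(T_p)=0$ for large $s$. (This condition is defined for product systems in which all $\widetilde\phi_q$ are injective, which is the case when all $\phi_p$ are injective.) $\psi$ is CNP-covariant if it is Nica covariant and satisfies (CP). *)

theory Defs
  imports "HOL-Analysis.Analysis" "HOL-Algebra.Algebraic_Closure_Type"
begin

section \<open>C*-algebras\<close>

text \<open>Not necessarily unital.\<close>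

class cstar_algebra = real_normed_algebra + banach +
  fixes scaleC :: "complex \<Rightarrow> 'a \<Rightarrow> 'a" (infixr \<open>*\<^sub>C\<close> 75)
    and star :: "'a \<Rightarrow> 'a"
  assumes scaleC_add_right: "c *\<^sub>C (a + b) = c *\<^sub>C a + c *\<^sub>C b"
    and scaleC_add_left: "(c + d) *\<^sub>C a = c *\<^sub>C a + d *\<^sub>C a"
    and scaleC_scaleC: "c *\<^sub>C d *\<^sub>C a = (c * d) *\<^sub>C a"
    and scaleC_of_real: "complex_of_real r *\<^sub>C a = r *\<^sub>R a"
    and scaleC_mult_left: "(c *\<^sub>C a) * b = c *\<^sub>C (a * b)"
    and scaleC_mult_right: "a * (c *\<^sub>C b) = c *\<^sub>C (a * b)"
    and norm_scaleC: "norm (c *\<^sub>C a) = cmod c * norm a"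
    and star_star: "star (star a) = a"
    and star_add: "star (a + b) = star a + star b"
    and star_scaleC: "star (c *\<^sub>C a) = cnj c *\<^sub>C star a"
    and star_mult: "star (a * b) = star b * star a"
    and cstar_identity: "norm (star a * a) = (norm a)\<^sup>2"

definition cstar_positive :: "'a::cstar_algebra \<Rightarrow> bool" where
  "cstar_positive a \<longleftrightarrow> (\<exists>b. a = star b * b)"


section \<open>Right-Hilbert bimodules\<close>

text \<open>
  The additive group and the complex scalars come from the \<^typ>\<open>('a, 'b) module\<close> record; its
  ring multiplication and ring unit carry no meaning here. The fields \<open>ract\<close>, \<open>lact\<close> and \<open>ip\<close>
  are the right action, the left action and the \<open>A\<close>-valued inner product, and all axioms
  are relative to the carrier.
\<close>

record ('a, 'x) bimodule = "(complex, 'x) module" +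
  ract :: "'x \<Rightarrow> 'a \<Rightarrow> 'x"
  lact :: "'a \<Rightarrow> 'x \<Rightarrow> 'x"
  ip :: "'x \<Rightarrow> 'x \<Rightarrow> 'a"

definition mnorm :: "('a::cstar_algebra, 'x) bimodule \<Rightarrow> 'x \<Rightarrow> real" where
  "mnorm M x = sqrt (norm (ip M x x))"

locale right_hilbert_module = Module.module "ring_of_type_algebra :: complex ring" M
  for M :: "('a::cstar_algebra, 'x) bimodule" (structure) +
  assumes ract_closed: "x \<in> carrier M \<Longrightarrow> ract M x a \<in> carrier M"
    and ract_add_left: "\<lbrakk>x \<in> carrier M; y \<in> carrier M\<rbrakk> \<Longrightarrow> ract M (x \<oplus> y) a = ract M x a \<oplus> ract M y a"
    and ract_add_right: "x \<in> carrier M \<Longrightarrow> ract M x (a + b) = ract M x a \<oplus> ract M x b"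
    and ract_mult: "x \<in> carrier M \<Longrightarrow> ract M x (a * b) = ract M (ract M x a) b"
    and ract_smult: "x \<in> carrier M \<Longrightarrow> ract M (c \<odot> x) a = c \<odot> ract M x a"
    and ract_scaleC: "x \<in> carrier M \<Longrightarrow> ract M x (c *\<^sub>C a) = c \<odot> ract M x a"
    and ip_add: "\<lbrakk>x \<in> carrier M; y \<in> carrier M; z \<in> carrier M\<rbrakk> \<Longrightarrow> ip M x (y \<oplus> z) = ip M x y + ip M x z"
    and ip_smult: "\<lbrakk>x \<in> carrier M; y \<in> carrier M\<rbrakk> \<Longrightarrow> ip M x (c \<odot> y) = c *\<^sub>C ip M x y"
    and ip_ract: "\<lbrakk>x \<in> carrier M; y \<in> carrier M\<rbrakk> \<Longrightarrow> ip M x (ract M y a) = ip M x y * a"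
    and ip_star: "\<lbrakk>x \<in> carrier M; y \<in> carrier M\<rbrakk> \<Longrightarrow> star (ip M x y) = ip M y x"
    and ip_positive: "x \<in> carrier M \<Longrightarrow> cstar_positive (ip M x x)"
    and ip_eq_zero: "\<lbrakk>x \<in> carrier M; ip M x x = 0\<rbrakk> \<Longrightarrow> x = \<zero>"
    and cauchy_complete: "\<lbrakk>\<And>n. s n \<in> carrier M;
          \<forall>\<epsilon>>0. \<exists>N. \<forall>m\<ge>N. \<forall>n\<ge>N. mnorm M (s m \<ominus> s n) < \<epsilon>\<rbrakk>
        \<Longrightarrow> \<exists>x\<in>carrier M. (\<lambda>n. mnorm M (s n \<ominus> x)) \<longlonglongrightarrow> 0"

text \<open>
  The last five axioms say that \<open>a \<mapsto> lact M a\<close> is a *-homomorphism into the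
  adjointable operators. It is not required to be nondegenerate.
\<close>

locale right_hilbert_bimodule = right_hilbert_module M
  for M :: "('a::cstar_algebra, 'x) bimodule" (structure) +
  assumes lact_closed: "x \<in> carrier M \<Longrightarrow> lact M a x \<in> carrier M"
    and lact_add: "x \<in> carrier M \<Longrightarrow> lact M (a + b) x = lact M a x \<oplus> lact M b x"
    and lact_scaleC: "x \<in> carrier M \<Longrightarrow> lact M (c *\<^sub>C a) x = c \<odot> lact M a x"
    and lact_mult: "x \<in> carrier M \<Longrightarrow> lact M (a * b) x = lact M a (lact M b x)"
    and lact_adjoint: "\<lbrakk>x \<in> carrier M; y \<in> carrier M\<rbrakk> \<Longrightarrow> ip M (lact M a x) y = ip M x (lact M (star a) y)"

definition bimodule_iso ::
  "('a::cstar_algebra, 'x) bimodule \<Rightarrow> ('a, 'y) bimodule \<Rightarrow> ('x \<Rightarrow> 'y) \<Rightarrow> bool" where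
  "bimodule_iso M N f \<longleftrightarrow>
     bij_betw f (carrier M) (carrier N) \<and>
     (\<forall>x\<in>carrier M. \<forall>y\<in>carrier M. f (x \<oplus>\<^bsub>M\<^esub> y) = f x \<oplus>\<^bsub>N\<^esub> f y) \<and>
     (\<forall>c. \<forall>x\<in>carrier M. f (c \<odot>\<^bsub>M\<^esub> x) = c \<odot>\<^bsub>N\<^esub> f x) \<and>
     (\<forall>a. \<forall>x\<in>carrier M. f (ract M x a) = ract N (f x) a) \<and>
     (\<forall>a. \<forall>x\<in>carrier M. f (lact M a x) = lact N a (f x)) \<and>
     (\<forall>x\<in>carrier M. \<forall>y\<in>carrier M. ip N (f x) (f y) = ip M x y)"

text \<open>The bimodule \<open>\<^sub>AA\<^sub>A\<close>.\<close>

definition algebra_bimodule :: "('a::cstar_algebra, 'a) bimodule" where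
  "algebra_bimodule = \<lparr>carrier = UNIV, mult = (*), one = undefined, zero = 0, add = (+),
     smult = (*\<^sub>C), ract = (*), lact = (*), ip = (\<lambda>a b. star a * b)\<rparr>"


subsection \<open>Adjointable and compact operators\<close>

text \<open>
  Operators are extensional functions on the carrier, so that equality of operators is
  equality of functions.
\<close>

definition is_adjoint :: "('a::cstar_algebra, 'x) bimodule \<Rightarrow> ('x \<Rightarrow> 'x) \<Rightarrow> ('x \<Rightarrow> 'x) \<Rightarrow> bool" where
  "is_adjoint M T S \<longleftrightarrow> (\<forall>x\<in>carrier M. \<forall>y\<in>carrier M. ip M (T x) y = ip M x (S y))"

definition adjointables :: "('a::cstar_algebra, 'x) bimodule \<Rightarrow> ('x \<Rightarrow> 'x) set" where
  "adjointables M =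
     {T \<in> carrier M \<rightarrow>\<^sub>E carrier M. \<exists>S \<in> carrier M \<rightarrow>\<^sub>E carrier M. is_adjoint M T S}"

definition op_zero :: "('a::cstar_algebra, 'x) bimodule \<Rightarrow> 'x \<Rightarrow> 'x" where
  "op_zero M = (\<lambda>z\<in>carrier M. \<zero>\<^bsub>M\<^esub>)"

definition op_add :: "('a::cstar_algebra, 'x) bimodule \<Rightarrow> ('x \<Rightarrow> 'x) \<Rightarrow> ('x \<Rightarrow> 'x) \<Rightarrow> 'x \<Rightarrow> 'x" where
  "op_add M S T = (\<lambda>z\<in>carrier M. S z \<oplus>\<^bsub>M\<^esub> T z)"

definition op_scale :: "('a::cstar_algebra, 'x) bimodule \<Rightarrow> complex \<Rightarrow> ('x \<Rightarrow> 'x) \<Rightarrow> 'x \<Rightarrow> 'x" where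
  "op_scale M c T = (\<lambda>z\<in>carrier M. c \<odot>\<^bsub>M\<^esub> T z)"

abbreviation op_comp :: "('a::cstar_algebra, 'x) bimodule \<Rightarrow> ('x \<Rightarrow> 'x) \<Rightarrow> ('x \<Rightarrow> 'x) \<Rightarrow> 'x \<Rightarrow> 'x" where
  "op_comp M S T \<equiv> compose (carrier M) S T"

definition phi :: "('a::cstar_algebra, 'x) bimodule \<Rightarrow> 'a \<Rightarrow> 'x \<Rightarrow> 'x" where
  "phi M a = (\<lambda>x\<in>carrier M. lact M a x)"

definition rank_one :: "('a::cstar_algebra, 'x) bimodule \<Rightarrow> 'x \<Rightarrow> 'x \<Rightarrow> 'x \<Rightarrow> 'x" where
  "rank_one M x y = (\<lambda>z\<in>carrier M. ract M x (ip M y z))"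

inductive_set finite_rank :: "('a::cstar_algebra, 'x) bimodule \<Rightarrow> ('x \<Rightarrow> 'x) set"
  for M :: "('a::cstar_algebra, 'x) bimodule" where
  zero: "op_zero M \<in> finite_rank M"
| add: "\<lbrakk>S \<in> finite_rank M; x \<in> carrier M; y \<in> carrier M\<rbrakk>
    \<Longrightarrow> op_add M (op_scale M c (rank_one M x y)) S \<in> finite_rank M"

text \<open>
  The closure of the finite-rank operators in the operator norm: the innermost condition
  says that the norm of \<open>T - S\<close> is at most \<open>\<epsilon>\<close>.
\<close>

definition compacts :: "('a::cstar_algebra, 'x) bimodule \<Rightarrow> ('x \<Rightarrow> 'x) set" where
  "compacts M = {T \<in> adjointables M. \<forall>\<epsilon>>0. \<exists>S\<in>finite_rank M.
     \<forall>x\<in>carrier M. mnorm M (T x \<ominus>\<^bsub>M\<^esub> S x) \<le> \<epsilon> * mnorm M x}"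


subsection \<open>The internal tensor product\<close>

text \<open>
  The list \<open>[(x1, y1), \<dots>, (xn, yn)]\<close> stands for the formal sum of the \<open>xi \<otimes> yi\<close>.
  The internal tensor product is the Hausdorff completion of the formal sums, realised by classes of
  Cauchy sequences, for the semi-inner product
  \<open>\<langle>x \<otimes> y, x' \<otimes> y'\<rangle> = \<langle>y, \<langle>x, x'\<rangle> \<cdot> y'\<rangle>\<close>.
  The bilinearity and balancing relations need not be imposed separately, because the
  corresponding differences of formal sums have length zero.
\<close>

type_synonym ('x, 'y) formal = "('x \<times> 'y) list"

definition formals :: "('a::cstar_algebra, 'x) bimodule \<Rightarrow> ('a, 'y) bimodule \<Rightarrow> ('x, 'y) formal set" where
  "formals M N = lists (carrier M \<times> carrier N)"

definition formal_ip ::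
  "('a::cstar_algebra, 'x) bimodule \<Rightarrow> ('a, 'y) bimodule \<Rightarrow> ('x, 'y) formal \<Rightarrow> ('x, 'y) formal \<Rightarrow> 'a" where
  "formal_ip M N u v = (\<Sum>(x, y)\<leftarrow>u. \<Sum>(x', y')\<leftarrow>v. ip N y (lact N (ip M x x') y'))"

definition formal_smult :: "('a::cstar_algebra, 'x) bimodule \<Rightarrow> complex \<Rightarrow> ('x, 'y) formal \<Rightarrow> ('x, 'y) formal" where
  "formal_smult M c u = map (\<lambda>(x, y). (c \<odot>\<^bsub>M\<^esub> x, y)) u"

definition formal_dist ::
  "('a::cstar_algebra, 'x) bimodule \<Rightarrow> ('a, 'y) bimodule \<Rightarrow> ('x, 'y) formal \<Rightarrow> ('x, 'y) formal \<Rightarrow> real" where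
  "formal_dist M N u v = (let w = u @ formal_smult M (-1) v in sqrt (norm (formal_ip M N w w)))"

definition tensor_cauchy ::
  "('a::cstar_algebra, 'x) bimodule \<Rightarrow> ('a, 'y) bimodule \<Rightarrow> (nat \<Rightarrow> ('x, 'y) formal) set" where
  "tensor_cauchy M N = {s. (\<forall>n. s n \<in> formals M N) \<and>
     (\<forall>\<epsilon>>0. \<exists>k. \<forall>m\<ge>k. \<forall>n\<ge>k. formal_dist M N (s m) (s n) < \<epsilon>)}"

definition tensor_rel ::
  "('a::cstar_algebra, 'x) bimodule \<Rightarrow> ('a, 'y) bimodule \<Rightarrow>
    ((nat \<Rightarrow> ('x, 'y) formal) \<times> (nat \<Rightarrow> ('x, 'y) formal)) set" where
  "tensor_rel M N = {(s, t). s \<in> tensor_cauchy M N \<and> t \<in> tensor_cauchy M N \<and>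
     (\<lambda>n. formal_dist M N (s n) (t n)) \<longlonglongrightarrow> 0}"

text \<open>
  The operations are the termwise ones on representatives; the union over all
  representatives of a class is the class of any one of the results.
\<close>

definition tensor_product ::
  "('a::cstar_algebra, 'x) bimodule \<Rightarrow> ('a, 'y) bimodule \<Rightarrow>
    ('a, (nat \<Rightarrow> ('x, 'y) formal) set) bimodule" where
  "tensor_product M N = \<lparr>
     carrier = tensor_cauchy M N // tensor_rel M N,
     mult = undefined,
     one = undefined,
     zero = tensor_rel M N `` {\<lambda>n. []},
     add = (\<lambda>C D. \<Union>s\<in>C. \<Union>t\<in>D. tensor_rel M N `` {\<lambda>n. s n @ t n}),
     smult = (\<lambda>c C. \<Union>s\<in>C. tensor_rel M N `` {\<lambda>n. formal_smult M c (s n)}),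
     ract = (\<lambda>C a. \<Union>s\<in>C. tensor_rel M N `` {\<lambda>n. map (\<lambda>(x, y). (x, ract N y a)) (s n)}),
     lact = (\<lambda>a C. \<Union>s\<in>C. tensor_rel M N `` {\<lambda>n. map (\<lambda>(x, y). (lact M a x, y)) (s n)}),
     ip = (\<lambda>C D. lim (\<lambda>n. formal_ip M N ((SOME s. s \<in> C) n) ((SOME t. t \<in> D) n)))\<rparr>"

definition simple_tensor ::
  "('a::cstar_algebra, 'x) bimodule \<Rightarrow> ('a, 'y) bimodule \<Rightarrow> 'x \<Rightarrow> 'y \<Rightarrow> (nat \<Rightarrow> ('x, 'y) formal) set" where
  "simple_tensor M N x y = tensor_rel M N `` {\<lambda>n. [(x, y)]}"


section \<open>Quasi-lattice ordered groups\<close>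

text \<open>
  The group is a type of class \<^class>\<open>group_add\<close>, which is written additively but is
  not assumed commutative: \<open>p + q\<close>, \<open>- p\<close> and \<open>0\<close> are the
  product \<open>pq\<close>, the inverse of \<open>p\<close> and the identity \<open>e\<close>.
\<close>

definition qle :: "'g::group_add set \<Rightarrow> 'g \<Rightarrow> 'g \<Rightarrow> bool" where
  "qle P p q \<longleftrightarrow> - p + q \<in> P"

definition common_ub :: "'g::group_add set \<Rightarrow> 'g \<Rightarrow> 'g \<Rightarrow> 'g \<Rightarrow> bool" where
  "common_ub P p q r \<longleftrightarrow> r \<in> P \<and> qle P p r \<and> qle P q r"

definition is_least_ub :: "'g::group_add set \<Rightarrow> 'g \<Rightarrow> 'g \<Rightarrow> 'g \<Rightarrow> bool" where
  "is_least_ub P p q r \<longleftrightarrow> common_ub P p q r \<and> (\<forall>s. common_ub P p q s \<longrightarrow> qle P r s)"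

definition least_ub :: "'g::group_add set \<Rightarrow> 'g \<Rightarrow> 'g \<Rightarrow> 'g" where
  "least_ub P p q = (THE r. is_least_ub P p q r)"

definition quasi_lattice_ordered :: "'g::group_add set \<Rightarrow> bool" where
  "quasi_lattice_ordered P \<longleftrightarrow>
     (\<forall>p\<in>P. \<forall>q\<in>P. p + q \<in> P) \<and>
     P \<inter> uminus ` P = {0} \<and>
     (\<forall>p q. (\<exists>r. common_ub P p q r) \<longrightarrow> (\<exists>r. is_least_ub P p q r))"

definition for_large :: "'g::group_add set \<Rightarrow> ('g \<Rightarrow> bool) \<Rightarrow> bool" where
  "for_large P Q \<longleftrightarrow> (\<forall>q\<in>P. \<exists>r\<in>P. qle P q r \<and> (\<forall>s\<in>P. qle P r s \<longrightarrow> Q s))"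


section \<open>Product systems\<close>

text \<open>
  The fibres have pairwise disjoint carriers inside one type, and \<open>pmult\<close> is the
  multiplication of their union. The map \<open>emb\<close> is the identification of the coefficient
  algebra \<open>A\<close> with the fibre over the identity.
\<close>

record ('g, 'a, 'x) prodsys =
  fibre :: "'g \<Rightarrow> ('a, 'x) bimodule"
  pmult :: "'x \<Rightarrow> 'x \<Rightarrow> 'x"
  emb :: "'a \<Rightarrow> 'x"

definition product_system ::
  "'g::group_add set \<Rightarrow> ('g, 'a::cstar_algebra, 'x) prodsys \<Rightarrow> bool" where
  "product_system P \<X> \<longleftrightarrow>
     (\<forall>p\<in>P. right_hilbert_bimodule (fibre \<X> p)) \<and>
     (\<forall>p\<in>P. \<forall>q\<in>P. p \<noteq> q \<longrightarrow> carrier (fibre \<X> p) \<inter> carrier (fibre \<X> q) = {}) \<and>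
     (\<forall>p\<in>P. \<forall>q\<in>P. \<forall>x\<in>carrier (fibre \<X> p). \<forall>y\<in>carrier (fibre \<X> q).
        pmult \<X> x y \<in> carrier (fibre \<X> (p + q))) \<and>
     (\<forall>p\<in>P. \<forall>q\<in>P. \<forall>r\<in>P. \<forall>x\<in>carrier (fibre \<X> p). \<forall>y\<in>carrier (fibre \<X> q). \<forall>z\<in>carrier (fibre \<X> r).
        pmult \<X> (pmult \<X> x y) z = pmult \<X> x (pmult \<X> y z)) \<and>
     bimodule_iso algebra_bimodule (fibre \<X> 0) (emb \<X>) \<and>
     (\<forall>p\<in>P. \<forall>q\<in>P. p \<noteq> 0 \<longrightarrow> q \<noteq> 0 \<longrightarrow>
        (\<exists>f. bimodule_iso (tensor_product (fibre \<X> p) (fibre \<X> q)) (fibre \<X> (p + q)) f \<and>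
           (\<forall>x\<in>carrier (fibre \<X> p). \<forall>y\<in>carrier (fibre \<X> q).
              f (simple_tensor (fibre \<X> p) (fibre \<X> q) x y) = pmult \<X> x y))) \<and>
     (\<forall>p\<in>P. \<forall>a. \<forall>x\<in>carrier (fibre \<X> p).
        pmult \<X> (emb \<X> a) x = lact (fibre \<X> p) a x \<and>
        pmult \<X> x (emb \<X> a) = ract (fibre \<X> p) x a)"

text \<open>
  For \<open>p = e\<close> the operator \<open>S\<close> is compact on the identity fibre, hence left multiplication
  \<open>phi (fibre \<X> 0) a\<close> by a unique \<open>a\<close>.
\<close>

definition iota ::
  "'g::group_add set \<Rightarrow> ('g, 'a::cstar_algebra, 'x) prodsys \<Rightarrow> 'g \<Rightarrow> 'g \<Rightarrow> ('x \<Rightarrow> 'x) \<Rightarrow> 'x \<Rightarrow> 'x" where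
  "iota P \<X> p r S =
     (if \<not> qle P p r then op_zero (fibre \<X> r)
      else if p = 0 then phi (fibre \<X> r) (THE a. S = phi (fibre \<X> 0) a)
      else (THE T. T \<in> adjointables (fibre \<X> r) \<and>
        (\<forall>x\<in>carrier (fibre \<X> p). \<forall>y\<in>carrier (fibre \<X> (- p + r)).
           T (pmult \<X> x y) = pmult \<X> (S x) y)))"

definition compactly_aligned ::
  "'g::group_add set \<Rightarrow> ('g, 'a::cstar_algebra, 'x) prodsys \<Rightarrow> bool" where
  "compactly_aligned P \<X> \<longleftrightarrow>
     (\<forall>p\<in>P. \<forall>q\<in>P. (\<exists>r. common_ub P p q r) \<longrightarrow>
       (\<forall>S\<in>compacts (fibre \<X> p). \<forall>T\<in>compacts (fibre \<X> q).
          op_comp (fibre \<X> (least_ub P p q)) (iota P \<X> p (least_ub P p q) S) (iota P \<X> q (least_ub P p q) T)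
            \<in> compacts (fibre \<X> (least_ub P p q))))"


subsection \<open>The modules X-tilde\<close>

definition kernel_ideal ::
  "'g::group_add set \<Rightarrow> ('g, 'a::cstar_algebra, 'x) prodsys \<Rightarrow> 'g \<Rightarrow> 'a set" where
  "kernel_ideal P \<X> p =
     (if p = 0 then UNIV
      else (\<Inter>r\<in>{r. qle P 0 r \<and> r \<noteq> 0 \<and> qle P r p}. {a. phi (fibre \<X> r) a = op_zero (fibre \<X> r)}))"

definition submodule_of_ideal :: "('a::cstar_algebra, 'x) bimodule \<Rightarrow> 'a set \<Rightarrow> 'x set" where
  "submodule_of_ideal M I = {ract M y a | y a. y \<in> carrier M \<and> a \<in> I}"

definition below :: "'g::group_add set \<Rightarrow> 'g \<Rightarrow> 'g set" where
  "below P q = {p\<in>P. qle P p q}"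

text \<open>The Hilbert module direct sum: the family of inner squares must be norm summable in \<open>A\<close>.\<close>

definition tilde_carrier ::
  "'g::group_add set \<Rightarrow> ('g, 'a::cstar_algebra, 'x) prodsys \<Rightarrow> 'g \<Rightarrow> ('g \<Rightarrow> 'x) set" where
  "tilde_carrier P \<X> q =
     {x \<in> (\<Pi>\<^sub>E p\<in>below P q. submodule_of_ideal (fibre \<X> p) (kernel_ideal P \<X> (- p + q))).
        (\<lambda>p. ip (fibre \<X> p) (x p) (x p)) summable_on below P q}"

definition tilde_phi ::
  "'g::group_add set \<Rightarrow> ('g, 'a::cstar_algebra, 'x) prodsys \<Rightarrow> 'g \<Rightarrow> 'a \<Rightarrow> ('g \<Rightarrow> 'x) \<Rightarrow> 'g \<Rightarrow> 'x" where
  "tilde_phi P \<X> q a = (\<lambda>x\<in>tilde_carrier P \<X> q. \<lambda>r\<in>below P q. phi (fibre \<X> r) a (x r))"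

definition tilde_iota ::
  "'g::group_add set \<Rightarrow> ('g, 'a::cstar_algebra, 'x) prodsys \<Rightarrow> 'g \<Rightarrow> 'g \<Rightarrow> ('x \<Rightarrow> 'x) \<Rightarrow> ('g \<Rightarrow> 'x) \<Rightarrow> 'g \<Rightarrow> 'x" where
  "tilde_iota P \<X> p q S =
     (if p = 0 then tilde_phi P \<X> q (THE a. S = phi (fibre \<X> 0) a)
      else (\<lambda>x\<in>tilde_carrier P \<X> q. \<lambda>r\<in>below P q. iota P \<X> p r S (x r)))"


section \<open>Representations\<close>

definition ps_representation ::
  "'g::group_add set \<Rightarrow> ('g, 'a::cstar_algebra, 'x) prodsys \<Rightarrow> ('x \<Rightarrow> 'b::cstar_algebra) \<Rightarrow> bool" where
  "ps_representation P \<X> \<psi> \<longleftrightarrow>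
     (\<forall>p\<in>P. \<forall>x\<in>carrier (fibre \<X> p). \<forall>y\<in>carrier (fibre \<X> p). \<psi> (x \<oplus>\<^bsub>fibre \<X> p\<^esub> y) = \<psi> x + \<psi> y) \<and>
     (\<forall>p\<in>P. \<forall>c. \<forall>x\<in>carrier (fibre \<X> p). \<psi> (c \<odot>\<^bsub>fibre \<X> p\<^esub> x) = c *\<^sub>C \<psi> x) \<and>
     (\<forall>a b. \<psi> (emb \<X> (a * b)) = \<psi> (emb \<X> a) * \<psi> (emb \<X> b)) \<and>
     (\<forall>a. \<psi> (emb \<X> (star a)) = star (\<psi> (emb \<X> a))) \<and>
     (\<forall>p\<in>P. \<forall>q\<in>P. \<forall>x\<in>carrier (fibre \<X> p). \<forall>y\<in>carrier (fibre \<X> q). \<psi> (pmult \<X> x y) = \<psi> x * \<psi> y) \<and>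
     (\<forall>p\<in>P. \<forall>x\<in>carrier (fibre \<X> p). \<forall>y\<in>carrier (fibre \<X> p).
        \<psi> (emb \<X> (ip (fibre \<X> p) x y)) = star (\<psi> x) * \<psi> y)"

text \<open>
  *-homomorphisms between C*-algebras are automatically norm decreasing. The last conjunct
  records this: \<open>\<parallel>T\<parallel> \<le> k\<close> implies \<open>\<parallel>f T\<parallel> \<le> k\<close>.
\<close>

definition compacts_hom ::
  "('a::cstar_algebra, 'x) bimodule \<Rightarrow> (('x \<Rightarrow> 'x) \<Rightarrow> 'b::cstar_algebra) \<Rightarrow> bool" where
  "compacts_hom M f \<longleftrightarrow>
     (\<forall>S\<in>compacts M. \<forall>T\<in>compacts M. f (op_add M S T) = f S + f T) \<and>
     (\<forall>c. \<forall>T\<in>compacts M. f (op_scale M c T) = c *\<^sub>C f T) \<and>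
     (\<forall>S\<in>compacts M. \<forall>T\<in>compacts M. f (op_comp M S T) = f S * f T) \<and>
     (\<forall>S\<in>compacts M. \<forall>T\<in>compacts M. is_adjoint M T S \<longrightarrow> f S = star (f T)) \<and>
     (\<forall>T\<in>compacts M. \<forall>k\<ge>0. (\<forall>x\<in>carrier M. mnorm M (T x) \<le> k * mnorm M x) \<longrightarrow> norm (f T) \<le> k)"

definition psi_compacts :: "('a::cstar_algebra, 'x) bimodule \<Rightarrow> ('x \<Rightarrow> 'b::cstar_algebra) \<Rightarrow> ('x \<Rightarrow> 'x) \<Rightarrow> 'b" where
  "psi_compacts M \<psi> = (THE f. f \<in> extensional (compacts M) \<and> compacts_hom M f \<and>
     (\<forall>x\<in>carrier M. \<forall>y\<in>carrier M. f (rank_one M x y) = \<psi> x * star (\<psi> y)))"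

definition nica_covariant ::
  "'g::group_add set \<Rightarrow> ('g, 'a::cstar_algebra, 'x) prodsys \<Rightarrow> ('x \<Rightarrow> 'b::cstar_algebra) \<Rightarrow> bool" where
  "nica_covariant P \<X> \<psi> \<longleftrightarrow>
     (\<forall>p\<in>P. \<forall>q\<in>P. \<forall>S\<in>compacts (fibre \<X> p). \<forall>T\<in>compacts (fibre \<X> q).
        psi_compacts (fibre \<X> p) \<psi> S * psi_compacts (fibre \<X> q) \<psi> T =
          (if \<exists>r. common_ub P p q r
           then psi_compacts (fibre \<X> (least_ub P p q)) \<psi>
             (op_comp (fibre \<X> (least_ub P p q)) (iota P \<X> p (least_ub P p q) S) (iota P \<X> q (least_ub P p q) T))
           else 0))"

text \<open>
  The vanishing of the sum of the operators \<open>tilde_iota P \<X> p s (T p)\<close> is expressed by the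
  vanishing of all components of its values.
\<close>

definition satisfies_CP ::
  "'g::group_add set \<Rightarrow> ('g, 'a::cstar_algebra, 'x) prodsys \<Rightarrow> ('x \<Rightarrow> 'b::cstar_algebra) \<Rightarrow> bool" where
  "satisfies_CP P \<X> \<psi> \<longleftrightarrow>
     (\<forall>F T. finite F \<longrightarrow> F \<subseteq> P \<longrightarrow> (\<forall>p\<in>F. T p \<in> compacts (fibre \<X> p)) \<longrightarrow>
        for_large P (\<lambda>s. \<forall>x\<in>tilde_carrier P \<X> s. \<forall>r\<in>below P s.
          finsum (fibre \<X> r) (\<lambda>p. tilde_iota P \<X> p s (T p) x r) F = \<zero>\<^bsub>fibre \<X> r\<^esub>) \<longrightarrow>
        (\<Sum>p\<in>F. psi_compacts (fibre \<X> p) \<psi> (T p)) = 0)"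

definition CNP_covariant ::
  "'g::group_add set \<Rightarrow> ('g, 'a::cstar_algebra, 'x) prodsys \<Rightarrow> ('x \<Rightarrow> 'b::cstar_algebra) \<Rightarrow> bool" where
  "CNP_covariant P \<X> \<psi> \<longleftrightarrow> nica_covariant P \<X> \<psi> \<and> satisfies_CP P \<X> \<psi>"

end

theory Submission
  imports Defs
begin

text \<open>
  The homomorphism \<open>\<psi>\<^sup>(\<^sup>p\<^sup>)\<close> exists because a selfadjoint finite-rank operator \<open>\<Theta>\<close> of norm \<open>k\<close> and its
  image \<open>t\<close> satisfy \<open>\<parallel>t\<parallel>\<^sup>n\<^sup>+\<^sup>1 \<le> C k\<^sup>n\<close> for all \<open>n\<close>. The condition (CP), applied to \<open>\<phi>\<^sub>p(a)\<close> and \<open>-a\<close>, gives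
  \<open>\<psi>\<^sup>(\<^sup>p\<^sup>) \<circ> \<phi>\<^sub>p = \<psi>\<^sub>e\<close>: as all \<open>\<phi>\<^sub>r\<close> are injective, the ideals \<open>I\<^sub>r\<close> with \<open>r \<noteq> e\<close> vanish, and only the
  summand \<open>X\<^sub>s\<close> of \<open>X\<close>-tilde is left. Conversely, this covariance gives \<open>\<psi>\<^sup>(\<^sup>p\<^sup>q\<^sup>) (\<iota> S) = \<psi>\<^sup>(\<^sup>p\<^sup>) S\<close> for compact
  \<open>S\<close> on \<open>X\<^sub>p\<close>. Indeed, if \<open>x a\<close> is close to \<open>x\<close> and \<open>\<phi>\<^sub>q(a)\<close> close to \<open>\<Sum> u\<^sub>i \<otimes> v\<^sub>i\<^sup>*\<close>, then \<open>\<iota> (x \<otimes> y\<^sup>*)\<close> is close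
  to \<open>\<Sum> x u\<^sub>i \<otimes> (y v\<^sub>i)\<^sup>*\<close>, whose image is \<open>\<psi>(x) \<psi>\<^sup>(\<^sup>q\<^sup>) (\<Sum> u\<^sub>i \<otimes> v\<^sub>i\<^sup>*) \<psi>(y)\<^sup>*\<close>, close to \<open>\<psi>(x a) \<psi>(y)\<^sup>*\<close>. Both Nica
  covariance and (CP) can then be read off in a single fibre \<open>X\<^sub>s\<close> with \<open>s\<close> large.
\<close>

section \<open>C*-algebras\<close>

text \<open>\<open>psi_compacts\<close>, \<open>iota\<close> and the inner product of
  \<open>tensor_product\<close> are given by descriptions, choices and limits, so nothing is known
  about them before existence, uniqueness and norm bounds are proved. The bounds come from the
  C*-identity: spectral theory is replaced by fixed-point constructions (such as a square root of 1
  - x without a unit) and by comparing exponential growth rates of powers. Positivity of b* b is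
  what makes Cauchy-Schwarz available, in a module and for formal tensors; its proof needs a unit
  and hence the unitization. On the fibres the delicate point is that S \<otimes> 1 is at first only
  a map on formal sums. It is bounded there, approximated by finite-rank operators of the product
  fibre, and only their norm limit is an operator, whose adjoint comes with it. Since left actions
  may be degenerate, products starting in the identity fibre need not be dense; as a left factor
  that fibre is treated apart, by identifying its compact operators with A. Least upper bounds make
  P directed, so that one large s dominates a finite set.\<close>

lemma scaleC_zero_left [simp]: "0 *\<^sub>C a = 0"
  using scaleC_of_real[of 0 a] by simp

lemma scaleC_one [simp]: "1 *\<^sub>C a = a"
  using scaleC_of_real[of 1 a] by simp

lemma scaleC_zero_right [simp]: "c *\<^sub>C (0::'a::cstar_algebra) = 0"
  using scaleC_add_right[of c 0 "0::'a"] by simp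

lemma scaleC_minus_left: "(- c) *\<^sub>C a = - (c *\<^sub>C a)"
  using scaleC_add_left[of c "-c" a] by (simp add: eq_neg_iff_add_eq_0 add.commute)

lemma scaleC_minus_right: "c *\<^sub>C (- a) = - (c *\<^sub>C (a::'a::cstar_algebra))"
  using scaleC_add_right[of c a "-a"] by (simp add: eq_neg_iff_add_eq_0 add.commute)

lemma scaleC_diff_right: "c *\<^sub>C (a - b) = c *\<^sub>C a - c *\<^sub>C (b::'a::cstar_algebra)"
  using scaleC_add_right[of c a "-b"] by (simp add: scaleC_minus_right)

lemma scaleC_minus_one [simp]: "(-1) *\<^sub>C a = - a"
  by (simp add: scaleC_minus_left)

lemma star_zero [simp]: "star (0::'a::cstar_algebra) = 0"
  using star_add[of 0 "0::'a"] by simp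

lemma star_minus: "star (- a) = - star (a::'a::cstar_algebra)"
  using star_add[of a "-a"] by (simp add: eq_neg_iff_add_eq_0 add.commute)

lemma star_diff: "star (a - b) = star a - star (b::'a::cstar_algebra)"
  using star_add[of a "-b"] by (simp add: star_minus)

lemma star_scaleR: "star (r *\<^sub>R a) = r *\<^sub>R star (a::'a::cstar_algebra)"
  by (metis scaleC_of_real star_scaleC complex_cnj_complex_of_real)

lemmas star_simps = star_add star_diff star_minus star_scaleR star_mult star_star star_scaleC

lemma norm_star [simp]: "norm (star a) = norm (a::'a::cstar_algebra)"
proof -
  have le: "norm b \<le> norm (star b)" for b :: 'a
  proof (cases "norm b = 0")
    case False
    have "(norm b)\<^sup>2 \<le> norm (star b) * norm b"
      using norm_mult_ineq[of "star b" b] by (simp add: cstar_identity)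
    then show ?thesis using False by (simp add: power2_eq_square)
  qed simp
  show ?thesis using le[of a] le[of "star a"] by (simp add: star_star)
qed

lemma cstar_identity': "norm (a * star a) = (norm (a::'a::cstar_algebra))\<^sup>2"
  using cstar_identity[of "star a"] by (simp add: star_star)

lemma continuous_on_star: "continuous_on S (star :: 'a::cstar_algebra \<Rightarrow> 'a)"
proof (rule continuous_onI)
  fix x e assume "e > (0::real)"
  then show "\<exists>d>0. \<forall>x'\<in>S. dist x' x < d \<longrightarrow> dist (star x') (star x) \<le> e"
    by (intro exI[of _ e]) (metis dist_norm norm_star star_diff less_imp_le)
qed

lemma norm_square_selfadjoint:
  "star h = h \<Longrightarrow> norm (h * h) = (norm (h::'a::cstar_algebra))\<^sup>2"
  using cstar_identity[of h] by simp

text \<open>The element \<open>k\<close> is \<open>1 - sqrt (1 - x)\<close>, expressed without a unit.\<close>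

lemma quasi_sqrt:
  fixes x :: "'a::cstar_algebra"
  assumes sa: "star x = x" and x1: "norm x < 1"
  shows "\<exists>k. star k = k \<and> norm k < 1 \<and> k + k = x + k * k \<and> (\<forall>y. y * x = x * y \<longrightarrow> y * k = k * y)"
proof -
  \<comment> \<open>\<open>r\<close> is the smaller root of r^2 - 2 r + norm x = 0, so that
    \<open>f\<close> maps the ball of radius \<open>r\<close> to itself and contracts it with the
    factor \<open>r\<close> < 1.\<close>
  define r where "r = 1 - sqrt (1 - norm x)"
  have r: "0 \<le> r" "r < 1" "norm x + r * r = 2 * r"
    using x1 by (auto simp: r_def algebra_simps)
  \<comment> \<open>Selfadjointness and commutation with everything that commutes with
    \<open>x\<close> are built into the closed set, so the fixed point has them without further
    argument.\<close>
  define S where "S = cball 0 r \<inter> {k. star k = k} \<inter> (\<Inter>y\<in>{y. y * x = x * y}. {k. y * k = k * y})"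
  define f where "f = (\<lambda>k. (1/2) *\<^sub>R (x + k * k))"
  have closed: "closed S" unfolding S_def
    by (intro closed_Int closed_cball closed_INT ballI closed_Collect_eq continuous_intros continuous_on_star)
  have ne: "0 \<in> S" using r by (auto simp: S_def)
  have fS: "f k \<in> S" if "k \<in> S" for k
  proof -
    have k: "norm k \<le> r" "star k = k" and c: "\<And>y. y * x = x * y \<Longrightarrow> y * k = k * y"
      using that by (auto simp: S_def)
    have "norm (x + k * k) \<le> norm x + norm k * norm k"
      by (meson add_left_mono norm_mult_ineq norm_triangle_le order_trans)
    also have "\<dots> \<le> norm x + r * r" using k r by (intro add_left_mono mult_mono) auto
    finally have "norm (f k) \<le> r" using r by (simp add: f_def)
    moreover have "star (f k) = f k" using k sa by (simp add: f_def star_simps)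
    moreover have "y * f k = f k * y" if "y * x = x * y" for y
    proof -
      have "y * (k * k) = (k * k) * y" using c[OF that] by (metis mult.assoc)
      then show ?thesis using that by (simp add: f_def algebra_simps)
    qed
    ultimately show ?thesis by (auto simp: S_def)
  qed
  have "\<exists>!k\<in>S. f k = k"
  proof (rule Banach_fix[OF _ _ r(1,2)])
    show "complete S" using closed by (simp add: complete_eq_closed)
    show "S \<noteq> {}" using ne by auto
    show "f ` S \<subseteq> S" using fS by auto
    fix k l assume "k \<in> S" "l \<in> S"
    then have kl: "norm k \<le> r" "norm l \<le> r" by (auto simp: S_def)
    have "f k - f l = (1/2) *\<^sub>R (k * (k - l) + (k - l) * l)" by (simp add: f_def algebra_simps)
    then have "norm (f k - f l) \<le> (norm (k * (k - l)) + norm ((k - l) * l)) / 2"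
      by (simp add: norm_triangle_ineq)
    also have "\<dots> \<le> (r * norm (k - l) + norm (k - l) * r) / 2"
      using kl r by (intro divide_right_mono add_mono order_trans[OF norm_mult_ineq] mult_mono) auto
    finally show "dist (f k) (f l) \<le> r * dist k l" by (simp add: dist_norm)
  qed
  then obtain k where k: "k \<in> S" "f k = k" by auto
  have "2 *\<^sub>R f k = x + k * k" unfolding f_def by simp
  then have "k + k = x + k * k" using k(2) by (metis scaleR_2)
  moreover have "norm k < 1" "star k = k" "\<And>y. y * x = x * y \<Longrightarrow> y * k = k * y"
    using k(1) r by (auto simp: S_def)
  ultimately show ?thesis by blast
qed

text \<open>With \<open>k\<close> from \<open>quasi_sqrt\<close>, \<open>f h + \<i> (1 - f k)\<close> acts as a unitary and has real part \<open>f h\<close>.\<close>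

lemma star_hom_contractive:
  fixes f :: "'a::cstar_algebra \<Rightarrow> 'b::cstar_algebra"
  assumes add: "\<And>a b. f (a + b) = f a + f b"
    and scale: "\<And>c a. f (c *\<^sub>C a) = c *\<^sub>C f a"
    and mult: "\<And>a b. f (a * b) = f a * f b"
    and star: "\<And>a. f (star a) = star (f a)"
  shows "norm (f a) \<le> norm a"
proof -
  have scaleR: "f (r *\<^sub>R a) = r *\<^sub>R f a" for r a by (metis scale scaleC_of_real)
  have sa: "norm (f h) \<le> 1" if h: "star h = h" and h1: "norm h < 1" for h
  proof -
    have "norm (h * h) < 1" using norm_square_selfadjoint[OF h] h1 by (simp add: abs_square_less_1)
    then obtain k where k: "star k = k" "k + k = h * h + k * k"
        and c: "\<And>y. y * (h * h) = h * h * y \<Longrightarrow> y * k = k * y"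
      using quasi_sqrt[of "h * h"] h by (metis star_mult)
    have hk: "h * k = k * h" using c[of h] by (simp add: mult.assoc)
    define H K where "H = f h" and "K = f k"
    have HK: "star H = H" "star K = K" "H * K = K * H" "K + K = H * H + K * K"
      unfolding H_def K_def using h k hk by (metis star, metis star, metis mult, metis add mult)
    define U V where "U = (\<lambda>b. H * b + \<i> *\<^sub>C (b - K * b))" and "V = (\<lambda>b. H * b - \<i> *\<^sub>C (b - K * b))"
    have *: "star (U b) * U b = star b * b" "star (V b) * V b = star b * b" for b
    proof -
      have "star (U b) * U b = star b * (H * H * b + (b - K * b) - K * (b - K * b))"
           "star (V b) * V b = star b * (H * H * b + (b - K * b) - K * (b - K * b))"
        unfolding U_def V_def
        by (simp_all add: star_simps HK(1-2) scaleC_mult_left scaleC_mult_right scaleC_scaleC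
            scaleC_minus_left scaleC_diff_right scaleC_add_right distrib_left distrib_right left_diff_distrib right_diff_distrib mult.assoc
            HK(3)[unfolded mult.assoc, symmetric])
          (simp_all flip: mult.assoc add: HK(3))
      moreover have "H * H * b + (b - K * b) - K * (b - K * b) = b + (H * H + K * K - (K + K)) * b"
        by (simp add: algebra_simps)
      ultimately show "star (U b) * U b = star b * b" "star (V b) * V b = star b * b"
        by (simp_all add: HK(4))
    qed
    \<comment> \<open>\<open>U\<close> and \<open>V\<close> are isometries; applied to
      \<open>H\<close> itself they express \<open>H * H\<close> as the mean of two elements of norm
      \<open>norm H\<close>, and no unit of the target algebra is involved.\<close>
    have UV: "norm (U b) = norm b" "norm (V b) = norm b" for b
      using *[of b] cstar_identity[of "U b"] cstar_identity[of "V b"] cstar_identity[of b] by (auto simp: power2_eq_iff_nonneg)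
    have "2 *\<^sub>R (H * H) = U H + V H" by (simp add: U_def V_def scaleR_2)
    then have "2 * norm (H * H) \<le> 2 * norm H"
      using norm_triangle_ineq[of "U H" "V H"] UV by (metis mult_2 norm_scaleR abs_numeral)
    then have "norm H * norm H \<le> 1 * norm H"
      using norm_square_selfadjoint[OF HK(1)] by (simp add: power2_eq_square)
    then show ?thesis unfolding H_def by (metis mult_right_le_imp_le norm_ge_zero order_le_less zero_le_one)
  qed
  have sa': "norm (f h) \<le> norm h" if h: "star h = h" for h
  proof (rule field_le_epsilon)
    fix e :: real assume e: "e > 0"
    define t where "t = norm h + e"
    have t: "t > 0" using e by (simp add: t_def add_nonneg_pos)
    have "norm (f ((1/t) *\<^sub>R h)) \<le> 1"
    proof (rule sa)
      show "star ((1/t) *\<^sub>R h) = (1/t) *\<^sub>R h" using h by (simp add: star_simps)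
      show "norm ((1/t) *\<^sub>R h) < 1" using t e by (simp add: t_def)
    qed
    then show "norm (f h) \<le> norm h + e" using t by (simp add: scaleR t_def field_simps)
  qed
  have "(norm (f a))\<^sup>2 \<le> (norm a)\<^sup>2"
    using sa'[of "star a * a"] by (simp add: star_simps mult star cstar_identity flip: cstar_identity)
  then show ?thesis by simp
qed


subsection \<open>Positivity in unital C*-algebras\<close>

lemma star_one [simp]: "star (1::'a::{cstar_algebra,real_normed_algebra_1}) = 1"
  by (metis mult.left_neutral mult.right_neutral star_mult star_star)

lemma star_power: "star (x ^ n) = star (x::'a::{cstar_algebra,real_normed_algebra_1}) ^ n"
  by (induction n) (auto simp: star_mult power_commutes)

text \<open>The C*-identity gives the equality for exponents 2^m; any \<open>n\<close> is then
  squeezed by factoring h^(2^n) as h^n times h^(2^n - n).\<close>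

lemma norm_power_selfadjoint:
  fixes h :: "'a::{cstar_algebra,real_normed_algebra_1}"
  assumes h: "star h = h"
  shows "norm (h ^ n) = norm h ^ n"
proof -
  have 2: "norm (h ^ (2 ^ m)) = norm h ^ (2 ^ m)" for m
  proof (induction m)
    case (Suc m)
    have "h ^ (2 ^ Suc m) = h ^ (2 ^ m) * h ^ (2 ^ m)"
      by (simp only: power_Suc mult_2 power_add)
    then have "norm (h ^ (2 ^ Suc m)) = (norm (h ^ (2 ^ m)))\<^sup>2"
      using norm_square_selfadjoint[of "h ^ (2 ^ m)"] h by (simp only: star_power)
    also have "\<dots> = norm h ^ (2 ^ m * 2)" by (simp only: Suc power_mult)
    finally show ?case by (simp only: power_Suc2)
  qed simp
  show ?thesis
  proof (cases "norm h = 0")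
    case False
    have n: "n < 2 ^ n" by simp
    have "norm h ^ (2 ^ n) = norm (h ^ n * h ^ (2 ^ n - n))"
      using n by (simp add: 2[symmetric] flip: power_add)
    also have "\<dots> \<le> norm (h ^ n) * norm h ^ (2 ^ n - n)"
      by (intro order_trans[OF norm_mult_ineq] mult_left_mono norm_power_ineq) auto
    finally have "norm h ^ n * norm h ^ (2 ^ n - n) \<le> norm (h ^ n) * norm h ^ (2 ^ n - n)"
      using n by (simp flip: power_add)
    then have "norm h ^ n \<le> norm (h ^ n)" using False by (simp add: mult_le_cancel_right)
    then show ?thesis using norm_power_ineq[of h n] by linarith
  qed (cases n; simp)
qed

text \<open>For selfadjoint \<open>h\<close> the inequality says that the spectrum lies in the open
  interval from 0 to 2 t, so these are the invertible positive elements. In this form sums are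
  handled by the triangle inequality alone.\<close>

definition spos :: "'a::{cstar_algebra,real_normed_algebra_1} \<Rightarrow> bool" where
  "spos h \<longleftrightarrow> star h = h \<and> (\<exists>t. norm (t *\<^sub>R 1 - h) < t)"

definition pos :: "'a::{cstar_algebra,real_normed_algebra_1} \<Rightarrow> bool" where
  "pos x \<longleftrightarrow> star x = x \<and> (\<forall>\<epsilon>>0. spos (x + \<epsilon> *\<^sub>R 1))"

lemma pos_star: "pos x \<Longrightarrow> star x = x"
  by (simp add: pos_def)

lemma spos_add: assumes "spos g" "spos h" shows "spos (g + h)"
proof -
  obtain s t where "norm (s *\<^sub>R 1 - g) < s" "norm (t *\<^sub>R 1 - h) < t"
    using assms by (auto simp: spos_def)
  moreover have "(s + t) *\<^sub>R 1 - (g + h) = (s *\<^sub>R 1 - g) + (t *\<^sub>R 1 - h)" by (simp add: algebra_simps)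
  ultimately have "norm ((s + t) *\<^sub>R 1 - (g + h)) < s + t"
    by (metis norm_triangle_lt add_strict_mono)
  then show ?thesis using assms by (auto simp: spos_def star_simps)
qed

lemma spos_scaleR: assumes "spos h" "r > 0" shows "spos (r *\<^sub>R h)"
proof -
  obtain t where "norm (t *\<^sub>R 1 - h) < t" using assms by (auto simp: spos_def)
  then have "norm (r *\<^sub>R (t *\<^sub>R 1 - h)) < r * t" using assms by simp
  then have "norm ((r * t) *\<^sub>R 1 - r *\<^sub>R h) < r * t" by (simp add: scaleR_diff_right)
  then show ?thesis using assms by (auto simp: spos_def star_simps)
qed

lemma spos_of_real: "r > 0 \<Longrightarrow> spos (r *\<^sub>R 1)"
  unfolding spos_def by (auto simp: star_simps intro!: exI[of _ r])

lemma spos_imp_pos: "spos h \<Longrightarrow> pos h"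
  by (simp add: pos_def spos_add spos_of_real) (simp add: spos_def)

lemma pos_add: assumes "pos x" "pos y" shows "pos (x + y)"
proof -
  have "spos ((x + (\<epsilon>/2) *\<^sub>R 1) + (y + (\<epsilon>/2) *\<^sub>R 1))" if "\<epsilon> > 0" for \<epsilon>
    by (rule spos_add) (use assms that in \<open>simp_all add: pos_def\<close>)
  moreover have "(x + (\<epsilon>/2) *\<^sub>R 1) + (y + (\<epsilon>/2) *\<^sub>R 1) = x + y + \<epsilon> *\<^sub>R 1" for \<epsilon>
    by (simp add: algebra_simps flip: scaleR_add_left)
  ultimately show ?thesis using assms by (auto simp: pos_def star_simps)
qed

lemma pos_scaleR: assumes "pos x" "r \<ge> 0" shows "pos (r *\<^sub>R x)"
proof (cases "r = 0")
  case False
  have "spos (r *\<^sub>R (x + (\<epsilon>/r) *\<^sub>R 1))" if "\<epsilon> > 0" for \<epsilon>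
    using assms that False by (intro spos_scaleR) (auto simp: pos_def)
  then show ?thesis using assms False by (auto simp: pos_def star_simps scaleR_add_right)
qed (simp add: pos_def spos_of_real)

lemma pos_zero [simp]: "pos 0"
  by (simp add: pos_def spos_of_real)

lemma pos_of_real: "r \<ge> 0 \<Longrightarrow> pos (r *\<^sub>R 1)"
  using pos_scaleR[OF spos_imp_pos[OF spos_of_real[of 1]], of r] by simp

lemma pos_of_norm:
  assumes "star e = e" "norm e \<le> d"
  shows "pos (d *\<^sub>R 1 + e)" "pos (d *\<^sub>R 1 - e)"
proof -
  have *: "pos (d *\<^sub>R 1 + e)" if "star e = e" "norm e \<le> d" for e :: 'a
  proof -
    have "spos (d *\<^sub>R 1 + e + \<epsilon> *\<^sub>R 1)" if "\<epsilon> > 0" for \<epsilon>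
      unfolding spos_def using that \<open>star e = e\<close> \<open>norm e \<le> d\<close>
      by (auto simp: star_simps algebra_simps intro!: exI[of _ "d + \<epsilon>"])
    then show ?thesis using that by (simp add: pos_def star_simps)
  qed
  show "pos (d *\<^sub>R 1 + e)" "pos (d *\<^sub>R 1 - e)"
    using *[of e] *[of "-e"] assms by (auto simp: star_simps)
qed

text \<open>x + \<epsilon> is the sum of y + \<epsilon>/4 and \<epsilon>/2 - (y - x) + \<epsilon>/4:
  the half absorbs the distance, and the quarters keep both summands strictly positive.\<close>

lemma pos_limit:
  assumes x: "star x = x" and lim: "\<And>\<epsilon>. \<epsilon> > 0 \<Longrightarrow> \<exists>y. norm (y - x) \<le> \<epsilon> \<and> pos y"
  shows "pos x"
  unfolding pos_def
proof (intro conjI allI impI x)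
  fix \<epsilon> :: real assume "\<epsilon> > 0"
  then obtain y where y: "norm (y - x) \<le> \<epsilon>/2" "pos y" using lim[of "\<epsilon>/2"] by auto
  have "spos (y + (\<epsilon>/4) *\<^sub>R 1)" using y \<open>\<epsilon> > 0\<close> by (simp add: pos_def)
  moreover have "pos ((\<epsilon>/2) *\<^sub>R 1 - (y - x))"
    using y x by (intro pos_of_norm) (auto simp: star_simps pos_star)
  then have "spos ((\<epsilon>/2) *\<^sub>R 1 - (y - x) + (\<epsilon>/4) *\<^sub>R 1)" using \<open>\<epsilon> > 0\<close> by (simp add: pos_def)
  ultimately have "spos ((y + (\<epsilon>/4) *\<^sub>R 1) + ((\<epsilon>/2) *\<^sub>R 1 - (y - x) + (\<epsilon>/4) *\<^sub>R 1))"
    by (rule spos_add)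
  moreover have "(y + (\<epsilon>/4) *\<^sub>R 1) + ((\<epsilon>/2) *\<^sub>R 1 - (y - x) + (\<epsilon>/4) *\<^sub>R 1) = x + \<epsilon> *\<^sub>R 1"
    by (simp add: algebra_simps flip: scaleR_add_left)
  ultimately show "spos (x + \<epsilon> *\<^sub>R 1)" by simp
qed

text \<open>Write h = t (1 - x) with norm x < 1; then 1 - k with \<open>k\<close> from
  \<open>quasi_sqrt\<close> squares to 1 - x.\<close>

lemma spos_sqrt:
  assumes "spos h"
  shows "\<exists>v. star v = v \<and> v * v = h \<and> spos v \<and> (\<forall>y. y * h = h * y \<longrightarrow> y * v = v * y)"
proof -
  obtain t where h: "star h = h" and t: "norm (t *\<^sub>R 1 - h) < t" using assms by (auto simp: spos_def)
  have t0: "t > 0" using t norm_ge_zero[of "t *\<^sub>R 1 - h"] by linarith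
  define x where "x = (1/t) *\<^sub>R (t *\<^sub>R 1 - h)"
  have "star x = x" using h by (simp add: x_def star_simps)
  moreover have "norm x < 1" using t t0 by (simp add: x_def)
  ultimately obtain k where k: "star k = k" "norm k < 1" "k + k = x + k * k"
    "\<And>y. y * x = x * y \<Longrightarrow> y * k = k * y" using quasi_sqrt by blast
  define v where "v = sqrt t *\<^sub>R (1 - k)"
  have "v * v = t *\<^sub>R (1 - (k + k) + k * k)" using t0 by (simp add: v_def algebra_simps)
  also have "\<dots> = t *\<^sub>R (1 - x)" by (simp add: k(3))
  also have "\<dots> = h" using t0 by (simp add: x_def algebra_simps)
  finally have vv: "v * v = h" .
  have sv: "star v = v" using k(1) by (simp add: v_def star_simps)
  have "norm (sqrt t *\<^sub>R 1 - v) < sqrt t" using k(2) t0 by (simp add: v_def algebra_simps)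
  then have spv: "spos v" using sv by (auto simp: spos_def)
  have "y * v = v * y" if "y * h = h * y" for y
  proof -
    have "y * x = x * y" using that by (simp add: x_def algebra_simps)
    then show ?thesis using k(4)[of y] by (simp add: v_def algebra_simps)
  qed
  then show ?thesis using vv sv spv by blast
qed

text \<open>The square roots \<open>w\<close> of d + e + \<epsilon> and \<open>v\<close> of d - e +
  \<epsilon> commute, so u = w + i v has u* u = 2 (d + \<epsilon>), while u u + u* u* = 4 e. The
  C*-identity then bounds 4 norm e by 4 (d + \<epsilon>).\<close>

lemma norm_le_of_pos:
  assumes "pos (d *\<^sub>R 1 - e)" "pos (d *\<^sub>R 1 + e)" "d \<ge> 0"
  shows "norm e \<le> d"
proof (rule field_le_epsilon)
  fix \<epsilon> :: real assume "\<epsilon> > 0"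
  obtain v where v: "star v = v" "v * v = d *\<^sub>R 1 - e + \<epsilon> *\<^sub>R 1"
    and cv: "\<And>y. y * (d *\<^sub>R 1 - e + \<epsilon> *\<^sub>R 1) = (d *\<^sub>R 1 - e + \<epsilon> *\<^sub>R 1) * y \<Longrightarrow> y * v = v * y"
    using assms(1) \<open>\<epsilon> > 0\<close> spos_sqrt unfolding pos_def by blast
  obtain w where w: "star w = w" "w * w = d *\<^sub>R 1 + e + \<epsilon> *\<^sub>R 1"
    and cw: "\<And>y. y * (d *\<^sub>R 1 + e + \<epsilon> *\<^sub>R 1) = (d *\<^sub>R 1 + e + \<epsilon> *\<^sub>R 1) * y \<Longrightarrow> y * w = w * y"
    using assms(2) \<open>\<epsilon> > 0\<close> spos_sqrt unfolding pos_def by blast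
  have "e * v = v * e" by (rule cv) (simp add: algebra_simps)
  then have vw: "v * w = w * v" by (intro cw) (simp add: algebra_simps)
  define u where "u = w + \<i> *\<^sub>C v"
  have su: "star u = w - \<i> *\<^sub>C v" using v w by (simp add: u_def star_simps scaleC_minus_left)
  have "star u * u = w * w + v * v"
    by (subst su) (simp add: u_def algebra_simps scaleC_mult_left scaleC_mult_right scaleC_scaleC scaleC_diff_right scaleC_add_right vw)
  also have "\<dots> = (2 * (d + \<epsilon>)) *\<^sub>R 1" by (simp add: v w algebra_simps scaleR_2 flip: scaleR_add_left)
  finally have "norm (star u * u) = 2 * (d + \<epsilon>)" using assms \<open>\<epsilon> > 0\<close> by simp
  then have nu: "norm u * norm u = 2 * (d + \<epsilon>)" by (simp add: cstar_identity power2_eq_square)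
  have "u * u + star u * star u = 2 *\<^sub>R (w * w - v * v)"
    by (simp only: su, simp only: u_def)
      (simp add: algebra_simps scaleC_mult_left scaleC_mult_right scaleC_scaleC scaleC_diff_right scaleC_add_right vw scaleR_2)
  also have "w * w - v * v = 2 *\<^sub>R e" by (simp add: v w scaleR_2)
  finally have "4 * norm e = norm (u * u + star u * star u)" by simp
  also have "\<dots> \<le> norm u * norm u + norm (star u) * norm (star u)"
    by (intro norm_triangle_le add_mono norm_mult_ineq)
  finally show "norm e \<le> d + \<epsilon>" using nu by simp
qed

text \<open>After scaling, u = g + i v with v^2 = 1 - g^2 satisfies u* u = 1. Its imaginary part
  \<open>v\<close> therefore has norm at most 1, hence so has 1 - g^2, and g^2 lies within distance
  1 of the unit.\<close>

lemma pos_square: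
  assumes h: "star h = h" shows "pos (h * h)"
proof -
  define s where "s = norm h + 1"
  have s: "s > 0" by (simp add: s_def add_nonneg_pos)
  define g where "g = (1/s) *\<^sub>R h"
  have g: "star g = g" using h by (simp add: g_def star_simps)
  have "norm g < 1" using s by (simp add: g_def s_def)
  then have gg: "norm (g * g) < 1" using norm_square_selfadjoint[OF g] by (simp add: abs_square_less_1)
  have "spos (1 - g * g)" unfolding spos_def using gg g by (auto simp: star_simps intro!: exI[of _ 1])
  then obtain v where v: "star v = v" "v * v = 1 - g * g" and cv: "\<And>y. y * (1 - g * g) = (1 - g * g) * y \<Longrightarrow> y * v = v * y"
    using spos_sqrt by blast
  have gv: "g * v = v * g" by (rule cv) (simp add: algebra_simps)
  define u where "u = g + \<i> *\<^sub>C v"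
  have su: "star u = g - \<i> *\<^sub>C v" using g v by (simp add: u_def star_simps scaleC_minus_left)
  have "star u * u = g * g + v * v"
    by (subst su) (simp add: u_def algebra_simps scaleC_mult_left scaleC_mult_right scaleC_scaleC scaleC_diff_right scaleC_add_right gv)
  then have "star u * u = 1" using v by simp
  then have "(norm u)\<^sup>2 = 1" by (metis cstar_identity norm_one)
  then have "norm u = 1" using norm_ge_zero[of u] by (auto simp: power2_eq_1_iff simp del: norm_ge_zero)
  have "u - star u = \<i> *\<^sub>C v + \<i> *\<^sub>C v" by (simp only: su) (simp add: u_def)
  also have "\<dots> = 2 *\<^sub>R (\<i> *\<^sub>C v)" by (simp add: scaleR_2)
  finally have "norm (u - star u) = 2 * norm v" by (simp add: norm_scaleC)
  then have "2 * norm v \<le> norm u + norm (star u)" by (metis norm_triangle_ineq4)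
  then have "norm v \<le> 1" using \<open>norm u = 1\<close> by simp
  then have nv: "norm (1 - g * g) \<le> 1" using norm_square_selfadjoint[OF v(1)] v(2) by (simp add: abs_square_le_1)
  have "pos (1 *\<^sub>R 1 - (1 - g * g))" by (rule pos_of_norm(2)) (use g nv in \<open>auto simp: star_simps\<close>)
  then have "pos (g * g)" by simp
  then have "pos ((s * s) *\<^sub>R (g * g))" by (rule pos_scaleR) simp
  then show ?thesis using s by (simp add: g_def)
qed

text \<open>Stands in for the fact that c c* and c* c have the same nonzero spectrum. From c D = E c
  one gets E^(n+1) = s E^n + c D^n c*, so norm E^n (norm E - s) grows at most like norm D^n; this is
  absurd when norm E exceeds both \<open>s\<close> and norm D.\<close>

lemma norm_shift_star_swap:
  fixes c :: "'a::{cstar_algebra,real_normed_algebra_1}"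
  assumes s: "s \<ge> 0"
  shows "norm (s *\<^sub>R 1 + c * star c) \<le> max s (norm (s *\<^sub>R 1 + star c * c))"
proof (rule ccontr)
  define E D where "E = s *\<^sub>R 1 + c * star c" and "D = s *\<^sub>R 1 + star c * c"
  assume "\<not> norm (s *\<^sub>R 1 + c * star c) \<le> max s (norm (s *\<^sub>R 1 + star c * c))"
  then have gt: "norm E > s" "norm E > norm D" by (auto simp: E_def D_def)
  have sE: "star E = E" by (simp add: E_def star_simps)
  have cDE: "c * D = E * c" by (simp add: D_def E_def algebra_simps)
  have cD: "c * D ^ n = E ^ n * c" for n
  proof (induction n)
    case (Suc n)
    have "c * D ^ Suc n = (c * D) * D ^ n" by (simp add: mult.assoc)
    also have "\<dots> = E * (c * D ^ n)" by (simp add: cDE mult.assoc)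
    finally show ?case by (simp add: Suc.IH mult.assoc)
  qed simp
  have le: "norm E ^ n * (norm E - s) \<le> norm c * norm c * norm D ^ n" for n
  proof -
    have "E ^ Suc n = E ^ n * E" by (rule power_Suc2)
    also have "\<dots> = s *\<^sub>R E ^ n + c * D ^ n * star c"
      by (subst (2) E_def) (simp add: cD algebra_simps)
    finally have "norm (E ^ Suc n) = norm (s *\<^sub>R E ^ n + c * D ^ n * star c)"
      by (rule arg_cong)
    also have "\<dots> \<le> s * norm (E ^ n) + norm (c * D ^ n * star c)"
      by (rule norm_triangle_le) (use s in simp)
    finally have "norm (E ^ Suc n) \<le> s * norm (E ^ n) + norm (c * D ^ n * star c)" .
    then have "norm E ^ Suc n \<le> s * norm E ^ n + norm (c * D ^ n * star c)"
      by (simp only: norm_power_selfadjoint[OF sE])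
    also have "norm (c * D ^ n * star c) \<le> norm c * norm D ^ n * norm c"
      using norm_mult_ineq[of "c * D ^ n" "star c"] norm_mult_ineq[of c "D ^ n"] norm_power_ineq[of D n]
      by (auto intro!: mult_right_mono mult_left_mono elim!: order_trans)
    finally show ?thesis by (simp add: algebra_simps)
  qed
  have "norm E - s \<le> norm c * norm c * (norm D / norm E) ^ n" for n
  proof -
    have "norm E ^ n > 0" using gt(1) s by (intro zero_less_power) linarith
    then have "norm E - s \<le> norm c * norm c * norm D ^ n / norm E ^ n"
      using le[of n] by (simp add: pos_le_divide_eq mult.commute)
    then show ?thesis by (simp add: power_divide)
  qed
  moreover have "(\<lambda>n. norm c * norm c * (norm D / norm E) ^ n) \<longlonglongrightarrow> norm c * norm c * 0"
  proof (rule tendsto_mult_left[OF LIMSEQ_realpow_zero])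
    have "norm E > 0" using gt(1) s by linarith
    then show "norm D / norm E < 1" using gt(2) by (simp only: divide_less_eq_1_pos)
  qed simp
  ultimately have "norm E - s \<le> norm c * norm c * 0"
    by (intro LIMSEQ_le_const) auto
  then show False using gt by simp
qed

text \<open>
  Kelley and Vaught: with \<open>y\<close> close to \<open>\<bar>x\<bar>\<close>, twice the negative part of \<open>x = b* b\<close> is close to
  \<open>q = y - x\<close>, and \<open>c = b q\<close> has \<open>c* c\<close> almost negative. As \<open>c c* + c* c\<close> is positive,
  \<open>c c*\<close> is almost positive; having essentially the spectrum of \<open>c* c\<close>, it is small.
\<close>

lemma pos_star_mult: "pos (star b * (b::'a::{cstar_algebra,real_normed_algebra_1}))"
proof -
  define x where "x = star b * b"
  have sx: "star x = x" by (simp add: x_def star_simps)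
  have "pos (x + \<delta> *\<^sub>R 1)" if \<delta>: "\<delta> > 0" for \<delta>
  proof -
    \<comment> \<open>The left-hand side of the second inequality is the coefficient of
      \<open>norm q\<close> in the final estimate of (norm q)^2 under the assumption norm q >
      \<delta>; being below \<delta>, it refutes that assumption.\<close>
    obtain \<epsilon> where \<epsilon>: "\<epsilon> > 0" "\<epsilon>\<^sup>2 / \<delta> + 2 * norm b * \<epsilon> / sqrt \<delta> < \<delta>"
    proof -
      define s K r where "s = sqrt \<delta>" and "K = 1 + s + 2 * norm b" and "r = s\<^sup>2 / K"
      have s: "s > 0" "\<delta> = s * s" using \<delta> by (simp_all add: s_def)
      have K: "K > s" "K > 0" using s by (simp_all add: K_def add_pos_nonneg)
      have r: "r > 0" "r * K = s * s" using s K by (simp_all add: r_def power2_eq_square)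
      have "r \<le> s" using s K by (simp add: r_def power2_eq_square field_simps)
      then have "r * (r + 2 * norm b) < r * K" using r by (intro mult_strict_left_mono) (simp_all add: K_def)
      then have "(r * s)\<^sup>2 / \<delta> + 2 * norm b * (r * s) / sqrt \<delta> < \<delta>"
        using s r by (simp add: power2_eq_square algebra_simps flip: s_def)
      then show thesis using that[of "r * s"] r s by simp
    qed
    have "spos (x * x + \<epsilon>\<^sup>2 *\<^sub>R 1)" using pos_square[OF sx] \<epsilon> by (simp add: pos_def)
    then obtain y where y: "star y = y" "y * y = x * x + \<epsilon>\<^sup>2 *\<^sub>R 1" "spos y"
      and cy: "\<And>z. z * (x * x + \<epsilon>\<^sup>2 *\<^sub>R 1) = (x * x + \<epsilon>\<^sup>2 *\<^sub>R 1) * z \<Longrightarrow> z * y = y * z"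
      using spos_sqrt by blast
    have xy: "x * y = y * x" by (rule cy) (simp add: algebra_simps)
    define q where "q = y - x"
    have sq: "star q = q" by (simp add: q_def star_simps sx y)
    have qxy: "q * x = x * q" "q * y = y * q" by (simp_all add: q_def algebra_simps xy)
    have qx: "q * x = \<epsilon>\<^sup>2 *\<^sub>R 1 - q * y"
    proof -
      have "q * x + q * y = y * y - x * x" by (simp add: q_def algebra_simps xy)
      then show ?thesis by (simp add: y(2) eq_diff_eq)
    qed
    define c where "c = b * q"
    have cc: "star c * c = \<epsilon>\<^sup>2 *\<^sub>R q - q * q * y"
    proof -
      have "star c * c = q * (x * q)" by (simp add: c_def x_def star_simps sq mult.assoc)
      also have "x * q = \<epsilon>\<^sup>2 *\<^sub>R 1 - q * y" using qx qxy by simp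
      finally show ?thesis by (simp add: algebra_simps)
    qed
    define d where "d = \<epsilon>\<^sup>2 * norm q"
    have d0: "d \<ge> 0" by (simp add: d_def)
    \<comment> \<open>A square root of \<open>y\<close> that commutes with \<open>q\<close> exhibits
      q q y as the square of q z.\<close>
    obtain z where z: "star z = z" "z * z = y" and cz: "\<And>w. w * y = y * w \<Longrightarrow> w * z = z * w"
      using spos_sqrt[OF y(3)] by blast
    have qz: "q * z = z * q" using cz qxy by blast
    have "pos ((q * z) * (q * z))" by (rule pos_square) (simp add: star_simps sq z qz)
    moreover have "(q * z) * (q * z) = q * (z * q) * z" by (simp only: mult.assoc)
    moreover have "\<dots> = q * q * y" by (simp only: qz[symmetric] z(2)[symmetric] mult.assoc)
    ultimately have p1: "pos (q * q * y)" by (simp only:)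
    have "pos (norm q *\<^sub>R 1 - q)" by (rule pos_of_norm) (auto simp: sq)
    then have "pos (\<epsilon>\<^sup>2 *\<^sub>R (norm q *\<^sub>R 1 - q))" by (rule pos_scaleR) simp
    then have "pos (\<epsilon>\<^sup>2 *\<^sub>R (norm q *\<^sub>R 1 - q) + q * q * y)" using p1 by (rule pos_add)
    moreover have "\<epsilon>\<^sup>2 *\<^sub>R (norm q *\<^sub>R 1 - q) + q * q * y = d *\<^sub>R 1 - star c * c"
      unfolding cc d_def by (simp add: scaleR_diff_right)
    ultimately have p2: "pos (d *\<^sub>R 1 - star c * c)" by simp
    have p3: "pos (c * star c + star c * c)"
    proof -
      define r m where "r = c + star c" and "m = \<i> *\<^sub>C (c - star c)"
      have "star r = r" "star m = m"
        by (simp_all add: r_def m_def star_simps scaleC_minus_left scaleC_diff_right)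
      then have "pos (r * r + m * m)" by (intro pos_add pos_square)
      moreover have "r * r + m * m = 2 *\<^sub>R (c * star c + star c * c)"
      proof -
        have m: "m * m = - ((c - star c) * (c - star c))"
          unfolding m_def scaleC_mult_left scaleC_mult_right scaleC_scaleC by simp
        show ?thesis unfolding m by (simp add: r_def algebra_simps scaleR_2)
      qed
      ultimately have "pos (2 *\<^sub>R (c * star c + star c * c))" by simp
      from pos_scaleR[OF this, of "1/2"] show ?thesis by simp
    qed
    have p4: "pos (d *\<^sub>R 1 + c * star c)" using pos_add[OF p2 p3] by simp
    \<comment> \<open>With this shift s + c* c is positive, so its upper bound s + d becomes a norm
      bound, and norms are what \<open>norm_shift_star_swap\<close> can transfer to s + c
      c*.\<close>
    define s where "s = (norm c)\<^sup>2"
    have s0: "s \<ge> 0" by (simp add: s_def)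
    have "pos (s *\<^sub>R 1 + star c * c)"
      by (rule pos_of_norm) (auto simp: star_simps s_def cstar_identity)
    then have "pos ((s *\<^sub>R 1 + star c * c) + (s + d) *\<^sub>R 1)"
      by (rule pos_add) (use s0 d0 in \<open>simp add: pos_of_real\<close>)
    then have "pos ((s + d) *\<^sub>R 1 + (s *\<^sub>R 1 + star c * c))" by (simp only: add.commute)
    note 1 = this
    have shift: "(s + d) *\<^sub>R 1 - (s *\<^sub>R 1 + b) = d *\<^sub>R 1 - b" for b :: 'a
      by (simp add: scaleR_add_left)
    have "pos ((s + d) *\<^sub>R 1 - (s *\<^sub>R 1 + star c * c))" using p2 by (simp only: shift)
    then have "norm (s *\<^sub>R 1 + star c * c) \<le> s + d"
      by (rule norm_le_of_pos[OF _ 1]) (use s0 d0 in simp)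
    then have "norm (s *\<^sub>R 1 + c * star c) \<le> s + d"
      using norm_shift_star_swap[OF s0, of c] d0 by linarith
    then have "pos ((s + d) *\<^sub>R 1 - (s *\<^sub>R 1 + c * star c))"
      by (rule pos_of_norm(2)[rotated]) (simp add: star_simps)
    then have "pos (d *\<^sub>R 1 - c * star c)" by (simp only: shift)
    then have "norm (c * star c) \<le> d" by (rule norm_le_of_pos[OF _ p4 d0])
    then have "(norm c)\<^sup>2 \<le> \<epsilon>\<^sup>2 * norm q" by (simp add: cstar_identity' d_def)
    then have nc: "norm c \<le> \<epsilon> * sqrt (norm q)"
      using \<epsilon> by (intro power2_le_imp_le[of "norm c"]) (auto simp: power_mult_distrib)
    have "q * q = \<epsilon>\<^sup>2 *\<^sub>R 1 - 2 *\<^sub>R (star b * c)"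
    proof -
      have "q * q = q * y - q * x" by (simp add: q_def right_diff_distrib)
      also have "q * y = \<epsilon>\<^sup>2 *\<^sub>R 1 - q * x" using qx by simp
      also have "q * x = star b * c" by (simp add: qxy(1)) (simp add: x_def c_def mult.assoc)
      finally show ?thesis by (simp add: scaleR_2)
    qed
    then have "norm (q * q) \<le> \<epsilon>\<^sup>2 + 2 * norm (star b * c)"
      using norm_triangle_ineq4[of "\<epsilon>\<^sup>2 *\<^sub>R 1" "2 *\<^sub>R (star b * c)"] by simp
    also have "norm (star b * c) \<le> norm b * (\<epsilon> * sqrt (norm q))"
      using nc by (intro order_trans[OF norm_mult_ineq] mult_mono) auto
    finally have Q: "(norm q)\<^sup>2 \<le> \<epsilon>\<^sup>2 + 2 * norm b * \<epsilon> * sqrt (norm q)"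
      using norm_square_selfadjoint[OF sq] by simp
    have "norm q \<le> \<delta>"
    proof (rule ccontr)
      assume *: "\<not> norm q \<le> \<delta>"
      have "sqrt (norm q) * sqrt \<delta> \<le> sqrt (norm q) * sqrt (norm q)" using * \<delta> by (intro mult_left_mono) auto
      then have "sqrt (norm q) \<le> norm q / sqrt \<delta>" using \<delta> by (simp add: field_simps)
      moreover have "1 \<le> norm q / \<delta>" using * \<delta> by simp
      ultimately have "\<epsilon>\<^sup>2 * 1 + (2 * norm b * \<epsilon>) * sqrt (norm q) \<le> \<epsilon>\<^sup>2 * (norm q / \<delta>) + (2 * norm b * \<epsilon>) * (norm q / sqrt \<delta>)"
        using \<epsilon> by (intro add_mono mult_left_mono) auto
      also have "\<dots> = (\<epsilon>\<^sup>2 / \<delta> + 2 * norm b * \<epsilon> / sqrt \<delta>) * norm q"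
        by (simp only: distrib_right times_divide_eq_left times_divide_eq_right)
      also have "\<dots> < \<delta> * norm q"
        by (rule mult_strict_right_mono[OF \<epsilon>(2)]) (use * \<delta> in linarith)
      also have "\<dots> \<le> norm q * norm q"
        by (rule mult_right_mono) (use * in auto)
      finally show False using Q unfolding power2_eq_square[of "norm q"] by linarith
    qed
    \<comment> \<open>x + \<delta> equals y + (\<delta> - q), a sum of two positive
      elements.\<close>
    then have "pos (y + (\<delta> *\<^sub>R 1 - q))"
      by (intro pos_add[OF spos_imp_pos[OF y(3)]] pos_of_norm(2)[OF sq])
    then show ?thesis by (simp add: q_def algebra_simps)
  qed
  then have "\<exists>y. norm (y - x) \<le> \<epsilon> \<and> pos y" if "\<epsilon> > 0" for \<epsilon>
    using that by (intro exI[of _ "x + \<epsilon> *\<^sub>R 1"]) simp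
  then show ?thesis unfolding x_def[symmetric] using sx by (intro pos_limit)
qed

text \<open>For e > 0 the element h + e is a square v v with \<open>v\<close> selfadjoint, so
  conjugating it by \<open>c\<close> gives star (v c) times v c, which is positive; let e tend to
  0.\<close>

lemma pos_conj:
  assumes "pos h" shows "pos (star c * h * c)"
proof (rule pos_limit)
  show "star (star c * h * c) = star c * h * c" using assms by (simp add: star_simps pos_star mult.assoc)
  fix \<epsilon> :: real assume \<epsilon>: "\<epsilon> > 0"
  define e where "e = \<epsilon> / (norm c * norm c + 1)"
  have n: "norm c * norm c + 1 > 0" by (simp add: add_nonneg_pos)
  have e: "e > 0" using \<epsilon> n by (simp add: e_def)
  obtain v where v: "star v = v" "v * v = h + e *\<^sub>R 1"
    using assms e spos_sqrt unfolding pos_def by blast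
  have "pos (star (v * c) * (v * c))" by (rule pos_star_mult)
  moreover have "star (v * c) * (v * c) = star c * (v * v) * c" by (simp add: star_simps v(1) mult.assoc)
  moreover have "star c * (v * v) * c - star c * h * c = e *\<^sub>R (star c * c)" by (simp add: v algebra_simps)
  moreover have "norm (e *\<^sub>R (star c * c)) \<le> \<epsilon>"
    using e \<epsilon> n by (simp add: cstar_identity power2_eq_square e_def divide_simps)
  ultimately show "\<exists>y. norm (y - star c * h * c) \<le> \<epsilon> \<and> pos y"
    by (intro exI[of _ "star c * (v * v) * c"]) simp
qed

lemma pos_norm_mono:
  assumes "pos x" "pos (y - x)" shows "norm x \<le> norm y"
proof (rule norm_le_of_pos)
  have "star y = y" using assms by (metis diff_add_cancel pos_star star_add)
  then have "pos (norm y *\<^sub>R 1 - y)" by (intro pos_of_norm) auto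
  from pos_add[OF this assms(2)] show "pos (norm y *\<^sub>R 1 - x)" by (simp add: algebra_simps)
  have "pos (norm y *\<^sub>R (1::'a))" by (simp add: pos_of_real)
  from pos_add[OF this assms(1)] show "pos (norm y *\<^sub>R 1 + x)" .
qed simp


subsection \<open>The unitization\<close>

datatype 'a unitization = Unitization (scalar: complex) (element: 'a)

lemma unitization_eqI: "scalar x = scalar y \<Longrightarrow> element x = element y \<Longrightarrow> x = y"
  by (cases x; cases y) simp

instantiation unitization :: (cstar_algebra) real_algebra_1
begin
definition "0 = Unitization 0 0"
definition "1 = Unitization 1 0"
definition "x + y = Unitization (scalar x + scalar y) (element x + element y)"
definition "x - y = Unitization (scalar x - scalar y) (element x - element y)"
definition "- x = Unitization (- scalar x) (- element x)"
definition "x * y = Unitization (scalar x * scalar y)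
  (scalar x *\<^sub>C element y + scalar y *\<^sub>C element x + element x * element y)"
definition "r *\<^sub>R x = Unitization (r *\<^sub>R scalar x) (r *\<^sub>R element x)"

lemma unitization_sel [simp]:
  "scalar 0 = 0" "scalar 1 = 1" "scalar (x + y) = scalar x + scalar y"
  "scalar (x - y) = scalar x - scalar y" "scalar (- x) = - scalar x"
  "scalar (x * y) = scalar x * scalar y" "scalar (r *\<^sub>R x) = r *\<^sub>R scalar x"
  "element 0 = 0" "element 1 = 0" "element (x + y) = element x + element y"
  "element (x - y) = element x - element y" "element (- x) = - element x"
  "element (x * y) = scalar x *\<^sub>C element y + scalar y *\<^sub>C element x + element x * element y"
  "element (r *\<^sub>R x) = r *\<^sub>R element x"
  for x y :: "'a unitization"
  by (simp_all add: zero_unitization_def one_unitization_def plus_unitization_def minus_unitization_def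
      uminus_unitization_def times_unitization_def scaleR_unitization_def)

lemma scaleR_scaleC_commute: "r *\<^sub>R c *\<^sub>C a = c *\<^sub>C r *\<^sub>R (a::'b::cstar_algebra)"
  by (simp add: scaleC_scaleC mult.commute flip: scaleC_of_real)

lemma scaleC_scaleR_left: "(r *\<^sub>R c) *\<^sub>C a = r *\<^sub>R c *\<^sub>C (a::'b::cstar_algebra)"
  by (simp add: scaleC_scaleC scaleR_conv_of_real flip: scaleC_of_real)

instance
  by standard (rule unitization_eqI;
    simp add: algebra_simps scaleC_add_left scaleC_add_right scaleC_scaleC scaleC_mult_left scaleC_mult_right
      scaleC_scaleR_left scaleR_scaleC_commute | simp add: zero_unitization_def one_unitization_def)+

end

definition umult :: "'a::cstar_algebra unitization \<Rightarrow> 'a \<Rightarrow> 'a" where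
  "umult x b = scalar x *\<^sub>C b + element x * b"

lemma bounded_linear_umult: "bounded_linear (umult x)"
proof (rule bounded_linear_intro)
  fix b
  have "norm (umult x b) \<le> norm (scalar x *\<^sub>C b) + norm (element x * b)"
    unfolding umult_def by (rule norm_triangle_ineq)
  also have "\<dots> \<le> cmod (scalar x) * norm b + norm (element x) * norm b"
    by (intro add_mono norm_mult_ineq) (simp add: norm_scaleC)
  finally show "norm (umult x b) \<le> norm b * (cmod (scalar x) + norm (element x))"
    by (simp add: algebra_simps)
qed (simp_all add: umult_def scaleC_add_right algebra_simps scaleR_scaleC_commute)

lemma umult_simps:
  "umult (x * y) b = umult x (umult y b)" "umult (x + y) b = umult x b + umult y b"
  "umult (x - y) b = umult x b - umult y b"
  "umult (r *\<^sub>R x) b = r *\<^sub>R umult x b" "umult 1 b = b" "umult 0 b = 0"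
  by (simp_all add: umult_def scaleC_add_right scaleC_add_left scaleC_scaleC scaleC_mult_left scaleC_mult_right
      algebra_simps scaleC_scaleR_left)
     (simp add: algebra_simps flip: scaleC_add_left)

instantiation unitization :: (cstar_algebra) real_normed_algebra_1
begin
text \<open>The norm of \<open>umult x\<close> on A alone would vanish on 1 - embed u if
  \<open>u\<close> is a unit of A; the maximum with the modulus of the scalar part makes the norm
  definite and keeps the C*-identity.\<close>

definition norm_unitization_def: "norm x = max (cmod (scalar x)) (onorm (umult x))"
definition sgn_unitization_def: "sgn (x :: 'a unitization) = inverse (norm x) *\<^sub>R x"
definition dist_unitization_def: "dist (x :: 'a unitization) y = norm (x - y)"
definition uniformity_unitization_def:
  "(uniformity :: ('a unitization \<times> 'a unitization) filter) = (INF e\<in>{0<..}. principal {(x, y). dist x y < e})"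
definition open_unitization_def:
  "open (U :: 'a unitization set) \<longleftrightarrow> (\<forall>x\<in>U. eventually (\<lambda>(x', y). x' = x \<longrightarrow> y \<in> U) uniformity)"
text \<open>Controls the second coordinate, as definiteness and completeness require: for a =
  element x, the element a a* is the difference of umult x a* and a scalar multiple of a*.\<close>

lemma norm_element_le: "norm (element x) \<le> 2 * norm (x :: 'a unitization)"
proof -
  define a where "a = element x"
  have "norm (umult x (star a)) \<le> onorm (umult x) * norm (star a)"
    by (rule onorm[OF bounded_linear_umult])
  then have u: "norm (umult x (star a)) \<le> norm x * norm a"
    by (rule order_trans) (auto simp: norm_unitization_def intro: mult_right_mono)
  have "a * star a = umult x (star a) - scalar x *\<^sub>C star a" by (simp add: umult_def a_def)
  then have "(norm a)\<^sup>2 \<le> norm (umult x (star a)) + norm (scalar x *\<^sub>C star a)"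
    by (metis cstar_identity' norm_triangle_ineq4)
  also have "\<dots> \<le> norm x * norm a + norm x * norm a"
    using u by (intro add_mono) (auto simp: norm_scaleC norm_unitization_def intro!: mult_right_mono)
  also have "\<dots> = (2 * norm x) * norm a" by simp
  finally have "norm a * norm a \<le> (2 * norm x) * norm a" by (simp only: power2_eq_square)
  moreover have "0 \<le> norm x" by (simp add: norm_unitization_def le_max_iff_disj)
  ultimately show ?thesis unfolding a_def[symmetric] by (cases "norm a = 0") (auto simp: mult_le_cancel_right)
qed

lemma norm_unitization_le: "norm (x :: 'a unitization) \<le> cmod (scalar x) + norm (element x)"
proof -
  have "onorm (umult x) \<le> cmod (scalar x) + norm (element x)"
  proof (rule onorm_bound)
    fix b
    have "norm (umult x b) \<le> norm (scalar x *\<^sub>C b) + norm (element x * b)"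
      unfolding umult_def by (rule norm_triangle_ineq)
    also have "\<dots> \<le> cmod (scalar x) * norm b + norm (element x) * norm b"
      by (intro add_mono norm_mult_ineq) (simp add: norm_scaleC)
    finally show "norm (umult x b) \<le> (cmod (scalar x) + norm (element x)) * norm b"
      by (simp add: algebra_simps)
  qed simp
  then show ?thesis by (simp add: norm_unitization_def)
qed

lemma onorm_umult_mult: "onorm (umult (x * y)) \<le> onorm (umult x) * onorm (umult y)" for x y :: "'a unitization"
proof -
  have "umult (x * y) = umult x \<circ> umult y" by (auto simp: umult_simps)
  then show ?thesis by (simp add: onorm_compose bounded_linear_umult)
qed

instance
proof
  fix x y :: "'a unitization" and r :: real
  show "dist x y = norm (x - y)" by (rule dist_unitization_def)
  show "sgn x = x /\<^sub>R norm x" by (rule sgn_unitization_def)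
  show "uniformity = (INF e\<in>{0<..}. principal {(x, y :: 'a unitization). dist x y < e})"
    by (rule uniformity_unitization_def)
  show "open U \<longleftrightarrow> (\<forall>x\<in>U. eventually (\<lambda>(x', y). x' = x \<longrightarrow> y \<in> U) uniformity)"
    for U :: "'a unitization set" by (rule open_unitization_def)
  show nz: "norm x = 0 \<longleftrightarrow> x = 0" for x :: "'a unitization"
  proof
    assume n: "norm x = 0"
    then have "cmod (scalar x) \<le> 0" by (simp add: norm_unitization_def max_def split: if_splits)
    moreover have "norm (element x) \<le> 0" using norm_element_le[of x] n by simp
    ultimately show "x = 0" by (intro unitization_eqI) simp_all
  next
    assume x: "x = 0"
    have "umult (0 :: 'a unitization) = (\<lambda>_. 0)" by (auto simp: umult_simps)
    then show "norm x = 0" using x by (simp add: norm_unitization_def onorm_zero)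
  qed
  have umult_add: "umult (x + y) = (\<lambda>b. umult x b + umult y b)" for x y :: "'a unitization"
    by (auto simp: umult_simps)
  have "onorm (umult (x + y)) \<le> onorm (umult x) + onorm (umult y)"
    unfolding umult_add by (intro onorm_triangle bounded_linear_umult)
  then show "norm (x + y) \<le> norm x + norm y"
    using norm_triangle_ineq[of "scalar x" "scalar y"] unfolding norm_unitization_def by (simp add: max_def)
  have "umult (r *\<^sub>R x) = (\<lambda>b. r *\<^sub>R umult x b)" by (auto simp: umult_simps)
  then have "onorm (umult (r *\<^sub>R x)) = \<bar>r\<bar> * onorm (umult x)"
    using onorm_scaleR[OF bounded_linear_umult[of x], of r] by simp
  then show "norm (r *\<^sub>R x) = \<bar>r\<bar> * norm x"
    by (simp add: norm_unitization_def max_mult_distrib_left)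
  show "norm (x * y) \<le> norm x * norm y" for x y :: "'a unitization"
    unfolding norm_unitization_def
    by (intro max.boundedI order_trans[OF onorm_umult_mult])
       (auto simp: norm_mult le_max_iff_disj intro!: mult_mono onorm_pos_le bounded_linear_umult)
  have "onorm (umult (1 :: 'a unitization)) \<le> 1" by (rule onorm_bound) (simp_all add: umult_simps)
  then show "norm (1 :: 'a unitization) = 1" by (simp add: norm_unitization_def)
qed

end

text \<open>The norm is equivalent to the sum of the norms of the two coordinates, so completeness
  is inherited from them.\<close>

instance unitization :: (cstar_algebra) banach
proof
  fix s :: "nat \<Rightarrow> 'a unitization" assume s: "Cauchy s"
  have "Cauchy (\<lambda>n. scalar (s n))" "Cauchy (\<lambda>n. element (s n))"
  proof -
    have d1: "dist (scalar x) (scalar y) \<le> dist x y" for x y :: "'a unitization"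
      by (simp add: dist_unitization_def dist_norm norm_unitization_def)
    have d2: "dist (element x) (element y) \<le> 2 * dist x y" for x y :: "'a unitization"
      using norm_element_le[of "x - y"] by (simp add: dist_unitization_def dist_norm)
    show "Cauchy (\<lambda>n. scalar (s n))"
      using s unfolding Cauchy_def by (meson d1 order_le_less_trans)
    show "Cauchy (\<lambda>n. element (s n))"
      unfolding Cauchy_def
    proof (intro allI impI)
      fix e :: real assume "e > 0"
      then obtain M where M: "\<And>m n. m \<ge> M \<Longrightarrow> n \<ge> M \<Longrightarrow> dist (s m) (s n) < e / 2"
        using s unfolding Cauchy_def by (metis half_gt_zero)
      have "dist (element (s m)) (element (s n)) < e" if "m \<ge> M" "n \<ge> M" for m n
        using M[OF that] d2[of "s m" "s n"] by linarith
      then show "\<exists>M. \<forall>m\<ge>M. \<forall>n\<ge>M. dist (element (s m)) (element (s n)) < e" by blast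
    qed
  qed
  then obtain l a where la: "(\<lambda>n. scalar (s n)) \<longlonglongrightarrow> l" "(\<lambda>n. element (s n)) \<longlonglongrightarrow> a"
    by (meson Cauchy_convergent convergent_def)
  have "(\<lambda>n. norm (s n - Unitization l a)) \<longlonglongrightarrow> 0"
  proof (rule tendsto_sandwich[OF _ _ tendsto_const])
    show "\<forall>\<^sub>F n in sequentially. norm (s n - Unitization l a) \<le> norm (scalar (s n) - l) + norm (element (s n) - a)"
      using norm_unitization_le[of "s _ - Unitization l a"] by simp
    show "(\<lambda>n. norm (scalar (s n) - l) + norm (element (s n) - a)) \<longlonglongrightarrow> 0"
      using la by (intro tendsto_eq_intros) (auto simp: tendsto_norm_zero_iff LIM_zero_iff)
  qed (auto simp: norm_unitization_def le_max_iff_disj)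
  then have "s \<longlonglongrightarrow> Unitization l a"
    by (subst tendsto_dist_iff) (simp add: dist_unitization_def)
  then show "convergent s" by (auto simp: convergent_def)
qed

instantiation unitization :: (cstar_algebra) cstar_algebra
begin
definition scaleC_unitization_def: "c *\<^sub>C x = Unitization (c * scalar x) (c *\<^sub>C element x)"
definition star_unitization_def: "star x = Unitization (cnj (scalar x)) (star (element x))"

lemma unitization_sel' [simp]:
  "scalar (c *\<^sub>C x) = c * scalar x" "element (c *\<^sub>C x) = c *\<^sub>C element x"
  "scalar (star x) = cnj (scalar x)" "element (star x) = star (element x)"
  for x :: "'a unitization"
  by (simp_all add: scaleC_unitization_def star_unitization_def)

text \<open>With the A-valued inner product star b * c on A, this is the identity \<langle>x b, x
  b\<rangle> = \<langle>b, x* x b\<rangle>, the source of the C*-identity for the operator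
  norm.\<close>

lemma umult_star: "star (umult x b) * umult x b = star b * umult (star x * x) b"
  for x :: "'a unitization"
  by (simp add: umult_def star_simps scaleC_add_right scaleC_add_left scaleC_scaleC scaleC_mult_left scaleC_mult_right
      algebra_simps)

instance
proof
  fix x y :: "'a unitization" and c d :: complex and r :: real
  show "c *\<^sub>C (x + y) = c *\<^sub>C x + c *\<^sub>C y" "(c + d) *\<^sub>C x = c *\<^sub>C x + d *\<^sub>C x"
    "c *\<^sub>C d *\<^sub>C x = (c * d) *\<^sub>C x"
    "(c *\<^sub>C x) * y = c *\<^sub>C (x * y)" "x * (c *\<^sub>C y) = c *\<^sub>C (x * y)"
    "star (star x) = x" "star (x + y) = star x + star y"
    "star (c *\<^sub>C x) = cnj c *\<^sub>C star x" "star (x * y) = star y * star x"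
    by (rule unitization_eqI; simp add: scaleC_add_right scaleC_add_left scaleC_scaleC
        scaleC_mult_left scaleC_mult_right star_simps algebra_simps; fail)+
  show "complex_of_real r *\<^sub>C x = r *\<^sub>R x"
    by (rule unitization_eqI) (simp_all add: scaleC_of_real scaleR_conv_of_real[where 'a=complex])
  have norm_scaleC_le: "norm (c *\<^sub>C x) \<le> cmod c * norm x" for c and x :: "'a unitization"
  proof -
    have "norm (umult (c *\<^sub>C x) b) = cmod c * norm (umult x b)" for b
      by (simp add: umult_def scaleC_mult_left flip: norm_scaleC scaleC_scaleC scaleC_add_right)
    then have "onorm (umult (c *\<^sub>C x)) \<le> cmod c * onorm (umult x)"
      by (intro onorm_bound)
        (auto simp: mult.assoc intro!: mult_left_mono onorm bounded_linear_umult onorm_pos_le mult_nonneg_nonneg)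
    then show ?thesis
      by (simp add: norm_unitization_def norm_mult max_mult_distrib_left max.coboundedI2)
  qed
  show "norm (c *\<^sub>C x) = cmod c * norm x"
  proof (cases "c = 0")
    case True
    then have "c *\<^sub>C x = 0" by (intro unitization_eqI) simp_all
    then show ?thesis using True by simp
  next
    case False
    have "inverse c *\<^sub>C c *\<^sub>C x = x" using False by (intro unitization_eqI) (simp_all add: scaleC_scaleC)
    then have "norm x \<le> cmod (inverse c) * norm (c *\<^sub>C x)" by (metis norm_scaleC_le)
    then have "cmod c * norm x \<le> norm (c *\<^sub>C x)" using False unfolding norm_inverse by (simp add: field_simps)
    then show ?thesis using norm_scaleC_le[of c x] by linarith
  qed
  have sq: "(onorm (umult x))\<^sup>2 \<le> onorm (umult (star x * x))" for x :: "'a unitization"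
  proof -
    have nn: "0 \<le> onorm (umult (star x * x))" by (intro onorm_pos_le bounded_linear_umult)
    have "onorm (umult x) \<le> sqrt (onorm (umult (star x * x)))"
    proof (rule onorm_bound)
      fix b
      have "(norm (umult x b))\<^sup>2 = norm (star b * umult (star x * x) b)"
        by (simp only: umult_star flip: cstar_identity)
      also have "\<dots> \<le> norm b * (onorm (umult (star x * x)) * norm b)"
        by (intro order_trans[OF norm_mult_ineq] mult_mono onorm bounded_linear_umult) auto
      also have "\<dots> = (sqrt (onorm (umult (star x * x))) * norm b)\<^sup>2"
        using nn by (simp add: power_mult_distrib power2_eq_square)
      finally show "norm (umult x b) \<le> sqrt (onorm (umult (star x * x))) * norm b"
        by (rule power2_le_imp_le) (simp add: nn)
    qed (simp add: nn)
    then have "(onorm (umult x))\<^sup>2 \<le> (sqrt (onorm (umult (star x * x))))\<^sup>2"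
      by (intro power_mono onorm_pos_le bounded_linear_umult)
    then show ?thesis using nn by simp
  qed
  \<comment> \<open>The inequality \<open>sq\<close> and submultiplicativity already force the
    involution to be isometric, and the C*-identity follows.\<close>
  have onorm_star_le: "onorm (umult x) \<le> onorm (umult (star x))" for x :: "'a unitization"
  proof (cases "onorm (umult x) = 0")
    case False
    have pos: "0 \<le> onorm (umult x)" by (intro onorm_pos_le bounded_linear_umult)
    have "onorm (umult x) * onorm (umult x) \<le> onorm (umult (star x)) * onorm (umult x)"
      using order_trans[OF sq onorm_umult_mult] by (simp add: power2_eq_square)
    then show ?thesis using False pos by (simp add: mult_le_cancel_right)
  qed (simp add: onorm_pos_le bounded_linear_umult)
  have ss: "star (star x) = x" for x :: "'a unitization" by (rule unitization_eqI) (simp_all add: star_star)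
  have onorm_star: "onorm (umult (star x)) = onorm (umult x)"
    using onorm_star_le[of x] onorm_star_le[of "star x"] by (simp add: ss)
  have "onorm (umult (star x * x)) = (onorm (umult x))\<^sup>2"
    using sq[of x] onorm_umult_mult[of "star x" x] by (simp add: onorm_star power2_eq_square)
  moreover have "max (a\<^sup>2) (b\<^sup>2) = (max a b)\<^sup>2" if "a \<ge> 0" "b \<ge> 0" for a b :: real
    using that by (auto simp: max_def power_mono dest: power2_le_imp_le)
  ultimately show "norm (star x * x) = (norm x)\<^sup>2"
    by (simp add: norm_unitization_def norm_mult onorm_pos_le bounded_linear_umult flip: power2_eq_square)
qed

end

definition embed :: "'a::cstar_algebra \<Rightarrow> 'a unitization" where
  "embed = Unitization 0"

lemma embed_sel [simp]: "scalar (embed a) = 0" "element (embed a) = a"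
  by (simp_all add: embed_def)

lemma embed_add: "embed (a + b) = embed a + embed b"
  by (rule unitization_eqI) simp_all

lemma embed_diff: "embed (a - b) = embed a - embed b"
  by (rule unitization_eqI) simp_all

lemma embed_mult: "embed (a * b) = embed a * embed b"
  by (rule unitization_eqI) simp_all

lemma embed_scaleR: "embed (r *\<^sub>R a) = r *\<^sub>R embed a"
  by (rule unitization_eqI) simp_all

lemma embed_star: "embed (star a) = star (embed a)"
  by (rule unitization_eqI) simp_all

lemmas embed_simps = embed_add embed_diff embed_mult embed_scaleR embed_star

lemma embed_inject [simp]: "embed a = embed b \<longleftrightarrow> a = b"
  by (simp add: embed_def)

lemma mult_embed: "x * embed a = embed (umult x a)"
  by (rule unitization_eqI) (simp_all add: umult_def)

lemma norm_embed [simp]: "norm (embed a) = norm a"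
proof (rule antisym)
  show "norm (embed a) \<le> norm a" using norm_unitization_le[of "embed a"] by simp
  have "norm (umult (embed a) (star a)) \<le> onorm (umult (embed a)) * norm (star a)"
    by (rule onorm[OF bounded_linear_umult])
  then have "norm a * norm a \<le> norm (embed a) * norm a"
    by (simp add: umult_def cstar_identity' power2_eq_square norm_unitization_def onorm_pos_le bounded_linear_umult max_absorb2)
  then show "norm a \<le> norm (embed a)" by (cases "norm a = 0") (auto simp: mult_le_cancel_right)
qed


subsection \<open>Positivity without a unit\<close>

definition cpos :: "'a::cstar_algebra \<Rightarrow> bool" where
  "cpos a \<longleftrightarrow> pos (embed a)"

lemma cpos_star: "cpos a \<Longrightarrow> star a = a"
  using pos_star[of "embed a"] by (simp add: cpos_def flip: embed_star)

lemma cpos_add: "cpos a \<Longrightarrow> cpos b \<Longrightarrow> cpos (a + b)"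
  by (simp add: cpos_def embed_simps pos_add)

lemma cpos_scaleR: "cpos a \<Longrightarrow> r \<ge> 0 \<Longrightarrow> cpos (r *\<^sub>R a)"
  by (simp add: cpos_def embed_simps pos_scaleR)

lemma cpos_star_mult: "cpos (star b * b)"
  by (simp add: cpos_def embed_simps pos_star_mult)

lemma cpos_cstar_positive: "cstar_positive a \<Longrightarrow> cpos a"
  by (auto simp: cstar_positive_def cpos_star_mult)

lemma cpos_zero [simp]: "cpos 0"
  using cpos_star_mult[of 0] by simp

lemma cpos_norm_mono: "cpos x \<Longrightarrow> cpos (y - x) \<Longrightarrow> norm x \<le> norm y"
  using pos_norm_mono[of "embed x" "embed y"] by (simp add: cpos_def embed_simps)

lemma cpos_limit:
  assumes "star x = x" and "\<And>\<epsilon>. \<epsilon> > 0 \<Longrightarrow> \<exists>y. norm (y - x) \<le> \<epsilon> \<and> cpos y"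
  shows "cpos x"
  unfolding cpos_def
proof (rule pos_limit)
  show "star (embed x) = embed x" using assms(1) by (simp flip: embed_star)
  fix \<epsilon> :: real assume "\<epsilon> > 0"
  then obtain y where "norm (y - x) \<le> \<epsilon>" "cpos y" using assms(2) by blast
  then show "\<exists>y. norm (y - embed x) \<le> \<epsilon> \<and> pos y"
    by (intro exI[of _ "embed y"]) (simp add: cpos_def flip: embed_diff)
qed

text \<open>In the unitization n - g is positive; conjugating it by \<open>a\<close> leads back into
  A.\<close>

lemma cpos_norm_conj:
  assumes "cpos g" "norm g \<le> n"
  shows "cpos (n *\<^sub>R (star a * a) - star a * g * a)"
proof -
  have "pos (n *\<^sub>R 1 - embed g)"
    using assms by (intro pos_of_norm) (auto simp: cpos_star simp flip: embed_star)
  from pos_conj[OF this, of "embed a"] show ?thesis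
    by (simp add: cpos_def embed_simps algebra_simps)
qed

text \<open>
  In applications \<open>g = \<langle>x, x\<rangle>\<close>, \<open>a = \<langle>x, y\<rangle>\<close>, \<open>h = \<langle>y, y\<rangle>\<close>, and the positive element is the inner
  square of \<open>x a - n y\<close>.
\<close>

lemma cauchy_schwarz_cpos:
  assumes g: "cpos g"
    and sq: "\<And>n::real. cpos (star a * g * a - (2 * n) *\<^sub>R (star a * a) + (n * n) *\<^sub>R h)"
  shows "(norm a)\<^sup>2 \<le> norm g * norm h"
proof (rule field_le_epsilon)
  fix e :: real assume e: "e > 0"
  define d where "d = e / (norm h + 1)"
  have h1: "norm h + 1 > 0" by (simp add: add_nonneg_pos)
  have d: "d > 0" "d * norm h \<le> e" using e h1 by (simp_all add: d_def field_simps)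
  \<comment> \<open>Slightly more than \<open>norm g\<close>, because \<open>n\<close> is cancelled
    at the end and \<open>norm g\<close> may be 0.\<close>
  define n where "n = norm g + d"
  have n: "n > 0" "norm g \<le> n" using d by (simp_all add: n_def add_nonneg_pos)
  have "cpos ((star a * g * a - (2 * n) *\<^sub>R (star a * a) + (n * n) *\<^sub>R h) + (n *\<^sub>R (star a * a) - star a * g * a))"
    by (intro cpos_add sq cpos_norm_conj g n)
  moreover have "(star a * g * a - (2 * n) *\<^sub>R (star a * a) + (n * n) *\<^sub>R h) + (n *\<^sub>R (star a * a) - star a * g * a)
      = (n * n) *\<^sub>R h - n *\<^sub>R (star a * a)"
    by (simp add: algebra_simps flip: scaleR_add_left)
  ultimately have "norm (n *\<^sub>R (star a * a)) \<le> norm ((n * n) *\<^sub>R h)"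
    using n by (intro cpos_norm_mono cpos_scaleR cpos_star_mult) auto
  then have "n * (norm a)\<^sup>2 \<le> n * (n * norm h)" using n by (simp add: cstar_identity)
  then have "(norm a)\<^sup>2 \<le> n * norm h" using n by (simp only: mult_le_cancel_left_pos)
  then show "(norm a)\<^sup>2 \<le> norm g * norm h + e" using d by (simp add: n_def algebra_simps)
qed

text \<open>Here \<open>T\<close> is multiplication by \<open>(g + \<epsilon>)\<^sup>-\<^sup>1\<close> and \<open>u = g (g + \<epsilon>)\<^sup>-\<^sup>1\<close>.\<close>

lemma resolvent:
  assumes g: "cpos g" and \<epsilon>: "\<epsilon> > 0"
  shows "\<exists>u T. (\<forall>b. g * T b + \<epsilon> *\<^sub>R T b = b) \<and> (\<forall>b. b - star u * b = \<epsilon> *\<^sub>R T b) \<and>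
    norm (g - g * u - star u * g + star u * g * u) \<le> 2 * \<epsilon>"
proof -
  define G where "G = embed g"
  have sG: "star G = G" using g by (simp add: G_def cpos_star flip: embed_star)
  define h where "h = G + \<epsilon> *\<^sub>R 1"
  have sh: "star h = h" by (simp add: h_def star_simps sG)
  have "spos h" using g \<epsilon> by (simp add: cpos_def pos_def h_def G_def)
  then obtain t where t: "norm (t *\<^sub>R 1 - h) < t" by (auto simp: spos_def)
  have t0: "t > 0" using t norm_ge_zero[of "t *\<^sub>R 1 - h"] by linarith
  \<comment> \<open>Fixed points of \<open>f\<close> are right inverses of \<open>h\<close>, and
    \<open>f\<close> is a contraction with factor norm (t - h) / t: the Neumann series in
    disguise.\<close>
  define f where "f = (\<lambda>w. (1/t) *\<^sub>R (1 + (t *\<^sub>R 1 - h) * w))"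
  have "\<exists>!w. w \<in> UNIV \<and> f w = w"
  proof (rule Banach_fix[of UNIV "norm (t *\<^sub>R 1 - h) / t"])
    show "complete (UNIV :: 'a unitization set)" by (rule complete_UNIV)
    fix v w
    have "f v - f w = (1/t) *\<^sub>R ((t *\<^sub>R 1 - h) * (v - w))"
      unfolding f_def by (simp only: scaleR_diff_right[symmetric] right_diff_distrib add_diff_cancel_left)
    then show "dist (f v) (f w) \<le> norm (t *\<^sub>R 1 - h) / t * dist v w"
      using norm_mult_ineq[of "t *\<^sub>R 1 - h" "v - w"] t0
      by (simp add: dist_norm divide_right_mono)
  qed (use t t0 in auto)
  then obtain w where "f w = w" by auto
  then have "t *\<^sub>R w = 1 + (t *\<^sub>R 1 - h) * w" using t0 unfolding f_def
    by (metis (no_types, lifting) divide_self_if less_irrefl scaleR_one scaleR_scaleR times_divide_eq_right mult.right_neutral)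
  then have hw: "h * w = 1" by (simp add: algebra_simps)
  have wh': "star w * h = 1" using hw sh by (metis star_mult star_one)
  have sw: "star w = w" by (metis hw wh' mult.assoc mult.left_neutral mult.right_neutral)
  have wh: "w * h = 1" using wh' sw by simp
  define u where "u = element (G * w)"
  have eu: "embed u = G * w"
    by (rule unitization_eqI) (simp_all add: u_def G_def)
  have esu: "star (embed u) = w * G" by (simp add: eu star_simps sw sG)
  have Gw: "G * w = 1 - \<epsilon> *\<^sub>R w" using hw by (simp add: h_def algebra_simps)
  have wG: "w * G = 1 - \<epsilon> *\<^sub>R w" using wh by (simp add: h_def algebra_simps)
  \<comment> \<open>Conjugating h h - \<epsilon>^2 by \<open>w\<close>, the inverse of
    \<open>h\<close>, gives 1 - (\<epsilon> w)^2, whose positivity yields norm (\<epsilon> w) \<le>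
    1.\<close>
  have "pos (star w * (G * G + (2 * \<epsilon>) *\<^sub>R G) * w)"
    using g \<epsilon> by (intro pos_conj pos_add pos_square pos_scaleR) (auto simp: sG cpos_def G_def[symmetric])
  moreover have "G * G + (2 * \<epsilon>) *\<^sub>R G = h * h - (\<epsilon> * \<epsilon>) *\<^sub>R 1"
    by (simp add: h_def algebra_simps flip: scaleR_add_left)
  moreover have "star w * (h * h - (\<epsilon> * \<epsilon>) *\<^sub>R 1) * w = (w * h) * (h * w) - (\<epsilon> *\<^sub>R w) * (\<epsilon> *\<^sub>R w)"
    by (simp add: sw algebra_simps)
  ultimately have "pos (1 - (\<epsilon> *\<^sub>R w) * (\<epsilon> *\<^sub>R w))" by (simp only: hw wh mult_1_left)
  moreover have "pos ((\<epsilon> *\<^sub>R w) * (\<epsilon> *\<^sub>R w))" by (rule pos_square) (simp only: star_scaleR sw)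
  ultimately have "norm ((\<epsilon> *\<^sub>R w) * (\<epsilon> *\<^sub>R w)) \<le> norm (1 :: 'a unitization)" by (intro pos_norm_mono)
  then have "(norm (\<epsilon> *\<^sub>R w))\<^sup>2 \<le> 1" by (subst (asm) norm_square_selfadjoint) (simp_all only: star_scaleR sw norm_one)
  then have nw: "norm (\<epsilon> *\<^sub>R w) \<le> 1" by (simp only: abs_square_le_1 abs_norm_cancel)
  have eq1: "g * umult w b + \<epsilon> *\<^sub>R umult w b = b" for b
  proof -
    have "embed (g * umult w b + \<epsilon> *\<^sub>R umult w b) = h * w * embed b"
      by (simp add: embed_simps h_def G_def algebra_simps flip: mult_embed)
    then show ?thesis by (simp add: hw)
  qed
  have eq2: "b - star u * b = \<epsilon> *\<^sub>R umult w b" for b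
  proof -
    have "embed (b - star u * b) = embed (\<epsilon> *\<^sub>R umult w b)"
      by (simp add: embed_simps esu wG algebra_simps flip: mult_embed)
    then show ?thesis by simp
  qed
  \<comment> \<open>The expression is \<open>g\<close> between 1 - star u and 1 - u. Both of these
    are \<epsilon> w, and one of them makes \<open>g\<close> small: G (\<epsilon> w) = \<epsilon> (1
    - \<epsilon> w) has norm at most 2 \<epsilon>.\<close>
  have "embed (g - g * u - star u * g + star u * g * u) = (1 - w * G) * (G * (1 - G * w))"
    by (simp add: embed_simps eu esu G_def[symmetric] star_simps sw sG algebra_simps)
  also have "\<dots> = (\<epsilon> *\<^sub>R w) * (\<epsilon> *\<^sub>R (1 - \<epsilon> *\<^sub>R w))"
    by (simp add: Gw wG)
  finally have "norm (g - g * u - star u * g + star u * g * u) = norm ((\<epsilon> *\<^sub>R w) * (\<epsilon> *\<^sub>R (1 - \<epsilon> *\<^sub>R w)))"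
    by (metis norm_embed)
  also have "\<dots> \<le> 1 * (\<epsilon> * (1 + 1))"
  proof (intro order_trans[OF norm_mult_ineq] mult_mono nw)
    have "norm (1 - \<epsilon> *\<^sub>R w) \<le> 1 + 1"
      using norm_triangle_ineq4[of 1 "\<epsilon> *\<^sub>R w"] nw by simp
    then show "norm (\<epsilon> *\<^sub>R (1 - \<epsilon> *\<^sub>R w)) \<le> \<epsilon> * (1 + 1)" using \<epsilon> by simp
  qed auto
  finally show ?thesis using eq1 eq2 by (intro exI[of _ u] exI[of _ "umult w"]) auto
qed


section \<open>Hilbert modules\<close>

definition lsum :: "('a, 'x) bimodule \<Rightarrow> 'x list \<Rightarrow> 'x" where
  "lsum M xs = foldr (\<lambda>x y. x \<oplus>\<^bsub>M\<^esub> y) xs \<zero>\<^bsub>M\<^esub>"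

lemma lsum_simps [simp]: "lsum M [] = \<zero>\<^bsub>M\<^esub>" "lsum M (x # xs) = x \<oplus>\<^bsub>M\<^esub> lsum M xs"
  by (simp_all add: lsum_def)

lemma mnorm_nonneg [simp]: "0 \<le> mnorm M x"
  by (simp add: mnorm_def)

lemma mnorm_sq: "(mnorm M x)\<^sup>2 = norm (ip M x x)"
  by (simp add: mnorm_def)

context right_hilbert_module
begin

lemma scalars [simp]:
  "c \<in> carrier ring_of_type_algebra"
  "a \<oplus>\<^bsub>ring_of_type_algebra\<^esub> b = a + b" "a \<otimes>\<^bsub>ring_of_type_algebra\<^esub> b = a * b"
  "\<one>\<^bsub>ring_of_type_algebra\<^esub> = 1" "\<zero>\<^bsub>ring_of_type_algebra\<^esub> = 0"
  for a b c :: complex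
  by (simp_all add: ring_of_type_algebra_def)

lemma smult_carrier [simp]: "x \<in> carrier M \<Longrightarrow> c \<odot> x \<in> carrier M"
  by (rule smult_closed) simp_all

lemma smult_add_left: "x \<in> carrier M \<Longrightarrow> (c + d) \<odot> x = c \<odot> x \<oplus> d \<odot> x"
  using smult_l_distr[of c d x] by simp

lemma smult_add_right: "x \<in> carrier M \<Longrightarrow> y \<in> carrier M \<Longrightarrow> c \<odot> (x \<oplus> y) = c \<odot> x \<oplus> c \<odot> y"
  using smult_r_distr[of c x y] by simp

lemma smult_1 [simp]: "x \<in> carrier M \<Longrightarrow> 1 \<odot> x = x"
  using smult_one[of x] by simp

lemma smult_0 [simp]: "x \<in> carrier M \<Longrightarrow> 0 \<odot> x = \<zero>"
  using smult_l_null[of x] by simp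

lemma smult_zero [simp]: "c \<odot> \<zero> = \<zero>"
  using smult_r_null[of c] by simp

lemma a_inv_eq: "x \<in> carrier M \<Longrightarrow> \<ominus> x = (-1) \<odot> x"
  using smult_add_left[of x "-1" 1] by (intro M.minus_equality) auto

lemma minus_eq: "x \<in> carrier M \<Longrightarrow> y \<in> carrier M \<Longrightarrow> x \<ominus> y = x \<oplus> (-1) \<odot> y"
  by (simp add: a_minus_def a_inv_eq)

lemma minus_carrier [simp]: "x \<in> carrier M \<Longrightarrow> y \<in> carrier M \<Longrightarrow> x \<ominus> y \<in> carrier M"
  by (simp add: minus_eq)

lemmas ract_carrier [simp] = ract_closed

lemma ip_add_left:
  "x \<in> carrier M \<Longrightarrow> y \<in> carrier M \<Longrightarrow> z \<in> carrier M \<Longrightarrow> ip M (x \<oplus> y) z = ip M x z + ip M y z"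
  using arg_cong[OF ip_add[of z x y], of star] by (simp add: star_add ip_star)

lemma ip_smult_left: "x \<in> carrier M \<Longrightarrow> y \<in> carrier M \<Longrightarrow> ip M (c \<odot> x) y = cnj c *\<^sub>C ip M x y"
  using arg_cong[OF ip_smult[of y x c], of star] by (simp add: star_scaleC ip_star)

lemma ip_ract_left: "x \<in> carrier M \<Longrightarrow> y \<in> carrier M \<Longrightarrow> ip M (ract M x a) y = star a * ip M x y"
  using arg_cong[OF ip_ract[of y x a], of star] by (simp add: star_mult ip_star)

lemma ip_zero [simp]: "x \<in> carrier M \<Longrightarrow> ip M x \<zero> = 0" "x \<in> carrier M \<Longrightarrow> ip M \<zero> x = 0"
  using ip_smult[of x \<zero> 0] ip_smult_left[of \<zero> x 0] by simp_all

lemma ip_diff: "x \<in> carrier M \<Longrightarrow> y \<in> carrier M \<Longrightarrow> z \<in> carrier M \<Longrightarrow> ip M z (x \<ominus> y) = ip M z x - ip M z y"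
  by (simp add: minus_eq ip_add ip_smult)

lemma ip_diff_left: "x \<in> carrier M \<Longrightarrow> y \<in> carrier M \<Longrightarrow> z \<in> carrier M \<Longrightarrow> ip M (x \<ominus> y) z = ip M x z - ip M y z"
  by (simp add: minus_eq ip_add_left ip_smult_left)

lemmas ip_simps = ip_add ip_add_left ip_diff ip_diff_left ip_smult ip_smult_left ip_ract ip_ract_left

lemma ip_cpos: "x \<in> carrier M \<Longrightarrow> cpos (ip M x x)"
  by (intro cpos_cstar_positive ip_positive)

lemma diff_eq_zero_iff: "x \<in> carrier M \<Longrightarrow> y \<in> carrier M \<Longrightarrow> x \<ominus> y = \<zero> \<longleftrightarrow> x = y"
  using M.a_assoc[of x "\<ominus> y" y] by (auto simp: a_minus_def M.l_neg M.r_neg)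

lemma ip_eqI:
  assumes "x \<in> carrier M" "y \<in> carrier M" "\<And>z. z \<in> carrier M \<Longrightarrow> ip M z x = ip M z y"
  shows "x = y"
proof -
  have "ip M (x \<ominus> y) (x \<ominus> y) = 0" using assms by (simp add: ip_diff)
  then show ?thesis using assms ip_eq_zero[of "x \<ominus> y"] diff_eq_zero_iff by simp
qed

lemma ract_zero_right [simp]: "x \<in> carrier M \<Longrightarrow> ract M x 0 = \<zero>"
  by (rule ip_eqI) (simp_all add: ip_ract)

lemma ract_zero_left [simp]: "ract M \<zero> a = \<zero>"
  by (rule ip_eqI) (simp_all add: ip_ract)

lemma norm_ip: assumes "x \<in> carrier M" "y \<in> carrier M" shows "norm (ip M x y) \<le> mnorm M x * mnorm M y"
proof -
  have "(norm (ip M x y))\<^sup>2 \<le> norm (ip M x x) * norm (ip M y y)"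
  proof (rule cauchy_schwarz_cpos[OF ip_cpos[OF assms(1)]])
    fix n :: real
    define a z where "a = ip M x y" and "z = ract M x a \<oplus> complex_of_real (- n) \<odot> y"
    have "ip M y x = star a" using assms by (simp add: a_def ip_star)
    then have "ip M z z = star a * ip M x x * a - (2 * n) *\<^sub>R (star a * a) + (n * n) *\<^sub>R ip M y y"
      unfolding z_def using assms
      by (simp add: ip_simps scaleC_of_real scaleC_minus_left scaleC_diff_right algebra_simps
          flip: a_def of_real_minus scaleR_add_left)
    moreover have "cpos (ip M z z)" using assms by (intro ip_cpos) (simp add: z_def)
    ultimately show "cpos (star (ip M x y) * ip M x x * ip M x y - (2 * n) *\<^sub>R (star (ip M x y) * ip M x y) + (n * n) *\<^sub>R ip M y y)"
      by (simp add: a_def)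
  qed
  then have "(norm (ip M x y))\<^sup>2 \<le> (mnorm M x * mnorm M y)\<^sup>2" by (simp add: power_mult_distrib mnorm_sq)
  then show ?thesis by (rule power2_le_imp_le) simp
qed

lemma mnorm_triangle: assumes "x \<in> carrier M" "y \<in> carrier M" shows "mnorm M (x \<oplus> y) \<le> mnorm M x + mnorm M y"
proof (rule power2_le_imp_le)
  have "(mnorm M (x \<oplus> y))\<^sup>2 = norm ((ip M x x + ip M y y) + (ip M x y + ip M y x))"
    using assms by (simp add: mnorm_sq ip_simps algebra_simps)
  also have "\<dots> \<le> (norm (ip M x x) + norm (ip M y y)) + (norm (ip M x y) + norm (ip M y x))"
    by (intro norm_triangle_le add_mono norm_triangle_ineq)
  also have "\<dots> \<le> (mnorm M x + mnorm M y)\<^sup>2"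
    using norm_ip[OF assms] norm_ip[OF assms(2,1)] by (simp add: power2_sum algebra_simps flip: mnorm_sq)
  finally show "(mnorm M (x \<oplus> y))\<^sup>2 \<le> (mnorm M x + mnorm M y)\<^sup>2" .
qed simp

lemma mnorm_zero [simp]: "mnorm M \<zero> = 0"
  by (simp add: mnorm_def)

lemma mnorm_eq_0_iff: "x \<in> carrier M \<Longrightarrow> mnorm M x = 0 \<longleftrightarrow> x = \<zero>"
  using ip_eq_zero[of x] by (auto simp: mnorm_def)

lemma mnorm_smult: "x \<in> carrier M \<Longrightarrow> mnorm M (c \<odot> x) = cmod c * mnorm M x"
  by (rule power2_eq_imp_eq)
    (simp_all add: power_mult_distrib mnorm_sq ip_simps norm_scaleC power2_eq_square[of "cmod c"])

lemma mnorm_ract: assumes "x \<in> carrier M" shows "mnorm M (ract M x a) \<le> mnorm M x * norm a"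
proof (rule power2_le_imp_le)
  have "(mnorm M (ract M x a))\<^sup>2 = norm (star a * (ip M x x * a))"
    using assms by (simp add: mnorm_sq ip_simps mult.assoc)
  also have "\<dots> \<le> norm (star a) * (norm (ip M x x) * norm a)"
    by (intro order_trans[OF norm_mult_ineq] mult_left_mono norm_mult_ineq) simp
  also have "\<dots> = (mnorm M x * norm a)\<^sup>2"
    by (simp add: power_mult_distrib mnorm_sq power2_eq_square[of "norm a"])
  finally show "(mnorm M (ract M x a))\<^sup>2 \<le> (mnorm M x * norm a)\<^sup>2" .
qed simp

lemma minus_split: "x \<in> carrier M \<Longrightarrow> y \<in> carrier M \<Longrightarrow> z \<in> carrier M \<Longrightarrow> x \<ominus> z = (x \<ominus> y) \<oplus> (y \<ominus> z)"
  by (rule ip_eqI) (simp_all add: ip_simps)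

lemma mnorm_minus_triangle:
  "x \<in> carrier M \<Longrightarrow> y \<in> carrier M \<Longrightarrow> z \<in> carrier M \<Longrightarrow>
    mnorm M (x \<ominus> z) \<le> mnorm M (x \<ominus> y) + mnorm M (y \<ominus> z)"
  using minus_split[of x y z] mnorm_triangle[of "x \<ominus> y" "y \<ominus> z"] by simp

lemma mnorm_minus_commute: "x \<in> carrier M \<Longrightarrow> y \<in> carrier M \<Longrightarrow> mnorm M (x \<ominus> y) = mnorm M (y \<ominus> x)"
  by (simp add: mnorm_def ip_simps algebra_simps)

lemma mnorm_le_diff: "x \<in> carrier M \<Longrightarrow> y \<in> carrier M \<Longrightarrow> mnorm M x \<le> mnorm M (x \<ominus> y) + mnorm M y"
  using mnorm_minus_triangle[of x y \<zero>] by (simp add: minus_eq)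

lemma lsum_carrier [simp]: "set xs \<subseteq> carrier M \<Longrightarrow> lsum M xs \<in> carrier M"
  by (induction xs) auto

text \<open>Plays the part of an approximate unit: for g = \<langle>x, x\<rangle> and u = g (g +
  \<epsilon>)^-1 from \<open>resolvent\<close>, the inner square of x - x u has norm at most 2
  \<epsilon>, and \<epsilon> is taken to be \<delta>^2 / 2.\<close>

lemma ract_approx:
  assumes x: "x \<in> carrier M" and \<delta>: "\<delta> > 0"
  shows "\<exists>a. mnorm M (x \<ominus> ract M x a) \<le> \<delta>"
proof -
  obtain u where u: "norm (ip M x x - ip M x x * u - star u * ip M x x + star u * ip M x x * u) \<le> 2 * (\<delta>\<^sup>2 / 2)"
    using resolvent[OF ip_cpos[OF x], of "\<delta>\<^sup>2 / 2"] \<delta> by auto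
  have "(mnorm M (x \<ominus> ract M x u))\<^sup>2 = norm (ip M x x - ip M x x * u - star u * ip M x x + star u * ip M x x * u)"
    using x by (simp add: mnorm_sq ip_simps algebra_simps)
  also have "\<dots> \<le> \<delta>\<^sup>2" using u by simp
  finally show ?thesis using \<delta> by (intro exI[of _ u]) (auto intro: power2_le_imp_le)
qed

end

context right_hilbert_bimodule
begin

lemmas lact_carrier [simp] = lact_closed

lemma lact_star_right: "x \<in> carrier M \<Longrightarrow> z \<in> carrier M \<Longrightarrow> ip M z (lact M a x) = ip M (lact M (star a) z) x"
  using lact_adjoint[of z x "star a"] by (simp add: star_star)

lemma lact_add_right: "x \<in> carrier M \<Longrightarrow> y \<in> carrier M \<Longrightarrow> lact M a (x \<oplus> y) = lact M a x \<oplus> lact M a y"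
  by (rule ip_eqI) (auto simp: ip_simps lact_star_right)

lemma lact_smult_right: "x \<in> carrier M \<Longrightarrow> lact M a (c \<odot> x) = c \<odot> lact M a x"
  by (rule ip_eqI) (auto simp: ip_simps lact_star_right)

lemma lact_ract: "x \<in> carrier M \<Longrightarrow> lact M a (ract M x b) = ract M (lact M a x) b"
  by (rule ip_eqI) (auto simp: ip_simps lact_star_right)

lemma lact_zero [simp]: "lact M a \<zero> = \<zero>" "x \<in> carrier M \<Longrightarrow> lact M 0 x = \<zero>"
  using lact_smult_right[of \<zero> a 0] lact_scaleC[of x 0 0] by simp_all

text \<open>With \<open>k\<close> from \<open>quasi_sqrt\<close> for \<open>x = h\<^sup>2\<close>: \<open>\<langle>y - k y, y - k y\<rangle> = \<langle>y, y\<rangle> - \<langle>h y, h y\<rangle>\<close>.\<close>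

lemma mnorm_lact: assumes y: "y \<in> carrier M" shows "mnorm M (lact M a y) \<le> norm a * mnorm M y"
proof -
  have sa1: "mnorm M (lact M h y) \<le> mnorm M y" if h: "star h = h" "norm h < 1" for h
  proof -
    have "norm (h * h) < 1" using norm_square_selfadjoint[OF h(1)] h(2) by (simp add: abs_square_less_1)
    then obtain k where k: "star k = k" "k + k = h * h + k * k"
      using quasi_sqrt[of "h * h"] h by (metis star_mult)
    define z where "z = y \<ominus> lact M k y"
    have z: "z \<in> carrier M" using y by (simp add: z_def)
    have "lact M k y \<oplus> lact M k y = lact M (h * h) y \<oplus> lact M (k * k) y"
      using y k(2) by (simp flip: lact_add)
    from arg_cong[OF this, of "ip M y"]
    have e: "ip M y (lact M k y) + ip M y (lact M k y) = ip M y (lact M (h * h) y) + ip M y (lact M (k * k) y)"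
      using y by (simp add: ip_add)
    have "ip M z z = ip M y y - ip M y (lact M k y) - ip M y (lact M k y) + ip M y (lact M (k * k) y)"
      unfolding z_def using y by (simp add: ip_simps lact_adjoint k(1) lact_mult)
    also have "\<dots> = ip M y y - ip M y (lact M (h * h) y)"
      using e by (simp add: algebra_simps)
    also have "ip M y (lact M (h * h) y) = ip M (lact M h y) (lact M h y)"
      using y by (simp add: lact_mult lact_adjoint h(1))
    finally have "cpos (ip M y y - ip M (lact M h y) (lact M h y))" using ip_cpos[OF z] by simp
    then have "norm (ip M (lact M h y) (lact M h y)) \<le> norm (ip M y y)"
      using y by (intro cpos_norm_mono ip_cpos) auto
    then show ?thesis by (simp add: mnorm_def)
  qed
  have sa: "mnorm M (lact M h y) \<le> norm h * mnorm M y" if h: "star h = h" for h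
  proof (rule field_le_epsilon)
    fix e :: real assume e: "e > 0"
    define t where "t = norm h + e / (mnorm M y + 1)"
    have m: "mnorm M y + 1 > 0" by (simp add: add_nonneg_pos)
    have t: "t > 0" "norm h < t" using e m by (simp_all add: t_def add_nonneg_pos)
    have "mnorm M (lact M ((1/t) *\<^sub>R h) y) \<le> mnorm M y"
      by (rule sa1) (use h t in \<open>simp_all add: star_simps\<close>)
    moreover have "lact M ((1/t) *\<^sub>R h) y = complex_of_real (1/t) \<odot> lact M h y"
      using y lact_scaleC[of y "complex_of_real (1/t)" h] by (simp only: scaleC_of_real)
    ultimately have "(1/t) * mnorm M (lact M h y) \<le> mnorm M y"
      using y t by (simp add: mnorm_smult norm_divide)
    then have "mnorm M (lact M h y) \<le> t * mnorm M y" using t by (simp add: field_simps)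
    also have "\<dots> = norm h * mnorm M y + e * (mnorm M y / (mnorm M y + 1))" by (simp add: t_def algebra_simps)
    also have "e * (mnorm M y / (mnorm M y + 1)) \<le> e * 1" using e m by (intro mult_left_mono) auto
    finally show "mnorm M (lact M h y) \<le> norm h * mnorm M y + e" by simp
  qed
  have "(mnorm M (lact M a y))\<^sup>2 = norm (ip M y (lact M (star a * a) y))"
    using y by (simp add: mnorm_sq lact_adjoint lact_mult)
  also have "\<dots> \<le> mnorm M y * mnorm M (lact M (star a * a) y)" using y by (intro norm_ip) auto
  also have "\<dots> \<le> mnorm M y * (norm (star a * a) * mnorm M y)"
    by (intro mult_left_mono sa) (simp_all add: star_simps)
  also have "\<dots> = (norm a * mnorm M y)\<^sup>2" by (simp add: cstar_identity power2_eq_square algebra_simps)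
  finally show ?thesis by (rule power2_le_imp_le) simp
qed

end


subsection \<open>Compact operators\<close>

text \<open>Norm bounds on operators are relations with a real parameter instead of a norm, so that
  they make sense for arbitrary functions on the carrier.\<close>

definition op_near :: "('a::cstar_algebra, 'x) bimodule \<Rightarrow> ('x \<Rightarrow> 'x) \<Rightarrow> ('x \<Rightarrow> 'x) \<Rightarrow> real \<Rightarrow> bool" where
  "op_near M S T k \<longleftrightarrow> (\<forall>x\<in>carrier M. mnorm M (S x \<ominus>\<^bsub>M\<^esub> T x) \<le> k * mnorm M x)"

definition op_bound :: "('a::cstar_algebra, 'x) bimodule \<Rightarrow> ('x \<Rightarrow> 'x) \<Rightarrow> real \<Rightarrow> bool" where
  "op_bound M T k \<longleftrightarrow> (\<forall>x\<in>carrier M. mnorm M (T x) \<le> k * mnorm M x)"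

text \<open>A finite-rank operator is handled through a list of pairs of vectors, because its image
  under a representation is computed from the list.\<close>

definition fin_op :: "('a::cstar_algebra, 'x) bimodule \<Rightarrow> ('x \<times> 'x) list \<Rightarrow> 'x \<Rightarrow> 'x" where
  "fin_op M L = (\<lambda>z\<in>carrier M. lsum M (map (\<lambda>(x, y). ract M x (ip M y z)) L))"

definition pairs :: "('a, 'x) bimodule \<Rightarrow> ('x \<times> 'x) list set" where
  "pairs M = lists (carrier M \<times> carrier M)"

lemma pairs_simps [simp]: "[] \<in> pairs M" "p # L \<in> pairs M \<longleftrightarrow> fst p \<in> carrier M \<and> snd p \<in> carrier M \<and> L \<in> pairs M"
  "L @ L' \<in> pairs M \<longleftrightarrow> L \<in> pairs M \<and> L' \<in> pairs M"
  by (simp_all add: pairs_def mem_Times_iff)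

lemma adjointables_ext: "T \<in> adjointables M \<Longrightarrow> T \<in> extensional (carrier M)"
  by (auto simp: adjointables_def PiE_def)

lemma adjointables_carrier: "T \<in> adjointables M \<Longrightarrow> x \<in> carrier M \<Longrightarrow> T x \<in> carrier M"
  by (auto simp: adjointables_def PiE_def)

lemma compacts_adjointables: "T \<in> compacts M \<Longrightarrow> T \<in> adjointables M"
  by (simp add: compacts_def)

context right_hilbert_module
begin

lemma is_adjoint_sym:
  assumes "is_adjoint M T S" "\<And>x. x \<in> carrier M \<Longrightarrow> T x \<in> carrier M" "\<And>x. x \<in> carrier M \<Longrightarrow> S x \<in> carrier M"
  shows "is_adjoint M S T"
  unfolding is_adjoint_def
proof (intro ballI)
  fix x y assume xy: "x \<in> carrier M" "y \<in> carrier M"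
  have "star (ip M (T y) x) = star (ip M y (S x))" using assms(1) xy by (simp add: is_adjoint_def)
  then show "ip M (S x) y = ip M x (T y)" using assms(2,3) xy by (simp add: ip_star)
qed

lemma adjointableE:
  assumes "T \<in> adjointables M"
  obtains S where "S \<in> adjointables M" "is_adjoint M T S" "is_adjoint M S T"
proof -
  obtain S where S: "S \<in> carrier M \<rightarrow>\<^sub>E carrier M" "is_adjoint M T S" and T: "T \<in> carrier M \<rightarrow>\<^sub>E carrier M"
    using assms by (auto simp: adjointables_def)
  have ST: "is_adjoint M S T" by (rule is_adjoint_sym[OF S(2)]) (use S T in auto)
  then have "S \<in> adjointables M" using S T by (auto simp: adjointables_def)
  then show thesis using that S(2) ST by blast
qed

lemma adjointablesI:
  assumes "T \<in> extensional (carrier M)" "\<And>x. x \<in> carrier M \<Longrightarrow> T x \<in> carrier M"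
    "\<And>x. x \<in> carrier M \<Longrightarrow> S x \<in> carrier M" "is_adjoint M T S"
  shows "T \<in> adjointables M"
  unfolding adjointables_def using assms
  by (auto simp: is_adjoint_def PiE_def intro!: bexI[of _ "restrict S (carrier M)"])

lemma adjoint_add:
  assumes T: "T \<in> adjointables M" and "x \<in> carrier M" "y \<in> carrier M"
  shows "T (x \<oplus> y) = T x \<oplus> T y"
proof -
  obtain S where S: "S \<in> adjointables M" "is_adjoint M S T" using T by (rule adjointableE)
  show ?thesis
  proof (rule ip_eqI)
    fix z assume "z \<in> carrier M"
    then show "ip M z (T (x \<oplus> y)) = ip M z (T x \<oplus> T y)"
      using assms S adjointables_carrier[OF T] adjointables_carrier[OF S(1)]
      by (simp add: ip_add is_adjoint_def flip: S(2)[unfolded is_adjoint_def, rule_format])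
  qed (use assms adjointables_carrier[OF T] in auto)
qed

lemma adjoint_smult:
  assumes T: "T \<in> adjointables M" and "x \<in> carrier M"
  shows "T (c \<odot> x) = c \<odot> T x"
proof -
  obtain S where S: "S \<in> adjointables M" "is_adjoint M S T" using T by (rule adjointableE)
  show ?thesis
  proof (rule ip_eqI)
    fix z assume "z \<in> carrier M"
    then show "ip M z (T (c \<odot> x)) = ip M z (c \<odot> T x)"
      using assms S adjointables_carrier[OF T] adjointables_carrier[OF S(1)]
      by (simp add: ip_smult is_adjoint_def flip: S(2)[unfolded is_adjoint_def, rule_format])
  qed (use assms adjointables_carrier[OF T] in auto)
qed

lemma adjoint_ract:
  assumes T: "T \<in> adjointables M" and "x \<in> carrier M"
  shows "T (ract M x a) = ract M (T x) a"
proof -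
  obtain S where S: "S \<in> adjointables M" "is_adjoint M S T" using T by (rule adjointableE)
  show ?thesis
  proof (rule ip_eqI)
    fix z assume "z \<in> carrier M"
    then show "ip M z (T (ract M x a)) = ip M z (ract M (T x) a)"
      using assms S adjointables_carrier[OF T] adjointables_carrier[OF S(1)]
      by (simp add: ip_ract is_adjoint_def flip: S(2)[unfolded is_adjoint_def, rule_format])
  qed (use assms adjointables_carrier[OF T] in auto)
qed

lemma adjoint_zero: "T \<in> adjointables M \<Longrightarrow> T \<zero> = \<zero>"
  using adjoint_smult[of T \<zero> 0] adjointables_carrier[of T M \<zero>] by simp

lemma adjoint_minus: "T \<in> adjointables M \<Longrightarrow> x \<in> carrier M \<Longrightarrow> y \<in> carrier M \<Longrightarrow> T (x \<ominus> y) = T x \<ominus> T y"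
  by (simp add: minus_eq adjoint_add adjoint_smult adjointables_carrier)

lemma adjoint_lsum: "T \<in> adjointables M \<Longrightarrow> set xs \<subseteq> carrier M \<Longrightarrow> T (lsum M xs) = lsum M (map T xs)"
  by (induction xs) (auto simp: adjoint_zero adjoint_add)

text \<open>Cauchy-Schwarz applied to \<langle>S x, S x\<rangle> = \<langle>T S x,
  x\<rangle>.\<close>

lemma op_bound_adjoint:
  assumes "is_adjoint M T S" "op_bound M T k" "k \<ge> 0"
    and T: "\<And>x. x \<in> carrier M \<Longrightarrow> T x \<in> carrier M" and S: "\<And>x. x \<in> carrier M \<Longrightarrow> S x \<in> carrier M"
  shows "op_bound M S k"
  unfolding op_bound_def
proof
  fix x assume x: "x \<in> carrier M"
  have "(mnorm M (S x))\<^sup>2 = norm (ip M (T (S x)) x)"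
    using assms(1) x S by (simp add: mnorm_sq is_adjoint_def)
  also have "\<dots> \<le> mnorm M (T (S x)) * mnorm M x" by (intro norm_ip T S x)
  also have "\<dots> \<le> (k * mnorm M (S x)) * mnorm M x"
    using assms(2) x S by (intro mult_right_mono) (auto simp: op_bound_def)
  finally have "mnorm M (S x) * mnorm M (S x) \<le> (k * mnorm M x) * mnorm M (S x)"
    by (simp add: power2_eq_square algebra_simps)
  then show "mnorm M (S x) \<le> k * mnorm M x"
    using assms(3) by (cases "mnorm M (S x) = 0") (auto simp: mult_le_cancel_right order.strict_iff_order)
qed

lemma op_near_adjoint:
  assumes "is_adjoint M S S'" "is_adjoint M T T'" "op_near M S T k" "k \<ge> 0"
    and "S \<in> adjointables M" "T \<in> adjointables M" "S' \<in> adjointables M" "T' \<in> adjointables M"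
  shows "op_near M S' T' k"
proof -
  note c = adjointables_carrier[OF assms(5)] adjointables_carrier[OF assms(6)]
    adjointables_carrier[OF assms(7)] adjointables_carrier[OF assms(8)]
  have "op_bound M (\<lambda>x. S' x \<ominus> T' x) k"
  proof (rule op_bound_adjoint)
    show "is_adjoint M (\<lambda>x. S x \<ominus> T x) (\<lambda>x. S' x \<ominus> T' x)"
      using assms(1,2) c unfolding is_adjoint_def by (auto simp: ip_diff ip_diff_left)
    show "op_bound M (\<lambda>x. S x \<ominus> T x) k" using assms(3) by (simp add: op_near_def op_bound_def)
  qed (use assms c in auto)
  then show ?thesis by (simp add: op_near_def op_bound_def)
qed

lemma op_near_trans:
  assumes "op_near M R S j" "op_near M S T k" "R \<in> adjointables M" "S \<in> adjointables M" "T \<in> adjointables M"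
  shows "op_near M R T (j + k)"
  unfolding op_near_def
proof
  fix x assume x: "x \<in> carrier M"
  have "mnorm M (R x \<ominus> T x) \<le> mnorm M (R x \<ominus> S x) + mnorm M (S x \<ominus> T x)"
    using assms x by (intro mnorm_minus_triangle) (auto intro: adjointables_carrier)
  also have "\<dots> \<le> j * mnorm M x + k * mnorm M x" using assms x by (intro add_mono) (auto simp: op_near_def)
  finally show "mnorm M (R x \<ominus> T x) \<le> (j + k) * mnorm M x" by (simp add: algebra_simps)
qed

lemma op_near_sym: "op_near M S T k \<Longrightarrow> S \<in> adjointables M \<Longrightarrow> T \<in> adjointables M \<Longrightarrow> op_near M T S k"
  unfolding op_near_def by (metis mnorm_minus_commute adjointables_carrier)

lemma fin_op_Nil [simp]: "fin_op M [] = op_zero M"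
  by (auto simp: fin_op_def op_zero_def)

lemma fin_op_Cons: "(x, y) # L \<in> pairs M \<Longrightarrow> fin_op M ((x, y) # L) = op_add M (rank_one M x y) (fin_op M L)"
  by (auto simp: fin_op_def op_add_def rank_one_def)

lemma fin_op_apply_Cons [simp]: "z \<in> carrier M \<Longrightarrow> fin_op M ((x, y) # L) z = ract M x (ip M y z) \<oplus> fin_op M L z"
  by (simp add: fin_op_def)

lemma fin_op_apply_Nil [simp]: "z \<in> carrier M \<Longrightarrow> fin_op M [] z = \<zero>"
  by (simp add: fin_op_def)

lemma fin_op_extensional: "fin_op M L \<in> extensional (carrier M)"
  by (simp add: fin_op_def)

lemma fin_op_carrier: "L \<in> pairs M \<Longrightarrow> z \<in> carrier M \<Longrightarrow> fin_op M L z \<in> carrier M"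
  by (induction L) (auto simp del: fin_op_Nil)

lemma fin_op_append:
  "L \<in> pairs M \<Longrightarrow> L' \<in> pairs M \<Longrightarrow> z \<in> carrier M \<Longrightarrow> fin_op M (L @ L') z = fin_op M L z \<oplus> fin_op M L' z"
  by (induction L) (auto simp: fin_op_carrier M.a_assoc simp del: fin_op_Nil)

lemma fin_op_smult:
  "L \<in> pairs M \<Longrightarrow> z \<in> carrier M \<Longrightarrow> fin_op M (map (\<lambda>(x, y). (c \<odot> x, y)) L) z = c \<odot> fin_op M L z"
  by (induction L) (auto simp: fin_op_carrier smult_add_right ract_smult simp del: fin_op_Nil)

lemma pairs_map_fst:
  assumes "L \<in> pairs M" and f: "\<And>x. x \<in> carrier M \<Longrightarrow> f x \<in> carrier M"
  shows "map (\<lambda>(x, y). (f x, y)) L \<in> pairs M"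
  using assms(1) by (induction L) (auto simp: f)

lemma pairs_swap: "L \<in> pairs M \<Longrightarrow> map prod.swap L \<in> pairs M"
  by (induction L) auto

lemma fin_op_swap: "L \<in> pairs M \<Longrightarrow> is_adjoint M (fin_op M L) (fin_op M (map prod.swap L))"
  unfolding is_adjoint_def
proof (induction L)
  case (Cons p L)
  obtain x y where p: "p = (x, y)" by (cases p)
  show ?case
    using Cons pairs_swap[of L] by (auto simp: p fin_op_carrier ip_simps ip_star)
qed (simp del: fin_op_Nil)

lemma fin_op_adjointable: "L \<in> pairs M \<Longrightarrow> fin_op M L \<in> adjointables M"
  by (rule adjointablesI[where S = "fin_op M (map prod.swap L)"])
    (auto simp: fin_op_swap fin_op_carrier pairs_swap fin_op_extensional)

lemma fin_op_comp:
  assumes "T \<in> adjointables M" "L \<in> pairs M" "z \<in> carrier M"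
  shows "fin_op M (map (\<lambda>(x, y). (T x, y)) L) z = T (fin_op M L z)"
  using assms(2)
proof (induction L)
  case (Cons p L)
  then show ?case
    using assms by (auto simp: fin_op_carrier adjoint_add adjoint_ract split: prod.splits)
qed (use assms in \<open>simp add: adjoint_zero del: fin_op_Nil\<close>)

text \<open>The scalars of the inductive definition are absorbed into the left vectors.\<close>

lemma finite_rank_eq: "finite_rank M = fin_op M ` pairs M"
proof (intro subset_antisym subsetI)
  fix S assume "S \<in> finite_rank M"
  then show "S \<in> fin_op M ` pairs M"
  proof induction
    case zero
    then show ?case by (intro image_eqI[of _ _ "[]"]) auto
  next
    case (add S x y c)
    then obtain L where "L \<in> pairs M" "S = fin_op M L" by auto
    then show ?case using add
      by (intro image_eqI[of _ _ "(c \<odot> x, y) # L"])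
        (auto simp: op_add_def op_scale_def rank_one_def ract_smult fun_eq_iff fin_op_def)
  qed
next
  fix S assume "S \<in> fin_op M ` pairs M"
  then obtain L where L: "L \<in> pairs M" "S = fin_op M L" by auto
  have "fin_op M L \<in> finite_rank M" using L(1)
  proof (induction L)
    case (Cons p L)
    obtain x y where p: "p = (x, y)" by (cases p)
    have "op_add M (op_scale M 1 (rank_one M x y)) (fin_op M L) \<in> finite_rank M"
      using Cons by (intro finite_rank.add) (auto simp: p)
    moreover have "op_add M (op_scale M 1 (rank_one M x y)) (fin_op M L) = fin_op M (p # L)"
      using Cons by (auto simp: p op_add_def op_scale_def rank_one_def fin_op_def fun_eq_iff)
    ultimately show ?case by simp
  qed (simp add: finite_rank.zero)
  then show "S \<in> finite_rank M" using L by simp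
qed

lemma compacts_iff:
  "T \<in> compacts M \<longleftrightarrow> T \<in> adjointables M \<and> (\<forall>\<epsilon>>0. \<exists>L\<in>pairs M. op_near M T (fin_op M L) \<epsilon>)"
  by (auto simp: compacts_def finite_rank_eq op_near_def)

lemma op_near_refl: "T \<in> adjointables M \<Longrightarrow> k \<ge> 0 \<Longrightarrow> op_near M T T k"
  by (auto simp: op_near_def adjointables_carrier diff_eq_zero_iff[THEN iffD2])

lemma fin_op_compact: "L \<in> pairs M \<Longrightarrow> fin_op M L \<in> compacts M"
  unfolding compacts_iff by (auto intro!: bexI[of _ L] op_near_refl fin_op_adjointable)

lemma fin_op_bounded: "L \<in> pairs M \<Longrightarrow> \<exists>k\<ge>0. op_bound M (fin_op M L) k"
proof (induction L)
  case Nil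
  show ?case by (rule exI[of _ 0]) (simp add: op_bound_def op_zero_def)
next
  case (Cons p L)
  obtain x y where p: "p = (x, y)" by (cases p)
  obtain k where k: "k \<ge> 0" "op_bound M (fin_op M L) k" using Cons by auto
  have "mnorm M (fin_op M (p # L) z) \<le> (mnorm M x * mnorm M y + k) * mnorm M z" if z: "z \<in> carrier M" for z
  proof -
    have "mnorm M (fin_op M (p # L) z) \<le> mnorm M (ract M x (ip M y z)) + mnorm M (fin_op M L z)"
      using Cons z by (auto simp: p fin_op_carrier intro!: mnorm_triangle)
    also have "\<dots> \<le> mnorm M x * (mnorm M y * mnorm M z) + k * mnorm M z"
      using Cons z k
      by (intro add_mono order_trans[OF mnorm_ract] mult_left_mono norm_ip) (auto simp: p op_bound_def)
    finally show ?thesis by (simp add: algebra_simps)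
  qed
  then show ?case using k by (intro exI[of _ "mnorm M x * mnorm M y + k"]) (auto simp: op_bound_def)
qed

lemma compact_bounded: assumes "T \<in> compacts M" shows "\<exists>k\<ge>0. op_bound M T k"
proof -
  obtain L where L: "L \<in> pairs M" "op_near M T (fin_op M L) 1"
    using assms unfolding compacts_iff by (metis zero_less_one)
  obtain k where k: "k \<ge> 0" "op_bound M (fin_op M L) k" using fin_op_bounded[OF L(1)] by auto
  have "mnorm M (T x) \<le> (1 + k) * mnorm M x" if x: "x \<in> carrier M" for x
  proof -
    have "mnorm M (T x) \<le> mnorm M (T x \<ominus> fin_op M L x) + mnorm M (fin_op M L x)"
      using assms x L by (intro mnorm_le_diff) (auto intro: adjointables_carrier compacts_adjointables fin_op_carrier)
    also have "\<dots> \<le> 1 * mnorm M x + k * mnorm M x"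
      using L k x by (intro add_mono) (auto simp: op_near_def op_bound_def)
    finally show ?thesis by (simp add: algebra_simps)
  qed
  then show ?thesis using k by (intro exI[of _ "1 + k"]) (auto simp: op_bound_def)
qed

lemma compact_limit:
  assumes "T \<in> adjointables M" "\<And>\<epsilon>. \<epsilon> > 0 \<Longrightarrow> \<exists>S\<in>compacts M. op_near M T S \<epsilon>"
  shows "T \<in> compacts M"
  unfolding compacts_iff
proof (intro conjI allI impI assms(1))
  fix \<epsilon> :: real assume \<epsilon>: "\<epsilon> > 0"
  obtain S where S: "S \<in> compacts M" "op_near M T S (\<epsilon>/2)" using assms(2)[of "\<epsilon>/2"] \<epsilon> by auto
  obtain L where L: "L \<in> pairs M" "op_near M S (fin_op M L) (\<epsilon>/2)"
    using S(1) \<epsilon> unfolding compacts_iff by (meson half_gt_zero)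
  have "op_near M T (fin_op M L) (\<epsilon>/2 + \<epsilon>/2)"
    using S L assms(1) by (intro op_near_trans[of T S]) (auto simp: fin_op_adjointable compacts_adjointables)
  then show "\<exists>L\<in>pairs M. op_near M T (fin_op M L) \<epsilon>" using L by auto
qed

lemma op_add_adjointable:
  assumes S: "S \<in> adjointables M" and T: "T \<in> adjointables M"
  shows "op_add M S T \<in> adjointables M"
proof -
  obtain S' T' where "S' \<in> adjointables M" "is_adjoint M S S'" "T' \<in> adjointables M" "is_adjoint M T T'"
    using adjointableE[OF S] adjointableE[OF T] by metis
  then show ?thesis
    using assms
    by (intro adjointablesI[where S = "\<lambda>x. S' x \<oplus> T' x"])
      (auto simp: op_add_def is_adjoint_def ip_simps adjointables_carrier)
qed

lemma op_scale_adjointable: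
  assumes T: "T \<in> adjointables M"
  shows "op_scale M c T \<in> adjointables M"
proof -
  obtain T' where "T' \<in> adjointables M" "is_adjoint M T T'"
    using adjointableE[OF T] by metis
  then show ?thesis
    using assms
    by (intro adjointablesI[where S = "\<lambda>x. cnj c \<odot> T' x"])
      (auto simp: op_scale_def is_adjoint_def ip_simps adjointables_carrier)
qed

lemma op_comp_adjointable:
  assumes S: "S \<in> adjointables M" and T: "T \<in> adjointables M"
  shows "op_comp M S T \<in> adjointables M"
proof -
  obtain S' T' where "S' \<in> adjointables M" "is_adjoint M S S'" "T' \<in> adjointables M" "is_adjoint M T T'"
    using adjointableE[OF S] adjointableE[OF T] by metis
  then show ?thesis
    using assms
    by (intro adjointablesI[where S = "\<lambda>x. T' (S' x)"])
      (auto simp: compose_def is_adjoint_def adjointables_carrier)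
qed

lemma op_near_add:
  assumes "op_near M S S' j" "op_near M T T' k"
    and "S \<in> adjointables M" "S' \<in> adjointables M" "T \<in> adjointables M" "T' \<in> adjointables M"
  shows "op_near M (op_add M S T) (op_add M S' T') (j + k)"
  unfolding op_near_def
proof
  fix x assume x: "x \<in> carrier M"
  note c = assms(3-6)[THEN adjointables_carrier, OF x]
  have "op_add M S T x \<ominus> op_add M S' T' x = (S x \<ominus> S' x) \<oplus> (T x \<ominus> T' x)"
    using x c by (intro ip_eqI) (auto simp: op_add_def ip_simps)
  then have "mnorm M (op_add M S T x \<ominus> op_add M S' T' x) \<le> mnorm M (S x \<ominus> S' x) + mnorm M (T x \<ominus> T' x)"
    using c by (auto intro: mnorm_triangle)
  also have "\<dots> \<le> j * mnorm M x + k * mnorm M x" using assms x by (intro add_mono) (auto simp: op_near_def)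
  finally show "mnorm M (op_add M S T x \<ominus> op_add M S' T' x) \<le> (j + k) * mnorm M x" by (simp add: algebra_simps)
qed

lemma op_near_scale:
  assumes "op_near M S T k" "S \<in> adjointables M" "T \<in> adjointables M"
  shows "op_near M (op_scale M c S) (op_scale M c T) (cmod c * k)"
  unfolding op_near_def
proof
  fix x assume x: "x \<in> carrier M"
  note c = assms(2-3)[THEN adjointables_carrier, OF x]
  have "op_scale M c S x \<ominus> op_scale M c T x = c \<odot> (S x \<ominus> T x)"
    using x c by (intro ip_eqI) (auto simp: op_scale_def ip_simps scaleC_diff_right)
  then show "mnorm M (op_scale M c S x \<ominus> op_scale M c T x) \<le> cmod c * k * mnorm M x"
    using assms(1) x c by (auto simp: mnorm_smult op_near_def mult.assoc intro: mult_left_mono)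
qed

lemma op_near_comp:
  assumes "op_near M S S' j" "op_near M T T' k" "op_bound M S a" "op_bound M T' b" "a \<ge> 0" "j \<ge> 0"
    and "S \<in> adjointables M" "S' \<in> adjointables M" "T \<in> adjointables M" "T' \<in> adjointables M"
  shows "op_near M (op_comp M S T) (op_comp M S' T') (a * k + j * b)"
  unfolding op_near_def
proof
  fix x assume x: "x \<in> carrier M"
  note c = assms(7-10)[THEN adjointables_carrier]
  have "mnorm M (S (T x) \<ominus> S' (T' x)) \<le> mnorm M (S (T x) \<ominus> S (T' x)) + mnorm M (S (T' x) \<ominus> S' (T' x))"
    using x c by (intro mnorm_minus_triangle) auto
  also have "S (T x) \<ominus> S (T' x) = S (T x \<ominus> T' x)" using x c assms by (simp add: adjoint_minus)
  also have "mnorm M (S (T x \<ominus> T' x)) \<le> a * (k * mnorm M x)"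
    using assms x c by (intro order_trans[OF assms(3)[unfolded op_bound_def, rule_format] mult_left_mono]) (auto simp: op_near_def)
  also have "mnorm M (S (T' x) \<ominus> S' (T' x)) \<le> j * (b * mnorm M x)"
    using assms x c by (intro order_trans[OF assms(1)[unfolded op_near_def, rule_format] mult_left_mono]) (auto simp: op_bound_def)
  finally show "mnorm M (op_comp M S T x \<ominus> op_comp M S' T' x) \<le> (a * k + j * b) * mnorm M x"
    using x by (simp add: compose_def algebra_simps)
qed

end


section \<open>Norm limits, products, sums and multiples of compact operators\<close>

context right_hilbert_module
begin

text \<open>Completeness of the module gives a limit at each vector, and the uniform estimates
  survive the limit in one index. The result is only a function so far; an adjoint has to be found
  separately.\<close>

lemma op_pointwise_limit:
  fixes L :: "nat \<Rightarrow> _"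
  assumes L: "\<And>n. L n \<in> adjointables M"
    and cauchy: "\<And>\<epsilon>. \<epsilon> > 0 \<Longrightarrow> \<exists>N. \<forall>m\<ge>N. \<forall>n\<ge>N. op_near M (L m) (L n) \<epsilon>"
  obtains T where "T \<in> carrier M \<rightarrow>\<^sub>E carrier M" "\<And>\<epsilon>. \<epsilon> > 0 \<Longrightarrow> \<exists>N. \<forall>n\<ge>N. op_near M T (L n) \<epsilon>"
proof -
  have "\<exists>y\<in>carrier M. (\<lambda>n. mnorm M (L n x \<ominus> y)) \<longlonglongrightarrow> 0" if x: "x \<in> carrier M" for x
  proof (rule cauchy_complete)
    show "L n x \<in> carrier M" for n using L x by (rule adjointables_carrier)
    show "\<forall>\<epsilon>>0. \<exists>N. \<forall>m\<ge>N. \<forall>n\<ge>N. mnorm M (L m x \<ominus> L n x) < \<epsilon>"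
    proof (intro allI impI)
      fix \<epsilon> :: real assume \<epsilon>: "\<epsilon> > 0"
      define d where "d = \<epsilon> / (mnorm M x + 1)"
      have m: "mnorm M x + 1 > 0" by (simp add: add_nonneg_pos)
      have d: "d > 0" "d * mnorm M x < \<epsilon>" using \<epsilon> m by (simp_all add: d_def field_simps)
      obtain N where N: "\<forall>m\<ge>N. \<forall>n\<ge>N. op_near M (L m) (L n) d" using cauchy[OF d(1)] by blast
      have "mnorm M (L m x \<ominus> L n x) < \<epsilon>" if "m \<ge> N" "n \<ge> N" for m n
        using N[rule_format, OF that] x d(2) unfolding op_near_def by force
      then show "\<exists>N. \<forall>m\<ge>N. \<forall>n\<ge>N. mnorm M (L m x \<ominus> L n x) < \<epsilon>" by blast
    qed
  qed
  then obtain T where T: "\<And>x. x \<in> carrier M \<Longrightarrow> T x \<in> carrier M \<and> (\<lambda>n. mnorm M (L n x \<ominus> T x)) \<longlonglongrightarrow> 0"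
    by metis
  have "\<exists>N. \<forall>n\<ge>N. op_near M (restrict T (carrier M)) (L n) \<epsilon>" if \<epsilon>: "\<epsilon> > 0" for \<epsilon>
  proof -
    obtain N where N: "\<And>m n. m \<ge> N \<Longrightarrow> n \<ge> N \<Longrightarrow> op_near M (L m) (L n) \<epsilon>" using cauchy[OF \<epsilon>] by blast
    have "mnorm M (T x \<ominus> L n x) \<le> \<epsilon> * mnorm M x" if n: "n \<ge> N" and x: "x \<in> carrier M" for n x
    proof -
      have c: "L k x \<in> carrier M" "T x \<in> carrier M" for k using T x adjointables_carrier[OF L] by auto
      have "(\<lambda>m. mnorm M (L m x \<ominus> T x) + \<epsilon> * mnorm M x) \<longlonglongrightarrow> 0 + \<epsilon> * mnorm M x"
        using T[OF x] by (intro tendsto_intros) auto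
      moreover have "\<exists>N. \<forall>m\<ge>N. mnorm M (T x \<ominus> L n x) \<le> mnorm M (L m x \<ominus> T x) + \<epsilon> * mnorm M x"
      proof (intro exI allI impI)
        fix m assume "m \<ge> N"
        then have "mnorm M (L m x \<ominus> L n x) \<le> \<epsilon> * mnorm M x" using N[OF _ n] x by (simp add: op_near_def)
        then show "mnorm M (T x \<ominus> L n x) \<le> mnorm M (L m x \<ominus> T x) + \<epsilon> * mnorm M x"
          using mnorm_minus_triangle[of "T x" "L m x" "L n x"] mnorm_minus_commute[of "T x" "L m x"] c by simp
      qed
      ultimately have "mnorm M (T x \<ominus> L n x) \<le> 0 + \<epsilon> * mnorm M x" by (rule LIMSEQ_le_const)
      then show ?thesis by simp
    qed
    then show ?thesis by (intro exI[of _ N]) (simp add: op_near_def)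
  qed
  then show thesis using T by (intro that[of "restrict T (carrier M)"]) auto
qed

text \<open>Passing to adjoints preserves \<open>op_near\<close>, so the adjoints form a Cauchy
  sequence too, and their limit is an adjoint of the limit.\<close>

lemma compacts_complete:
  fixes L :: "nat \<Rightarrow> _"
  assumes L: "\<And>n. L n \<in> compacts M"
    and cauchy: "\<And>\<epsilon>. \<epsilon> > 0 \<Longrightarrow> \<exists>N. \<forall>m\<ge>N. \<forall>n\<ge>N. op_near M (L m) (L n) \<epsilon>"
  obtains T where "T \<in> compacts M" "\<And>\<epsilon>. \<epsilon> > 0 \<Longrightarrow> \<exists>N. \<forall>n\<ge>N. op_near M T (L n) \<epsilon>"
proof -
  have La: "L n \<in> adjointables M" for n using L by (rule compacts_adjointables)
  have "\<exists>S. S \<in> adjointables M \<and> is_adjoint M (L n) S" for n using La adjointableE by metis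
  then obtain L' where L': "\<And>n. L' n \<in> adjointables M" "\<And>n. is_adjoint M (L n) (L' n)" by metis
  have cauchy': "\<exists>N. \<forall>m\<ge>N. \<forall>n\<ge>N. op_near M (L' m) (L' n) \<epsilon>" if \<epsilon>: "\<epsilon> > 0" for \<epsilon>
  proof -
    obtain N where "\<forall>m\<ge>N. \<forall>n\<ge>N. op_near M (L m) (L n) \<epsilon>" using cauchy[OF \<epsilon>] by blast
    then show ?thesis
      using \<epsilon> by (intro exI[of _ N] allI impI) (rule op_near_adjoint[OF L'(2) L'(2) _ _ La La L'(1) L'(1)]; simp)
  qed
  obtain T where T: "T \<in> carrier M \<rightarrow>\<^sub>E carrier M" "\<And>\<epsilon>. \<epsilon> > 0 \<Longrightarrow> \<exists>N. \<forall>n\<ge>N. op_near M T (L n) \<epsilon>"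
    using op_pointwise_limit[OF La cauchy] by blast
  obtain S where S: "S \<in> carrier M \<rightarrow>\<^sub>E carrier M" "\<And>\<epsilon>. \<epsilon> > 0 \<Longrightarrow> \<exists>N. \<forall>n\<ge>N. op_near M S (L' n) \<epsilon>"
    using op_pointwise_limit[OF L'(1) cauchy'] by blast
  have "is_adjoint M T S"
    unfolding is_adjoint_def
  proof (intro ballI)
    fix x y assume xy: "x \<in> carrier M" "y \<in> carrier M"
    have c: "T x \<in> carrier M" "S y \<in> carrier M" "L n x \<in> carrier M" "L' n y \<in> carrier M" for n
      using T S xy La L' by (auto intro: adjointables_carrier)
    have "norm (ip M (T x) y - ip M x (S y)) \<le> 0"
    proof (rule field_le_epsilon)
      fix e :: real assume e: "e > 0"
      define K where "K = mnorm M x * mnorm M y"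
      define d where "d = e / (2 * K + 1)"
      have K: "K \<ge> 0" by (simp add: K_def)
      have d: "d > 0" "2 * (d * K) \<le> e" using e K by (simp_all add: d_def field_simps)
      obtain n where n: "op_near M T (L n) d" "op_near M S (L' n) d"
        using T(2)[OF d(1)] S(2)[OF d(1)] by (meson nle_le)
      have "ip M (T x) y - ip M x (S y) = ip M (T x \<ominus> L n x) y - ip M x (S y \<ominus> L' n y)"
        using c xy L'(2)[of n] by (simp add: ip_simps is_adjoint_def)
      then have "norm (ip M (T x) y - ip M x (S y)) \<le> norm (ip M (T x \<ominus> L n x) y) + norm (ip M x (S y \<ominus> L' n y))"
        by (simp add: norm_triangle_ineq4)
      also have "\<dots> \<le> (d * mnorm M x) * mnorm M y + mnorm M x * (d * mnorm M y)"
      proof (rule add_mono)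
        show "norm (ip M (T x \<ominus> L n x) y) \<le> (d * mnorm M x) * mnorm M y"
          using n(1) xy c by (intro order_trans[OF norm_ip] mult_right_mono) (auto simp: op_near_def)
        show "norm (ip M x (S y \<ominus> L' n y)) \<le> mnorm M x * (d * mnorm M y)"
          using n(2) xy c by (intro order_trans[OF norm_ip] mult_left_mono) (auto simp: op_near_def)
      qed
      also have "\<dots> \<le> 0 + e" using d(2) by (simp add: K_def algebra_simps)
      finally show "norm (ip M (T x) y - ip M x (S y)) \<le> 0 + e" .
    qed
    then show "ip M (T x) y = ip M x (S y)" by simp
  qed
  then have "T \<in> adjointables M" using T S by (auto simp: adjointables_def)
  then have "T \<in> compacts M" using T(2) L by (meson compact_limit le_refl)
  then show thesis using T(2) that by blast
qed

text \<open>S after x \<otimes> y* is S x \<otimes> y*, so composing with a finite-rank approximant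
  of \<open>T\<close> stays within finite rank.\<close>

lemma op_comp_compact:
  assumes S: "S \<in> compacts M" and T: "T \<in> compacts M"
  shows "op_comp M S T \<in> compacts M"
proof (rule compact_limit)
  note Sa = compacts_adjointables[OF S] and Ta = compacts_adjointables[OF T]
  show "op_comp M S T \<in> adjointables M" using Sa Ta by (rule op_comp_adjointable)
  fix \<epsilon> :: real assume \<epsilon>: "\<epsilon> > 0"
  obtain a where a: "a \<ge> 0" "op_bound M S a" using compact_bounded[OF S] by blast
  define d where "d = \<epsilon> / (a + 1)"
  have d: "d > 0" "a * d \<le> \<epsilon>" using \<epsilon> a by (simp_all add: d_def field_simps)
  obtain L where L: "L \<in> pairs M" "op_near M T (fin_op M L) d" using T d(1) unfolding compacts_iff by blast
  obtain b where b: "b \<ge> 0" "op_bound M (fin_op M L) b" using fin_op_bounded[OF L(1)] by blast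
  have "op_near M (op_comp M S T) (op_comp M S (fin_op M L)) (a * d + 0 * b)"
    by (intro op_near_comp op_near_refl L a b Sa Ta fin_op_adjointable) auto
  moreover have "op_comp M S (fin_op M L) = fin_op M (map (\<lambda>(x, y). (S x, y)) L)"
  proof (rule extensionalityI)
    show "op_comp M S (fin_op M L) \<in> extensional (carrier M)" by (simp add: compose_def)
  qed (simp_all add: fin_op_extensional compose_def fin_op_comp[OF Sa L(1)])
  moreover have "fin_op M (map (\<lambda>(x, y). (S x, y)) L) \<in> compacts M"
    by (intro fin_op_compact pairs_map_fst L) (rule adjointables_carrier[OF Sa])
  ultimately show "\<exists>R\<in>compacts M. op_near M (op_comp M S T) R \<epsilon>"
    using d(2) unfolding op_near_def by (auto intro!: bexI order_trans[OF _ mult_right_mono[OF d(2)]])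
qed

lemma op_add_compact:
  assumes S: "S \<in> compacts M" and T: "T \<in> compacts M"
  shows "op_add M S T \<in> compacts M"
  unfolding compacts_iff
proof (intro conjI allI impI)
  note Sa = compacts_adjointables[OF S] and Ta = compacts_adjointables[OF T]
  show "op_add M S T \<in> adjointables M" using Sa Ta by (rule op_add_adjointable)
  fix \<epsilon> :: real assume \<epsilon>: "\<epsilon> > 0"
  obtain L L' where L: "L \<in> pairs M" "op_near M S (fin_op M L) (\<epsilon>/2)" "L' \<in> pairs M" "op_near M T (fin_op M L') (\<epsilon>/2)"
    using S T \<epsilon> unfolding compacts_iff by (meson half_gt_zero)
  have "op_near M (op_add M S T) (op_add M (fin_op M L) (fin_op M L')) (\<epsilon>/2 + \<epsilon>/2)"
    by (intro op_near_add L Sa Ta fin_op_adjointable)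
  moreover have "op_add M (fin_op M L) (fin_op M L') = fin_op M (L @ L')"
    by (rule extensionalityI[where A = "carrier M"])
      (simp_all add: op_add_def fin_op_extensional fin_op_append L)
  ultimately show "\<exists>L\<in>pairs M. op_near M (op_add M S T) (fin_op M L) \<epsilon>"
    using L by (intro bexI[of _ "L @ L'"]) auto
qed

lemma op_scale_compact:
  assumes T: "T \<in> compacts M"
  shows "op_scale M c T \<in> compacts M"
  unfolding compacts_iff
proof (intro conjI allI impI)
  note Ta = compacts_adjointables[OF T]
  show "op_scale M c T \<in> adjointables M" using Ta by (rule op_scale_adjointable)
  fix \<epsilon> :: real assume \<epsilon>: "\<epsilon> > 0"
  define d where "d = \<epsilon> / (cmod c + 1)"
  have c: "cmod c + 1 > 0" by (simp add: add_nonneg_pos)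
  have d: "d > 0" "cmod c * d \<le> \<epsilon>" using \<epsilon> c by (simp_all add: d_def field_simps)
  obtain L where L: "L \<in> pairs M" "op_near M T (fin_op M L) d"
    using T d(1) unfolding compacts_iff by blast
  have "op_near M (op_scale M c T) (op_scale M c (fin_op M L)) (cmod c * d)"
    by (intro op_near_scale L Ta fin_op_adjointable)
  moreover have "op_scale M c (fin_op M L) = fin_op M (map (\<lambda>(x, y). (c \<odot> x, y)) L)"
    by (rule extensionalityI[where A = "carrier M"])
      (simp_all add: op_scale_def fin_op_extensional fin_op_smult L)
  ultimately have "op_near M (op_scale M c T) (fin_op M (map (\<lambda>(x, y). (c \<odot> x, y)) L)) \<epsilon>"
    using d(2) unfolding op_near_def by (auto intro!: order_trans[OF _ mult_right_mono[OF d(2)]])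
  then show "\<exists>L\<in>pairs M. op_near M (op_scale M c T) (fin_op M L) \<epsilon>"
    using L by (intro bexI[of _ "map (\<lambda>(x, y). (c \<odot> x, y)) L"] pairs_map_fst) auto
qed

end


subsection \<open>The homomorphism on the compact operators induced by a representation\<close>

text \<open>A substitute for the spectral radius formula: if a > k, the hypothesis bounds
  \<open>c\<close> by C (k/a)^n, which tends to 0.\<close>

lemma power_growth_le:
  fixes a k C c :: real
  assumes "a \<ge> 0" "k \<ge> 0" "c > 0" and le: "\<And>n. a ^ n * c \<le> C * k ^ n"
  shows "a \<le> k"
proof (rule ccontr)
  assume "\<not> a \<le> k"
  then have a: "a > 0" "k / a < 1" using assms by auto
  have "c \<le> C * (k / a) ^ n" for n
    using le[of n] a by (simp add: power_divide pos_le_divide_eq mult.commute)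
  moreover have "(\<lambda>n. C * (k / a) ^ n) \<longlonglongrightarrow> C * 0"
    by (rule tendsto_mult_left[OF LIMSEQ_realpow_zero]) (use a assms in auto)
  ultimately have "c \<le> C * 0" by (intro LIMSEQ_le_const) auto
  then show False using assms by simp
qed

text \<open>The coefficient map \<open>\<sigma>\<close> is kept apart from \<open>\<psi>\<close>
  because two kinds of instances are needed: the fibres with values in the target algebra, and the
  identity fibre with values in A, where \<open>\<sigma>\<close> is the identity.\<close>

locale module_rep = right_hilbert_module M
  for M :: "('a::cstar_algebra, 'x) bimodule" (structure) +
  fixes \<sigma> :: "'a \<Rightarrow> 'b::cstar_algebra" and \<psi> :: "'x \<Rightarrow> 'b"
  assumes psi_add: "\<lbrakk>x \<in> carrier M; y \<in> carrier M\<rbrakk> \<Longrightarrow> \<psi> (x \<oplus> y) = \<psi> x + \<psi> y"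
    and psi_smult: "x \<in> carrier M \<Longrightarrow> \<psi> (c \<odot> x) = c *\<^sub>C \<psi> x"
    and psi_ract: "x \<in> carrier M \<Longrightarrow> \<psi> (ract M x a) = \<psi> x * \<sigma> a"
    and psi_ip: "\<lbrakk>x \<in> carrier M; y \<in> carrier M\<rbrakk> \<Longrightarrow> \<sigma> (ip M x y) = star (\<psi> x) * \<psi> y"
    and sigma_contractive: "norm (\<sigma> a) \<le> norm a"
begin

lemma norm_psi: assumes "x \<in> carrier M" shows "norm (\<psi> x) \<le> mnorm M x"
proof (rule power2_le_imp_le)
  have "(norm (\<psi> x))\<^sup>2 = norm (\<sigma> (ip M x x))" using assms by (simp add: psi_ip cstar_identity)
  also have "\<dots> \<le> (mnorm M x)\<^sup>2" by (simp add: mnorm_sq sigma_contractive)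
  finally show "(norm (\<psi> x))\<^sup>2 \<le> (mnorm M x)\<^sup>2" .
qed simp

lemma psi_zero [simp]: "\<psi> \<zero> = 0"
  using psi_smult[of \<zero> 0] by simp

text \<open>Defined on lists, since it is not yet known that lists with the same operator have the
  same image; \<open>norm_rep_diff\<close> with k = 0 settles that.\<close>

definition rep :: "('x \<times> 'x) list \<Rightarrow> 'b" where
  "rep L = (\<Sum>(x, y)\<leftarrow>L. \<psi> x * star (\<psi> y))"

lemma rep_simps [simp]: "rep [] = 0" "rep ((x, y) # L) = \<psi> x * star (\<psi> y) + rep L"
  "rep (L @ L') = rep L + rep L'"
  by (simp_all add: rep_def)

lemma rep_mult_psi: "L \<in> pairs M \<Longrightarrow> z \<in> carrier M \<Longrightarrow> rep L * \<psi> z = \<psi> (fin_op M L z)"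
  by (induction L)
    (auto simp: fin_op_carrier psi_add psi_ract psi_ip distrib_right mult.assoc simp del: fin_op_Nil)

lemma rep_mult_rep:
  "L \<in> pairs M \<Longrightarrow> L' \<in> pairs M \<Longrightarrow> rep L * rep L' = rep (map (\<lambda>(x, y). (fin_op M L x, y)) L')"
  by (induction L') (auto simp: distrib_left rep_mult_psi simp flip: mult.assoc)

lemma rep_swap: "rep (map prod.swap L) = star (rep L)"
  by (induction L) (auto simp: star_simps)

lemma rep_smult: "L \<in> pairs M \<Longrightarrow> rep (map (\<lambda>(x, y). (c \<odot> x, y)) L) = c *\<^sub>C rep L"
  by (induction L) (auto simp: psi_smult scaleC_add_right scaleC_mult_left)

lemma norm_rep_le: "L \<in> pairs M \<Longrightarrow> norm (rep L) \<le> (\<Sum>(x, y)\<leftarrow>L. mnorm M x * mnorm M y)"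
proof (induction L)
  case (Cons p L)
  obtain x y where p: "p = (x, y)" by (cases p)
  have "norm (rep (p # L)) \<le> norm (\<psi> x * star (\<psi> y)) + norm (rep L)"
    by (simp add: p norm_triangle_ineq)
  also have "\<dots> \<le> mnorm M x * mnorm M y + (\<Sum>(x, y)\<leftarrow>L. mnorm M x * mnorm M y)"
    using Cons by (intro add_mono order_trans[OF norm_mult_ineq] mult_mono) (auto simp: p norm_psi)
  finally show ?case by (simp add: p)
qed simp

text \<open>
  For a selfadjoint finite-rank operator, \<open>rep L ^ (n + 1)\<close> is \<open>rep\<close> of the list with first
  components multiplied by the \<open>n\<close>-th power of the operator; compare the growth of the norms.
\<close>

lemma norm_rep_bound:
  assumes L: "L \<in> pairs M" and bd: "op_bound M (fin_op M L) k" and k: "k \<ge> 0"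
  shows "norm (rep L) \<le> k"
proof -
  have sa: "norm (rep L) \<le> k" if L: "L \<in> pairs M" and bd: "op_bound M (fin_op M L) k" and k: "k \<ge> 0"
    and sa: "star (rep L) = rep L" for L k
  proof (cases "norm (rep L) = 0")
    case False
    define C where "C = (\<Sum>(x, y)\<leftarrow>L. mnorm M x * mnorm M y)"
    define Ln where "Ln n = map (\<lambda>(x, y). ((fin_op M L ^^ n) x, y)) L" for n
    have pow: "(fin_op M L ^^ n) x \<in> carrier M" "mnorm M ((fin_op M L ^^ n) x) \<le> k ^ n * mnorm M x"
      if x: "x \<in> carrier M" for n x
    proof -
      have "(fin_op M L ^^ n) x \<in> carrier M \<and> mnorm M ((fin_op M L ^^ n) x) \<le> k ^ n * mnorm M x"
      proof (induction n)
        case (Suc n)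
        have "mnorm M (fin_op M L ((fin_op M L ^^ n) x)) \<le> k * mnorm M ((fin_op M L ^^ n) x)"
          using bd Suc by (simp add: op_bound_def)
        also have "\<dots> \<le> k * (k ^ n * mnorm M x)" using Suc k by (intro mult_left_mono) auto
        finally show ?case using Suc L by (simp add: fin_op_carrier)
      qed (simp add: x)
      then show "(fin_op M L ^^ n) x \<in> carrier M" "mnorm M ((fin_op M L ^^ n) x) \<le> k ^ n * mnorm M x" by auto
    qed
    have LnP: "Ln n \<in> pairs M" for n unfolding Ln_def by (intro pairs_map_fst L pow)
    \<comment> \<open>The powers are taken in the unitization, where a unit is available for
      \<open>^\<close>.\<close>
    have power: "embed (rep L) ^ Suc n = embed (rep (Ln n))" for n
    proof (induction n)
      case 0
      then show ?case by (simp add: Ln_def case_prod_unfold)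
    next
      case (Suc n)
      have "rep L * rep (Ln n) = rep (map (\<lambda>(x, y). (fin_op M L x, y)) (Ln n))"
        by (rule rep_mult_rep[OF L LnP])
      also have "map (\<lambda>(x, y). (fin_op M L x, y)) (Ln n) = Ln (Suc n)" by (simp add: Ln_def case_prod_unfold)
      finally have eq: "rep L * rep (Ln n) = rep (Ln (Suc n))" .
      have "embed (rep L) ^ Suc (Suc n) = embed (rep L) * embed (rep (Ln n))"
        by (simp only: power_Suc[of _ "Suc n"] Suc.IH)
      then show ?case by (simp only: eq flip: embed_mult)
    qed
    have sae: "star (embed (rep L)) = embed (rep L)" using sa by (simp flip: embed_star)
    have "norm (rep L) ^ n * norm (rep L) \<le> C * k ^ n" for n
    proof -
      have "norm (rep L) ^ n * norm (rep L) = norm (embed (rep L) ^ Suc n)"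
        unfolding norm_power_selfadjoint[OF sae] by simp
      also have "\<dots> = norm (rep (Ln n))" by (simp only: power norm_embed)
      also have "\<dots> \<le> (\<Sum>(x, y)\<leftarrow>Ln n. mnorm M x * mnorm M y)" by (rule norm_rep_le[OF LnP])
      also have "\<dots> = (\<Sum>(x, y)\<leftarrow>L. mnorm M ((fin_op M L ^^ n) x) * mnorm M y)"
        by (simp add: Ln_def case_prod_unfold comp_def)
      also have "\<dots> \<le> (\<Sum>(x, y)\<leftarrow>L. (k ^ n * mnorm M x) * mnorm M y)"
        using L pow(2) by (intro sum_list_mono) (auto simp: pairs_def intro!: mult_right_mono)
      also have "\<dots> = C * k ^ n" by (simp add: C_def sum_list_const_mult case_prod_unfold mult.assoc mult.commute[of _ "k ^ n"])
      finally show ?thesis .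
    qed
    note growth = this
    show ?thesis
      by (rule power_growth_le[OF norm_ge_zero k _ growth]) (use False in simp)
  qed (simp add: k)
  define L' where "L' = map prod.swap L"
  \<comment> \<open>This list has the operator \<Theta>* \<Theta> and the image t* t, for which the
    selfadjoint case gives the bound k^2; the C*-identity takes the root.\<close>
  define L'' where "L'' = map (\<lambda>(x, y). (fin_op M L' x, y)) L"
  have L': "L' \<in> pairs M" unfolding L'_def by (rule pairs_swap[OF L])
  have L'': "L'' \<in> pairs M" unfolding L''_def by (intro pairs_map_fst L fin_op_carrier L')
  have "op_bound M (fin_op M L') k"
    using op_bound_adjoint[OF fin_op_swap[OF L] bd k] fin_op_carrier[OF L] fin_op_carrier[OF L'] by (simp add: L'_def)
  note bd' = this
  have "op_bound M (fin_op M L'') (k * k)"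
    unfolding op_bound_def
  proof
    fix z assume z: "z \<in> carrier M"
    have "mnorm M (fin_op M L'' z) = mnorm M (fin_op M L' (fin_op M L z))"
      unfolding L''_def using fin_op_comp[OF fin_op_adjointable[OF L'] L z] by simp
    also have "\<dots> \<le> k * mnorm M (fin_op M L z)"
      using bd' fin_op_carrier[OF L z] by (simp add: op_bound_def)
    also have "\<dots> \<le> k * (k * mnorm M z)"
      using bd z k by (intro mult_left_mono) (simp_all add: op_bound_def)
    finally show "mnorm M (fin_op M L'' z) \<le> k * k * mnorm M z" by (simp only: mult.assoc)
  qed
  moreover have "rep L'' = star (rep L) * rep L"
    unfolding L''_def using rep_mult_rep[OF L' L] by (simp add: L'_def rep_swap)
  ultimately have "norm (star (rep L) * rep L) \<le> k * k"
    using sa[OF L'', of "k * k"] k by (simp add: star_simps)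
  then have "(norm (rep L))\<^sup>2 \<le> k\<^sup>2" by (simp only: cstar_identity power2_eq_square[of k])
  then show ?thesis using k by (rule power2_le_imp_le)
qed

lemma norm_rep_diff:
  assumes L: "L \<in> pairs M" "L' \<in> pairs M" and near: "op_near M (fin_op M L) (fin_op M L') k" and k: "k \<ge> 0"
  shows "norm (rep L - rep L') \<le> k"
proof -
  define N where "N = L @ map (\<lambda>(x, y). ((-1) \<odot> x, y)) L'"
  have N': "map (\<lambda>(x, y). ((-1) \<odot> x, y)) L' \<in> pairs M" by (intro pairs_map_fst L) simp
  then have N: "N \<in> pairs M" using L by (simp add: N_def)
  have "fin_op M N z = fin_op M L z \<ominus> fin_op M L' z" if "z \<in> carrier M" for z
    using that L N' by (simp add: N_def fin_op_append fin_op_smult minus_eq fin_op_carrier)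
  then have "op_bound M (fin_op M N) k" using near by (simp add: op_near_def op_bound_def)
  then have "norm (rep N) \<le> k" using N k by (intro norm_rep_bound)
  moreover have "rep N = rep L - rep L'" using L by (simp add: N_def rep_smult)
  ultimately show ?thesis by simp
qed

text \<open>Characterised by all finite-rank approximations at once, with the same error, so that
  independence of an approximating sequence is part of the definition.\<close>

definition compact_rep :: "('x \<Rightarrow> 'x) \<Rightarrow> 'b" where
  "compact_rep T = (THE b. \<forall>\<epsilon>>0. \<forall>L\<in>pairs M. op_near M T (fin_op M L) \<epsilon> \<longrightarrow> norm (b - rep L) \<le> \<epsilon>)"

lemma compact_rep:
  assumes T: "T \<in> compacts M" and L: "L \<in> pairs M" "op_near M T (fin_op M L) \<epsilon>" "\<epsilon> > 0"
  shows "norm (compact_rep T - rep L) \<le> \<epsilon>"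
proof -
  note Ta = compacts_adjointables[OF T]
  define Q where "Q b \<longleftrightarrow> (\<forall>\<epsilon>>0. \<forall>L\<in>pairs M. op_near M T (fin_op M L) \<epsilon> \<longrightarrow> norm (b - rep L) \<le> \<epsilon>)" for b
  have "\<exists>L\<in>pairs M. op_near M T (fin_op M L) (1 / real (Suc n))" for n
    using T unfolding compacts_iff by simp
  then obtain Ls where Ls: "\<And>n. Ls n \<in> pairs M" "\<And>n. op_near M T (fin_op M (Ls n)) (1 / real (Suc n))" by metis
  \<comment> \<open>Two finite-rank approximants of \<open>T\<close> are close to each other, hence
    so are their images; this gives the Cauchy property and then the estimate for the limit.\<close>
  have diff: "norm (rep (Ls n) - rep L) \<le> 1 / real (Suc n) + \<epsilon>"
    if "L \<in> pairs M" "op_near M T (fin_op M L) \<epsilon>" "\<epsilon> > 0" for n L \<epsilon>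
    using that Ls Ta
    by (intro norm_rep_diff op_near_trans[of _ T] op_near_sym[of T]) (auto simp: fin_op_adjointable)
  have lim0: "(\<lambda>n. 1 / real (Suc n)) \<longlonglongrightarrow> 0" using lim_inverse_n' LIMSEQ_Suc by blast
  have "Cauchy (\<lambda>n. rep (Ls n))"
  proof (rule CauchyI)
    fix e :: real assume e: "e > 0"
    then obtain N where N: "\<And>n. n \<ge> N \<Longrightarrow> 1 / real (Suc n) < e / 2"
      using order_tendstoD(2)[OF lim0, of "e / 2"] by (auto simp: eventually_sequentially)
    have "norm (rep (Ls m) - rep (Ls n)) < e" if "m \<ge> N" "n \<ge> N" for m n
    proof -
      have "norm (rep (Ls m) - rep (Ls n)) \<le> 1 / real (Suc m) + 1 / real (Suc n)"
        by (rule diff[OF Ls(1) Ls(2)]) simp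
      then show ?thesis using N[OF that(1)] N[OF that(2)] by linarith
    qed
    then show "\<exists>N. \<forall>m\<ge>N. \<forall>n\<ge>N. norm (rep (Ls m) - rep (Ls n)) < e" by blast
  qed
  then obtain b where b: "(\<lambda>n. rep (Ls n)) \<longlonglongrightarrow> b" by (meson Cauchy_convergent convergent_def)
  have "Q b" unfolding Q_def
  proof (intro allI impI ballI)
    fix \<epsilon> :: real and L assume L: "\<epsilon> > 0" "L \<in> pairs M" "op_near M T (fin_op M L) \<epsilon>"
    have "(\<lambda>n. norm (rep (Ls n) - rep L)) \<longlonglongrightarrow> norm (b - rep L)" by (intro tendsto_intros b)
    moreover have "(\<lambda>n. 1 / real (Suc n) + \<epsilon>) \<longlonglongrightarrow> 0 + \<epsilon>" by (intro tendsto_intros lim0)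
    ultimately have "norm (b - rep L) \<le> 0 + \<epsilon>" using diff[OF L(2,3,1)] by (intro LIMSEQ_le) auto
    then show "norm (b - rep L) \<le> \<epsilon>" by simp
  qed
  moreover have "b' = b" if "Q b'" for b'
  proof -
    have "norm (rep (Ls n) - b') \<le> 1 / real (Suc n)" for n
    proof -
      have "0 < 1 / real (Suc n)" by simp
      from that[unfolded Q_def, rule_format, OF this Ls] show ?thesis by (simp only: norm_minus_commute)
    qed
    then have "(\<lambda>n. norm (rep (Ls n) - b')) \<longlonglongrightarrow> 0"
      by (intro tendsto_sandwich[OF _ _ tendsto_const lim0]) auto
    then have "(\<lambda>n. rep (Ls n)) \<longlonglongrightarrow> b'" by (rule LIM_zero_cancel[OF tendsto_norm_zero_cancel])
    then show ?thesis using b LIMSEQ_unique by blast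
  qed
  ultimately have "Q (compact_rep T)" unfolding compact_rep_def Q_def[symmetric] by (rule theI)
  then show ?thesis using L by (simp add: Q_def)
qed

lemma compact_seq:
  assumes "T \<in> compacts M"
  obtains L where "\<And>n. L n \<in> pairs M" "\<And>n. op_near M T (fin_op M (L n)) (1 / real (Suc n))"
proof -
  have "\<exists>L\<in>pairs M. op_near M T (fin_op M L) (1 / real (Suc n))" for n
    using assms unfolding compacts_iff by simp
  then show thesis using that by metis
qed

text \<open>The constant \<open>C\<close> is there for sums, products and scalar multiples, whose
  approximants converge at a rate multiplied by a constant.\<close>

lemma compact_rep_tendsto:
  assumes T: "T \<in> compacts M" and L: "\<And>n. L n \<in> pairs M" "\<And>n. op_near M T (fin_op M (L n)) (C * (1 / real (Suc n)))"
    and C: "C > 0"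
  shows "(\<lambda>n. rep (L n)) \<longlonglongrightarrow> compact_rep T"
proof -
  have lim0: "(\<lambda>n. 1 / real (Suc n)) \<longlonglongrightarrow> 0" using lim_inverse_n' LIMSEQ_Suc by blast
  have lim: "(\<lambda>n. C * (1 / real (Suc n))) \<longlonglongrightarrow> 0"
    using tendsto_mult_left[OF lim0, of C] by (simp only: mult_zero_right)
  have le: "norm (rep (L n) - compact_rep T) \<le> C * (1 / real (Suc n))" for n
  proof -
    have "0 < C * (1 / real (Suc n))" using C by simp
    from compact_rep[OF T L this] show ?thesis by (simp only: norm_minus_commute)
  qed
  show ?thesis
    by (rule LIM_zero_cancel[OF Lim_null_comparison[OF always_eventually[OF allI[OF le]] lim]])
qed

lemma compact_rep_fin_op: assumes L: "L \<in> pairs M" shows "compact_rep (fin_op M L) = rep L"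
proof -
  have "norm (compact_rep (fin_op M L) - rep L) \<le> 0 + e" if "e > 0" for e
    using compact_rep[OF fin_op_compact[OF L] L _ that] that L by (simp add: op_near_refl fin_op_adjointable)
  then have "norm (compact_rep (fin_op M L) - rep L) \<le> 0" by (rule field_le_epsilon)
  then show ?thesis by simp
qed

lemma compact_rep_hom: "compacts_hom M compact_rep"
  unfolding compacts_hom_def
proof (intro conjI ballI allI impI)
  fix S T assume S: "S \<in> compacts M" and T: "T \<in> compacts M"
  note Sa = compacts_adjointables[OF S] and Ta = compacts_adjointables[OF T]
  obtain L where L: "\<And>n. L n \<in> pairs M" "\<And>n. op_near M S (fin_op M (L n)) (1 / real (Suc n))"
    using compact_seq[OF S] by blast
  obtain K where K: "\<And>n. K n \<in> pairs M" "\<And>n. op_near M T (fin_op M (K n)) (1 / real (Suc n))"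
    using compact_seq[OF T] by blast
  have limS: "(\<lambda>n. rep (L n)) \<longlonglongrightarrow> compact_rep S" using compact_rep_tendsto[where C = 1, OF S L(1)] L(2) by simp
  have limT: "(\<lambda>n. rep (K n)) \<longlonglongrightarrow> compact_rep T" using compact_rep_tendsto[where C = 1, OF T K(1)] K(2) by simp
  note La = fin_op_adjointable[OF L(1)] and Ka = fin_op_adjointable[OF K(1)]
  show "compact_rep (op_add M S T) = compact_rep S + compact_rep T"
  proof -
    have "op_near M (op_add M S T) (fin_op M (L n @ K n)) (2 * (1 / real (Suc n)))" for n
    proof -
      have "op_near M (op_add M S T) (op_add M (fin_op M (L n)) (fin_op M (K n))) (1 / real (Suc n) + 1 / real (Suc n))"
        by (intro op_near_add L K Sa Ta La Ka)
      moreover have "op_add M (fin_op M (L n)) (fin_op M (K n)) = fin_op M (L n @ K n)"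
        by (rule extensionalityI[where A = "carrier M"])
          (simp_all add: op_add_def fin_op_extensional fin_op_append L K)
      ultimately show ?thesis by simp
    qed
    then have "(\<lambda>n. rep (L n @ K n)) \<longlonglongrightarrow> compact_rep (op_add M S T)"
      by (intro compact_rep_tendsto[where C = 2] op_add_compact S T) (auto simp: L K)
    moreover have "(\<lambda>n. rep (L n @ K n)) \<longlonglongrightarrow> compact_rep S + compact_rep T"
      using tendsto_add[OF limS limT] by simp
    ultimately show ?thesis by (rule LIMSEQ_unique)
  qed
  show "compact_rep (op_comp M S T) = compact_rep S * compact_rep T"
  proof -
    define N where "N n = map (\<lambda>(x, y). (fin_op M (L n) x, y)) (K n)" for n
    have N: "N n \<in> pairs M" for n unfolding N_def by (intro pairs_map_fst K fin_op_carrier L)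
    obtain a where a: "a \<ge> 0" "op_bound M S a" using compact_bounded[OF S] by blast
    obtain b where b: "b \<ge> 0" "op_bound M T b" using compact_bounded[OF T] by blast
    \<comment> \<open>A bound that does not depend on \<open>n\<close>: the distance of the
      approximant from \<open>T\<close> is at most 1 / (n + 1) \<le> 1.\<close>
    have bK: "op_bound M (fin_op M (K n)) (b + 1)" for n
      unfolding op_bound_def
    proof
      fix x assume x: "x \<in> carrier M"
      have "mnorm M (fin_op M (K n) x) \<le> mnorm M (fin_op M (K n) x \<ominus> T x) + mnorm M (T x)"
        using x adjointables_carrier[OF Ka] adjointables_carrier[OF Ta] by (intro mnorm_le_diff)
      also have "\<dots> \<le> (1 / real (Suc n)) * mnorm M x + b * mnorm M x"
        using op_near_sym[OF K(2) Ta Ka, of n] b x by (intro add_mono) (auto simp: op_near_def op_bound_def)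
      also have "\<dots> \<le> 1 * mnorm M x + b * mnorm M x" by (intro add_right_mono mult_right_mono) auto
      finally show "mnorm M (fin_op M (K n) x) \<le> (b + 1) * mnorm M x" by (simp add: algebra_simps)
    qed
    have "op_near M (op_comp M S T) (fin_op M (N n)) ((a + b + 1) * (1 / real (Suc n)))" for n
    proof -
      have "op_near M (op_comp M S T) (op_comp M (fin_op M (L n)) (fin_op M (K n)))
          (a * (1 / real (Suc n)) + (1 / real (Suc n)) * (b + 1))"
        by (intro op_near_comp L K Sa Ta La Ka a bK) simp
      moreover have "op_comp M (fin_op M (L n)) (fin_op M (K n)) = fin_op M (N n)"
        by (rule extensionalityI[where A = "carrier M"])
          (simp_all add: N_def compose_def fin_op_extensional fin_op_comp[OF La K(1)])
      ultimately show ?thesis by (simp add: algebra_simps add_divide_distrib)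
    qed
    then have "(\<lambda>n. rep (N n)) \<longlonglongrightarrow> compact_rep (op_comp M S T)"
      using a b by (intro compact_rep_tendsto[where C = "a + b + 1"] op_comp_compact S T N) auto
    moreover have "(\<lambda>n. rep (N n)) \<longlonglongrightarrow> compact_rep S * compact_rep T"
      using tendsto_mult[OF limS limT] by (simp add: rep_mult_rep L K N_def)
    ultimately show ?thesis by (rule LIMSEQ_unique)
  qed
  show "compact_rep T = star (compact_rep S)" if adj: "is_adjoint M S T"
  proof -
    have "op_near M T (fin_op M (map prod.swap (L n))) (1 * (1 / real (Suc n)))" for n
      using op_near_adjoint[OF adj fin_op_swap[OF L(1)] L(2)] Sa Ta La
      by (simp add: fin_op_adjointable pairs_swap L)
    then have "(\<lambda>n. rep (map prod.swap (L n))) \<longlonglongrightarrow> compact_rep T"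
      by (intro compact_rep_tendsto[where C = 1] T) (auto simp: pairs_swap L)
    moreover have "(\<lambda>n. rep (map prod.swap (L n))) \<longlonglongrightarrow> star (compact_rep S)"
      unfolding rep_swap by (rule continuous_on_tendsto_compose[OF continuous_on_star[of UNIV] limS]) auto
    ultimately show ?thesis by (rule LIMSEQ_unique)
  qed
next
  fix c T assume T: "T \<in> compacts M"
  obtain K where K: "\<And>n. K n \<in> pairs M" "\<And>n. op_near M T (fin_op M (K n)) (1 / real (Suc n))"
    using compact_seq[OF T] by blast
  have limT: "(\<lambda>n. rep (K n)) \<longlonglongrightarrow> compact_rep T" using compact_rep_tendsto[where C = 1, OF T K(1)] K(2) by simp
  define N where "N n = map (\<lambda>(x, y). (c \<odot> x, y)) (K n)" for n
  have N: "N n \<in> pairs M" for n unfolding N_def by (intro pairs_map_fst K) simp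
  have "op_near M (op_scale M c T) (fin_op M (N n)) ((cmod c + 1) * (1 / real (Suc n)))" for n
  proof -
    have "op_near M (op_scale M c T) (op_scale M c (fin_op M (K n))) (cmod c * (1 / real (Suc n)))"
      by (intro op_near_scale K compacts_adjointables[OF T] fin_op_adjointable)
    moreover have "op_scale M c (fin_op M (K n)) = fin_op M (N n)"
      by (rule extensionalityI[where A = "carrier M"])
        (simp_all add: N_def op_scale_def fin_op_extensional fin_op_smult K)
    ultimately have "op_near M (op_scale M c T) (fin_op M (N n)) (cmod c * (1 / real (Suc n)))" by simp
    moreover have "cmod c * (1 / real (Suc n)) \<le> (cmod c + 1) * (1 / real (Suc n))" by (intro mult_right_mono) auto
    ultimately show ?thesis unfolding op_near_def by (meson mnorm_nonneg mult_right_mono order_trans)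
  qed
  then have "(\<lambda>n. rep (N n)) \<longlonglongrightarrow> compact_rep (op_scale M c T)"
    by (intro compact_rep_tendsto[where C = "cmod c + 1"] op_scale_compact T N) (auto simp: add_nonneg_pos)
  moreover have "(\<lambda>n. rep (N n)) \<longlonglongrightarrow> c *\<^sub>C compact_rep T"
  proof -
    have "(\<lambda>n. cmod c * norm (rep (K n) - compact_rep T)) \<longlonglongrightarrow> cmod c * 0"
      by (intro tendsto_mult_left tendsto_norm_zero LIM_zero limT)
    moreover have "rep (N n) - c *\<^sub>C compact_rep T = c *\<^sub>C (rep (K n) - compact_rep T)" for n
      by (simp add: N_def rep_smult K scaleC_diff_right)
    ultimately have "(\<lambda>n. norm (rep (N n) - c *\<^sub>C compact_rep T)) \<longlonglongrightarrow> 0" by (simp add: norm_scaleC)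
    then show ?thesis by (rule LIM_zero_cancel[OF tendsto_norm_zero_cancel])
  qed
  ultimately show "compact_rep (op_scale M c T) = c *\<^sub>C compact_rep T" by (rule LIMSEQ_unique)
next
  fix T and k :: real
  assume T: "T \<in> compacts M" and k: "k \<ge> 0" "\<forall>x\<in>carrier M. mnorm M (T x) \<le> k * mnorm M x"
  have "norm (compact_rep T) \<le> k + e" if e: "e > 0" for e
  proof -
    \<comment> \<open>A norm bound is read as closeness to the operator of the empty list, whose
      image is 0; \<open>e\<close> keeps the error positive when k = 0.\<close>
    have "op_near M T (fin_op M []) (k + e)"
      unfolding op_near_def
    proof
      fix x assume x: "x \<in> carrier M"
      have "mnorm M (T x \<ominus> fin_op M [] x) = mnorm M (T x)"
        using x adjointables_carrier[OF compacts_adjointables[OF T] x] by (simp add: minus_eq del: fin_op_Nil)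
      also have "\<dots> \<le> k * mnorm M x" using k x by simp
      also have "\<dots> \<le> (k + e) * mnorm M x" using e by (intro mult_right_mono) auto
      finally show "mnorm M (T x \<ominus> fin_op M [] x) \<le> (k + e) * mnorm M x" .
    qed
    then have "norm (compact_rep T - rep []) \<le> k + e" using k e by (intro compact_rep T) auto
    then show ?thesis by simp
  qed
  then show "norm (compact_rep T) \<le> k" by (rule field_le_epsilon)
qed

text \<open>Contractivity applied to S - T; this is the continuity on which uniqueness of the
  homomorphism rests.\<close>

lemma hom_near:
  assumes f: "compacts_hom M f" and ST: "S \<in> compacts M" "T \<in> compacts M" "op_near M S T k" "k \<ge> 0"
  shows "norm (f S - f T) \<le> k"
proof -
  have c: "op_scale M (-1) T \<in> compacts M" "op_add M S (op_scale M (-1) T) \<in> compacts M"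
    using ST by (auto intro: op_add_compact op_scale_compact)
  have "f (op_add M S (op_scale M (-1) T)) = f S - f T"
    using f ST c by (simp add: compacts_hom_def)
  moreover have "op_add M S (op_scale M (-1) T) x = S x \<ominus> T x" if "x \<in> carrier M" for x
    using that ST by (simp add: op_add_def op_scale_def minus_eq adjointables_carrier compacts_adjointables)
  then have "\<forall>x\<in>carrier M. mnorm M (op_add M S (op_scale M (-1) T) x) \<le> k * mnorm M x"
    using ST by (simp add: op_near_def)
  then have "norm (f (op_add M S (op_scale M (-1) T))) \<le> k"
    using f c ST(4) unfolding compacts_hom_def by blast
  ultimately show ?thesis by simp
qed

lemma hom_fin_op:
  assumes f: "compacts_hom M f" and r: "\<And>x y. x \<in> carrier M \<Longrightarrow> y \<in> carrier M \<Longrightarrow> f (rank_one M x y) = \<psi> x * star (\<psi> y)"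
  shows "L \<in> pairs M \<Longrightarrow> f (fin_op M L) = rep L"
proof (induction L)
  case Nil
  have "op_zero M \<in> compacts M" using fin_op_compact[of "[]"] by simp
  moreover have "\<forall>x\<in>carrier M. mnorm M (op_zero M x) \<le> 0 * mnorm M x" by (simp add: op_zero_def)
  ultimately have "norm (f (op_zero M)) \<le> 0" using f unfolding compacts_hom_def by blast
  then show ?case by simp
next
  case (Cons p L)
  obtain x y where p: "p = (x, y)" by (cases p)
  have xy: "x \<in> carrier M" "y \<in> carrier M" "L \<in> pairs M" using Cons by (auto simp: p)
  have "rank_one M x y = fin_op M [(x, y)]"
    using xy by (auto simp: rank_one_def fin_op_def fun_eq_iff)
  then have "rank_one M x y \<in> compacts M" using xy by (auto intro: fin_op_compact)
  then have "f (op_add M (rank_one M x y) (fin_op M L)) = f (rank_one M x y) + f (fin_op M L)"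
    using f fin_op_compact[OF xy(3)] unfolding compacts_hom_def by blast
  moreover have "fin_op M (p # L) = op_add M (rank_one M x y) (fin_op M L)"
    unfolding p using xy by (intro fin_op_Cons) simp
  ultimately show ?case using Cons xy by (simp add: p r)
qed

text \<open>Two homomorphisms with the prescribed values on rank-one operators agree on finite rank,
  and contractivity carries this to the closure. The restriction meets the extensionality asked for
  in the description.\<close>

lemma psi_compacts_compact_rep: "psi_compacts M \<psi> = restrict compact_rep (compacts M)"
  unfolding psi_compacts_def
proof (rule the_equality)
  have hom: "compacts_hom M (restrict compact_rep (compacts M))"
    using compact_rep_hom unfolding compacts_hom_def
    by (simp add: op_add_compact op_scale_compact op_comp_compact)
  have "compact_rep (rank_one M x y) = \<psi> x * star (\<psi> y)" "rank_one M x y \<in> compacts M"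
    if xy: "x \<in> carrier M" "y \<in> carrier M" for x y
  proof -
    have "rank_one M x y = fin_op M [(x, y)]"
      using xy by (auto simp: rank_one_def fin_op_def fun_eq_iff)
    then show "compact_rep (rank_one M x y) = \<psi> x * star (\<psi> y)" "rank_one M x y \<in> compacts M"
      using compact_rep_fin_op[of "[(x, y)]"] fin_op_compact[of "[(x, y)]"] xy by auto
  qed
  then show "restrict compact_rep (compacts M) \<in> extensional (compacts M) \<and> compacts_hom M (restrict compact_rep (compacts M)) \<and>
    (\<forall>x\<in>carrier M. \<forall>y\<in>carrier M. restrict compact_rep (compacts M) (rank_one M x y) = \<psi> x * star (\<psi> y))"
    using hom by simp
  fix f assume f: "f \<in> extensional (compacts M) \<and> compacts_hom M f \<and>
    (\<forall>x\<in>carrier M. \<forall>y\<in>carrier M. f (rank_one M x y) = \<psi> x * star (\<psi> y))"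
  have "f T = compact_rep T" if T: "T \<in> compacts M" for T
  proof -
    have "norm (f T - compact_rep T) \<le> 0 + e" if e: "e > 0" for e
    proof -
      obtain L where L: "L \<in> pairs M" "op_near M T (fin_op M L) (e/2)"
        using T e unfolding compacts_iff by (meson half_gt_zero)
      have "norm (f T - f (fin_op M L)) \<le> e/2" using f T L e by (intro hom_near fin_op_compact) auto
      moreover have "norm (compact_rep T - rep L) \<le> e/2" using T L e by (intro compact_rep) auto
      moreover have "f (fin_op M L) = rep L" using f L by (intro hom_fin_op) auto
      ultimately show ?thesis using norm_triangle_ineq4[of "f T - rep L" "compact_rep T - rep L"] by simp
    qed
    then have "norm (f T - compact_rep T) \<le> 0" by (rule field_le_epsilon)
    then show ?thesis by simp
  qed
  then show "f = restrict compact_rep (compacts M)" using f by (intro extensionalityI[of f "compacts M"]) auto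
qed

lemma psi_compacts_hom: "compacts_hom M (psi_compacts M \<psi>)"
  using compact_rep_hom unfolding psi_compacts_compact_rep compacts_hom_def
  by (simp add: op_add_compact op_scale_compact op_comp_compact)

lemma psi_compacts_fin_op: "L \<in> pairs M \<Longrightarrow> psi_compacts M \<psi> (fin_op M L) = rep L"
  by (simp add: psi_compacts_compact_rep fin_op_compact compact_rep_fin_op)

lemmas psi_compacts_near = hom_near[OF psi_compacts_hom]

end


section \<open>The internal tensor product\<close>

lemma formals_simps [simp]:
  "[] \<in> formals M N" "(x, y) # u \<in> formals M N \<longleftrightarrow> x \<in> carrier M \<and> y \<in> carrier N \<and> u \<in> formals M N"
  "u @ v \<in> formals M N \<longleftrightarrow> u \<in> formals M N \<and> v \<in> formals M N"
  by (simp_all add: formals_def)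

lemma formal_ip_Nil [simp]: "formal_ip M N [] v = 0" "formal_ip M N u [] = 0"
  by (simp_all add: formal_ip_def case_prod_unfold)

lemma formal_ip_append_left: "formal_ip M N (u @ v) w = formal_ip M N u w + formal_ip M N v w"
  by (simp add: formal_ip_def)

lemma formal_ip_append_right: "formal_ip M N w (u @ v) = formal_ip M N w u + formal_ip M N w v"
  by (induction w) (simp_all add: formal_ip_def case_prod_unfold)

lemma formal_ip_Cons_left: "formal_ip M N (p # u) w = formal_ip M N [p] w + formal_ip M N u w"
  using formal_ip_append_left[of M N "[p]" u w] by simp

lemma formal_ip_Cons_right: "formal_ip M N w (p # u) = formal_ip M N w [p] + formal_ip M N w u"
  using formal_ip_append_right[of M N w "[p]" u] by simp

lemma formal_ip_single: "formal_ip M N [(x, y)] [(x', y')] = ip N y (lact N (ip M x x') y')"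
  by (simp add: formal_ip_def)

lemma formals_map:
  assumes "u \<in> formals M N" "\<And>x y. x \<in> carrier M \<Longrightarrow> y \<in> carrier N \<Longrightarrow> h (x, y) \<in> carrier M' \<times> carrier N'"
  shows "map h u \<in> formals M' N'"
  using assms(1)
proof (induction u)
  case (Cons p u)
  obtain x y where p: "p = (x, y)" by (cases p)
  have "h p \<in> carrier M' \<times> carrier N'" using Cons.prems assms(2) by (simp add: p)
  then show ?case using Cons by (cases "h p") (simp add: p)
qed simp

text \<open>Both lists enter additively, so a relation on single tensors passes to sums. It serves
  for the scalar and the right action.\<close>

lemma formal_ip_map_right:
  assumes u: "u \<in> formals M N" and v: "v \<in> formals M N"
    and f: "\<And>a b. f (a + b) = f a + f b" "f 0 = 0"
    and h: "\<And>x y x' y'. x \<in> carrier M \<Longrightarrow> y \<in> carrier N \<Longrightarrow> x' \<in> carrier M \<Longrightarrow> y' \<in> carrier N \<Longrightarrow>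
      formal_ip M N [(x, y)] [h (x', y')] = f (formal_ip M N [(x, y)] [(x', y')])"
  shows "formal_ip M N u (map h v) = f (formal_ip M N u v)"
  using v
proof (induction v)
  case (Cons q v)
  obtain x' y' where q: "q = (x', y')" by (cases q)
  have "formal_ip M N u [h q] = f (formal_ip M N u [q])"
    using u
  proof (induction u)
    case (Cons p u)
    obtain x y where p: "p = (x, y)" by (cases p)
    have "formal_ip M N [p] [h q] = f (formal_ip M N [p] [q])"
      unfolding p q by (rule h) (use Cons.prems \<open>q # v \<in> formals M N\<close> in \<open>simp_all add: p q\<close>)
    moreover have "formal_ip M N u [h q] = f (formal_ip M N u [q])"
      using Cons.prems by (intro Cons.IH) (simp add: p)
    ultimately show ?case
      by (simp only: formal_ip_Cons_left[of M N p u] f)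
  qed (simp add: f)
  moreover have "formal_ip M N u (map h v) = f (formal_ip M N u v)"
    using Cons.prems by (intro Cons.IH) (simp add: q)
  ultimately show ?case
    by (simp only: formal_ip_Cons_right[of M N u q v] formal_ip_Cons_right[of M N u "h q" "map h v"] list.map f)
qed (simp add: f)

locale bimodule_pair = M: right_hilbert_bimodule M + N: right_hilbert_bimodule N
  for M :: "('a::cstar_algebra, 'x) bimodule" and N :: "('a, 'y) bimodule"
begin

lemma formal_ip_star:
  assumes "u \<in> formals M N" "v \<in> formals M N"
  shows "star (formal_ip M N u v) = formal_ip M N v u"
  using assms(1)
proof (induction u)
  case (Cons p u)
  obtain x y where p: "p = (x, y)" by (cases p)
  have "star (formal_ip M N [p] v) = formal_ip M N v [p]"
    using assms(2)
  proof (induction v)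
    case (Cons q v)
    obtain x' y' where q: "q = (x', y')" by (cases q)
    have c: "x \<in> carrier M" "y \<in> carrier N" "x' \<in> carrier M" "y' \<in> carrier N"
      using Cons.prems \<open>p # u \<in> formals M N\<close> by (simp_all add: p q)
    have "star (formal_ip M N [p] [q]) = formal_ip M N [q] [p]"
      unfolding p q formal_ip_single using c by (simp add: N.ip_star N.lact_adjoint M.ip_star)
    then show ?case
      using Cons by (simp add: q formal_ip_Cons_left[of _ _ _ v] formal_ip_Cons_right[of _ _ _ _ v] star_add)
  qed simp
  then show ?case
    using Cons by (simp add: p formal_ip_Cons_left[of _ _ _ u] formal_ip_Cons_right[of _ _ _ _ u] star_add)
qed simp

definition formal_ract :: "('x, 'y) formal \<Rightarrow> 'a \<Rightarrow> ('x, 'y) formal" where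
  "formal_ract u a = map (\<lambda>(x, y). (x, ract N y a)) u"

lemma formal_smult_closed [simp]: "u \<in> formals M N \<Longrightarrow> formal_smult M c u \<in> formals M N"
  unfolding formal_smult_def by (rule formals_map[of u M N]) simp_all

lemma formal_ract_closed [simp]: "u \<in> formals M N \<Longrightarrow> formal_ract u a \<in> formals M N"
  unfolding formal_ract_def by (rule formals_map[of u M N]) simp_all

lemma formal_ip_smult_right:
  "u \<in> formals M N \<Longrightarrow> v \<in> formals M N \<Longrightarrow> formal_ip M N u (formal_smult M c v) = c *\<^sub>C formal_ip M N u v"
  unfolding formal_smult_def
  by (rule formal_ip_map_right) (simp_all add: scaleC_add_right formal_ip_single M.ip_smult N.lact_scaleC N.ip_smult)

lemma formal_ip_ract_right:
  "u \<in> formals M N \<Longrightarrow> v \<in> formals M N \<Longrightarrow> formal_ip M N u (formal_ract v a) = formal_ip M N u v * a"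
  unfolding formal_ract_def
  by (rule formal_ip_map_right) (simp_all add: distrib_right formal_ip_single N.lact_ract N.ip_ract)

lemma formal_ip_smult_left:
  assumes "u \<in> formals M N" "v \<in> formals M N"
  shows "formal_ip M N (formal_smult M c u) v = cnj c *\<^sub>C formal_ip M N u v"
  using arg_cong[OF formal_ip_smult_right[OF assms(2,1), of c], of star] assms
  by (simp add: star_scaleC formal_ip_star)

lemma formal_ip_ract_left:
  assumes "u \<in> formals M N" "v \<in> formals M N"
  shows "formal_ip M N (formal_ract u a) v = star a * formal_ip M N u v"
  using arg_cong[OF formal_ip_ract_right[OF assms(2,1), of a], of star] assms
  by (simp add: star_mult formal_ip_star)

text \<open>In the tensor product x \<otimes> y = (x - x1 c) \<otimes> y + x1 \<otimes> c y, with
  \<open>c\<close> depending on \<open>x\<close>. Equality of the two formal sums is expressed by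
  their pairings with every \<open>w\<close>.\<close>

lemma formal_ip_insert_right:
  assumes "w \<in> formals M N" "u \<in> formals M N" "x\<^sub>1 \<in> carrier M" "y\<^sub>1 \<in> carrier N"
  shows "formal_ip M N w ((x\<^sub>1, y\<^sub>1 \<oplus>\<^bsub>N\<^esub> lsum N (map (\<lambda>(x, y). lact N (c x) y) u)) # map (\<lambda>(x, y). (x \<ominus>\<^bsub>M\<^esub> ract M x\<^sub>1 (c x), y)) u)
    = formal_ip M N w ((x\<^sub>1, y\<^sub>1) # u)"
  using assms(1)
proof (induction w)
  case (Cons p w)
  obtain x y where p: "p = (x, y)" by (cases p)
  have xy: "x \<in> carrier M" "y \<in> carrier N" using Cons.prems by (simp_all add: p)
  have main: "ip N y (lact N (ip M x x\<^sub>1) (lsum N (map (\<lambda>(x, y). lact N (c x) y) u)))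
      + formal_ip M N [p] (map (\<lambda>(x, y). (x \<ominus>\<^bsub>M\<^esub> ract M x\<^sub>1 (c x), y)) u) = formal_ip M N [p] u
    \<and> lsum N (map (\<lambda>(x, y). lact N (c x) y) u) \<in> carrier N"
    using assms(2)
  proof (induction u)
    case (Cons q u)
    obtain x' y' where q: "q = (x', y')" by (cases q)
    have c: "x' \<in> carrier M" "y' \<in> carrier N" "u \<in> formals M N" using Cons.prems by (simp_all add: q)
    note IH = Cons.IH[OF c(3)]
    have sub: "lact N (ip M x x') y' = lact N (ip M x x' - b) y' \<oplus>\<^bsub>N\<^esub> lact N b y'" for b
      using c by (simp flip: N.lact_add)
    have "ip N y (lact N (ip M x x\<^sub>1) (lact N (c x') y')) + formal_ip M N [p] [(x' \<ominus>\<^bsub>M\<^esub> ract M x\<^sub>1 (c x'), y')]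
        = formal_ip M N [p] [q]"
      unfolding p q formal_ip_single sub[of "ip M x x\<^sub>1 * c x'"] using xy c assms(3)
      by (simp add: M.ip_diff M.ip_ract N.ip_add N.lact_mult)
    moreover have "lact N (c x') y' \<in> carrier N" using c by simp
    ultimately show ?case
      using IH xy c
      by (simp add: q formal_ip_Cons_right[of _ _ _ _ u] formal_ip_Cons_right[of _ _ _ _ "map _ u"] N.lact_add_right N.ip_add
          add.assoc add.left_commute)
  qed (use xy in simp)
  have "formal_ip M N [p] [(x\<^sub>1, y\<^sub>1 \<oplus>\<^bsub>N\<^esub> lsum N (map (\<lambda>(x, y). lact N (c x) y) u))] = formal_ip M N [p] [(x\<^sub>1, y\<^sub>1)] + ip N y (lact N (ip M x x\<^sub>1) (lsum N (map (\<lambda>(x, y). lact N (c x) y) u)))"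
    unfolding p formal_ip_single using main xy assms(4) by (simp add: N.lact_add_right N.ip_add)
  then have "formal_ip M N [p] ((x\<^sub>1, y\<^sub>1 \<oplus>\<^bsub>N\<^esub> lsum N (map (\<lambda>(x, y). lact N (c x) y) u)) # map (\<lambda>(x, y). (x \<ominus>\<^bsub>M\<^esub> ract M x\<^sub>1 (c x), y)) u)
    = formal_ip M N [p] ((x\<^sub>1, y\<^sub>1) # u)"
    using main
    by (simp only: formal_ip_Cons_right[of M N "[p]" _ u] formal_ip_Cons_right[of M N "[p]" _ "map _ u"]
        add.assoc)
  then show ?case
    using Cons by (simp only: formal_ip_Cons_left[of M N p w]) (simp add: p)
qed simp

text \<open>
  Gram-Schmidt: with \<open>g = \<langle>x\<^sub>1, x\<^sub>1\<rangle>\<close> and \<open>c x = (g + \<epsilon>)\<^sup>-\<^sup>1 \<langle>x\<^sub>1, x\<rangle>\<close>, replacing \<open>x\<close> by \<open>x - x\<^sub>1 c x\<close> and moving the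
  difference into the first tensor makes \<open>x\<^sub>1\<close> almost orthogonal to the rest. The vector \<open>Y\<close> below
  need not stay bounded as \<open>\<epsilon>\<close> tends to \<open>0\<close>, but it enters only through \<open>\<epsilon> \<langle>y\<^sub>1, Y\<rangle>\<close>, where \<open>\<epsilon> Y\<close> is
  small, and through the positive term \<open>2 \<epsilon> \<langle>Y, Y\<rangle>\<close>.
\<close>

lemma formal_ip_cpos: "u \<in> formals M N \<Longrightarrow> cpos (formal_ip M N u u)"
proof (induction "length u" arbitrary: u)
  case 0
  then show ?case by simp
next
  case (Suc n)
  then obtain x\<^sub>1 y\<^sub>1 u' where u: "u = (x\<^sub>1, y\<^sub>1) # u'" by (cases u) auto
  have c: "x\<^sub>1 \<in> carrier M" "y\<^sub>1 \<in> carrier N" "u' \<in> formals M N" and n: "length u' = n" using Suc u by auto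
  show ?case
  proof (rule cpos_limit)
    show "star (formal_ip M N u u) = formal_ip M N u u" using Suc.prems by (rule formal_ip_star[OF _ Suc.prems])
    fix \<delta> :: real assume \<delta>: "\<delta> > 0"
    define C where "C = (\<Sum>(x, y)\<leftarrow>u'. mnorm M x * mnorm N y)"
    \<comment> \<open>Chosen so that the error terms \<epsilon> \<langle>y1, Y\<rangle> and
      \<epsilon> \<langle>Y, y1\<rangle>, each of norm at most s C times the norm of y1, add up to
      at most \<delta>.\<close>
    define s where "s = \<delta> / (2 * (mnorm N y\<^sub>1 * C) + 1)"
    have C0: "C \<ge> 0" unfolding C_def by (rule sum_list_nonneg) auto
    then have K0: "mnorm N y\<^sub>1 * C \<ge> 0" by simp
    have s: "s > 0" "2 * (mnorm N y\<^sub>1 * (s * C)) \<le> \<delta>" using \<delta> K0 by (simp_all add: s_def field_simps)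
    \<comment> \<open>The bound 2 \<epsilon> of \<open>resolvent\<close> then gives x1 - x1 r norm
      at most \<open>s\<close>.\<close>
    define \<epsilon> where "\<epsilon> = s\<^sup>2 / 2"
    have \<epsilon>: "\<epsilon> > 0" using s by (simp add: \<epsilon>_def)
    define g where "g = ip M x\<^sub>1 x\<^sub>1"
    obtain r T where T: "\<And>b. g * T b + \<epsilon> *\<^sub>R T b = b" and r: "\<And>b. b - star r * b = \<epsilon> *\<^sub>R T b"
      and small: "norm (g - g * r - star r * g + star r * g * r) \<le> 2 * \<epsilon>"
      using resolvent[OF M.ip_cpos[OF c(1)] \<epsilon>] unfolding g_def by blast
    have "(mnorm M (x\<^sub>1 \<ominus>\<^bsub>M\<^esub> ract M x\<^sub>1 r))\<^sup>2 = norm (g - g * r - star r * g + star r * g * r)"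
      using c by (simp add: mnorm_sq M.ip_simps algebra_simps g_def)
    also have "\<dots> \<le> s\<^sup>2" using small by (simp add: \<epsilon>_def)
    finally have xs: "mnorm M (x\<^sub>1 \<ominus>\<^bsub>M\<^esub> ract M x\<^sub>1 r) \<le> s" by (rule power2_le_imp_le) (use s in simp)
    \<comment> \<open>\<open>T\<close> itself is not bounded as \<epsilon> shrinks, but \<epsilon> T
      \<langle>x1, x\<rangle> is the pairing of the short vector x1 - x1 r with
      \<open>x\<close>.\<close>
    have Tsmall: "norm (\<epsilon> *\<^sub>R T (ip M x\<^sub>1 x)) \<le> s * mnorm M x" if x: "x \<in> carrier M" for x
    proof -
      have "\<epsilon> *\<^sub>R T (ip M x\<^sub>1 x) = ip M (x\<^sub>1 \<ominus>\<^bsub>M\<^esub> ract M x\<^sub>1 r) x"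
        using x c by (simp add: M.ip_simps flip: r)
      then have "norm (\<epsilon> *\<^sub>R T (ip M x\<^sub>1 x)) \<le> mnorm M (x\<^sub>1 \<ominus>\<^bsub>M\<^esub> ract M x\<^sub>1 r) * mnorm M x"
        using x c M.norm_ip[of "x\<^sub>1 \<ominus>\<^bsub>M\<^esub> ract M x\<^sub>1 r" x] by simp
      also have "\<dots> \<le> s * mnorm M x" using xs by (intro mult_right_mono) auto
      finally show ?thesis .
    qed
    define a where "a x = T (ip M x\<^sub>1 x)" for x
    define Y where "Y = lsum N (map (\<lambda>(x, y). lact N (a x) y) u')"
    have "Y \<in> carrier N \<and> mnorm N (complex_of_real \<epsilon> \<odot>\<^bsub>N\<^esub> Y) \<le> s * C"
      unfolding Y_def C_def using c(3)
    proof (induction u')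
      case (Cons p u')
      obtain x y where p: "p = (x, y)" by (cases p)
      have xy: "x \<in> carrier M" "y \<in> carrier N" "u' \<in> formals M N" using Cons.prems by (simp_all add: p)
      let ?Y = "lsum N (map (\<lambda>(x, y). lact N (a x) y) u')"
      have Y: "?Y \<in> carrier N" "mnorm N (complex_of_real \<epsilon> \<odot>\<^bsub>N\<^esub> ?Y) \<le> s * (\<Sum>(x, y)\<leftarrow>u'. mnorm M x * mnorm N y)"
        using Cons.IH[OF xy(3)] by auto
      have "complex_of_real \<epsilon> \<odot>\<^bsub>N\<^esub> (lact N (a x) y \<oplus>\<^bsub>N\<^esub> ?Y)
          = lact N (\<epsilon> *\<^sub>R a x) y \<oplus>\<^bsub>N\<^esub> complex_of_real \<epsilon> \<odot>\<^bsub>N\<^esub> ?Y"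
        using xy Y by (simp add: N.smult_add_right flip: N.lact_scaleC scaleC_of_real)
      then have "mnorm N (complex_of_real \<epsilon> \<odot>\<^bsub>N\<^esub> (lact N (a x) y \<oplus>\<^bsub>N\<^esub> ?Y))
          \<le> mnorm N (lact N (\<epsilon> *\<^sub>R a x) y) + mnorm N (complex_of_real \<epsilon> \<odot>\<^bsub>N\<^esub> ?Y)"
        using xy Y by (simp add: N.mnorm_triangle)
      also have "\<dots> \<le> (s * mnorm M x) * mnorm N y + s * (\<Sum>(x, y)\<leftarrow>u'. mnorm M x * mnorm N y)"
        using xy Tsmall[OF xy(1)]
        by (intro add_mono Y order_trans[OF N.mnorm_lact] mult_right_mono) (simp_all add: a_def)
      finally show ?case using xy Y by (simp add: p algebra_simps)
    qed simp
    then have Y: "Y \<in> carrier N" "mnorm N (complex_of_real \<epsilon> \<odot>\<^bsub>N\<^esub> Y) \<le> s * C" by auto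
    define Y\<^sub>1 where "Y\<^sub>1 = y\<^sub>1 \<oplus>\<^bsub>N\<^esub> Y"
    define v where "v = map (\<lambda>(x, y). (x \<ominus>\<^bsub>M\<^esub> ract M x\<^sub>1 (a x), y)) u'"
    have Y1: "Y\<^sub>1 \<in> carrier N" using Y c by (simp add: Y\<^sub>1_def)
    have v: "v \<in> formals M N" unfolding v_def using c by (intro formals_map[OF c(3)]) simp
    have ins: "formal_ip M N w ((x\<^sub>1, Y\<^sub>1) # v) = formal_ip M N w u" if "w \<in> formals M N" for w
      unfolding Y\<^sub>1_def Y_def v_def u using formal_ip_insert_right[OF that c(3) c(1,2)] .
    have V: "(x\<^sub>1, Y\<^sub>1) # v \<in> formals M N" using v Y1 c by simp
    \<comment> \<open>The replacement is made in the right argument and then, by symmetry of the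
      form, in the left one.\<close>
    have "formal_ip M N u u = formal_ip M N u ((x\<^sub>1, Y\<^sub>1) # v)" by (rule ins[OF Suc.prems, symmetric])
    also have "\<dots> = star (formal_ip M N ((x\<^sub>1, Y\<^sub>1) # v) u)" by (rule formal_ip_star[OF V Suc.prems, symmetric])
    also have "\<dots> = star (formal_ip M N ((x\<^sub>1, Y\<^sub>1) # v) ((x\<^sub>1, Y\<^sub>1) # v))" by (simp only: ins[OF V])
    also have "\<dots> = formal_ip M N ((x\<^sub>1, Y\<^sub>1) # v) ((x\<^sub>1, Y\<^sub>1) # v)" by (rule formal_ip_star[OF V V])
    finally have e1: "formal_ip M N u u = formal_ip M N [(x\<^sub>1, Y\<^sub>1)] [(x\<^sub>1, Y\<^sub>1)] + formal_ip M N [(x\<^sub>1, Y\<^sub>1)] v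
        + (formal_ip M N v [(x\<^sub>1, Y\<^sub>1)] + formal_ip M N v v)"
      by (simp only: formal_ip_Cons_left[of M N _ v] formal_ip_Cons_right[of M N _ _ v] add_ac)
    have "formal_ip M N [(x\<^sub>1, Y\<^sub>1)] v = \<epsilon> *\<^sub>R ip N Y\<^sub>1 Y"
    proof -
      have "formal_ip M N [(x\<^sub>1, Y\<^sub>1)] v = \<epsilon> *\<^sub>R ip N Y\<^sub>1 Y \<and> Y \<in> carrier N"
        unfolding v_def Y_def using c(3)
      proof (induction u')
        case (Cons p u')
        obtain x y where p: "p = (x, y)" by (cases p)
        have xy: "x \<in> carrier M" "y \<in> carrier N" "u' \<in> formals M N" using Cons.prems by (simp_all add: p)
        have "ip M x\<^sub>1 (x \<ominus>\<^bsub>M\<^esub> ract M x\<^sub>1 (a x)) = complex_of_real \<epsilon> *\<^sub>C a x"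
          using xy c T[of "ip M x\<^sub>1 x"] by (simp add: M.ip_simps a_def scaleC_of_real flip: g_def) (metis add_diff_cancel_left')
        then have "formal_ip M N [(x\<^sub>1, Y\<^sub>1)] [(x \<ominus>\<^bsub>M\<^esub> ract M x\<^sub>1 (a x), y)]
            = complex_of_real \<epsilon> *\<^sub>C ip N Y\<^sub>1 (lact N (a x) y)"
          unfolding formal_ip_single using xy Y1 by (simp only: N.lact_scaleC N.ip_smult N.lact_closed)
        then have "formal_ip M N [(x\<^sub>1, Y\<^sub>1)] [(x \<ominus>\<^bsub>M\<^esub> ract M x\<^sub>1 (a x), y)] = \<epsilon> *\<^sub>R ip N Y\<^sub>1 (lact N (a x) y)"
          by (simp only: scaleC_of_real)
        then show ?case
          using Cons.IH[OF xy(3)] xy Y1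
          by (simp add: p formal_ip_Cons_right[of _ _ _ _ "map _ u'"] N.ip_add scaleR_add_right)
      qed (use Y1 in simp)
      then show ?thesis by simp
    qed
    note f1 = this
    have f2: "formal_ip M N v [(x\<^sub>1, Y\<^sub>1)] = \<epsilon> *\<^sub>R ip N Y Y\<^sub>1"
    proof -
      have "formal_ip M N v [(x\<^sub>1, Y\<^sub>1)] = star (formal_ip M N [(x\<^sub>1, Y\<^sub>1)] v)"
        by (rule formal_ip_star[symmetric]) (use v Y1 c in simp_all)
      then show ?thesis using Y1 Y by (simp only: f1 star_scaleR N.ip_star)
    qed
    have Y1Y: "ip N Y\<^sub>1 Y = ip N y\<^sub>1 Y + ip N Y Y" "ip N Y Y\<^sub>1 = ip N Y y\<^sub>1 + ip N Y Y"
      using Y c by (simp_all add: Y\<^sub>1_def N.ip_add N.ip_add_left)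
    have e2: "formal_ip M N u u = ip N Y\<^sub>1 (lact N g Y\<^sub>1) + formal_ip M N v v + (2 * \<epsilon>) *\<^sub>R ip N Y Y
        + \<epsilon> *\<^sub>R (ip N y\<^sub>1 Y + ip N Y y\<^sub>1)"
      by (simp only: e1 f1 f2 formal_ip_single g_def[symmetric] Y1Y scaleR_add_right mult_2 scaleR_add_left add_ac)
    \<comment> \<open>Writing g = b* b turns the first term into the inner square of b Y1.\<close>
    obtain b where b: "g = star b * b" using M.ip_positive[OF c(1)] by (auto simp: g_def cstar_positive_def)
    have "ip N Y\<^sub>1 (lact N g Y\<^sub>1) = ip N (lact N b Y\<^sub>1) (lact N b Y\<^sub>1)"
      using Y1 by (simp add: b N.lact_mult N.lact_adjoint)
    then have "cpos (ip N Y\<^sub>1 (lact N g Y\<^sub>1))" using Y1 by (simp add: N.ip_cpos)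
    moreover have "n = length v" by (simp add: v_def n)
    then have "cpos (formal_ip M N v v)" using v by (rule Suc.hyps(1))
    moreover have "cpos ((2 * \<epsilon>) *\<^sub>R ip N Y Y)" using Y \<epsilon> by (simp add: cpos_scaleR N.ip_cpos)
    ultimately have "cpos (ip N Y\<^sub>1 (lact N g Y\<^sub>1) + formal_ip M N v v + (2 * \<epsilon>) *\<^sub>R ip N Y Y)"
      by (simp only: cpos_add)
    moreover have "norm (\<epsilon> *\<^sub>R (ip N y\<^sub>1 Y + ip N Y y\<^sub>1)) \<le> \<delta>"
    proof -
      have i: "\<epsilon> *\<^sub>R ip N y\<^sub>1 Y = ip N y\<^sub>1 (complex_of_real \<epsilon> \<odot>\<^bsub>N\<^esub> Y)" "\<epsilon> *\<^sub>R ip N Y y\<^sub>1 = ip N (complex_of_real \<epsilon> \<odot>\<^bsub>N\<^esub> Y) y\<^sub>1"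
        using c Y by (simp_all add: N.ip_smult N.ip_smult_left scaleC_of_real)
      have "norm (\<epsilon> *\<^sub>R (ip N y\<^sub>1 Y + ip N Y y\<^sub>1)) \<le> norm (\<epsilon> *\<^sub>R ip N y\<^sub>1 Y) + norm (\<epsilon> *\<^sub>R ip N Y y\<^sub>1)"
        by (simp only: scaleR_add_right norm_triangle_ineq)
      also have "\<dots> \<le> mnorm N y\<^sub>1 * (s * C) + (s * C) * mnorm N y\<^sub>1"
        unfolding i using c Y
        by (intro add_mono order_trans[OF N.norm_ip] mult_left_mono mult_right_mono) simp_all
      also have "\<dots> \<le> \<delta>" using s(2) by (simp add: algebra_simps)
      finally show ?thesis .
    qed
    moreover have "ip N Y\<^sub>1 (lact N g Y\<^sub>1) + formal_ip M N v v + (2 * \<epsilon>) *\<^sub>R ip N Y Y - formal_ip M N u u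
        = - (\<epsilon> *\<^sub>R (ip N y\<^sub>1 Y + ip N Y y\<^sub>1))"
      unfolding e2 by simp
    ultimately show "\<exists>y. norm (y - formal_ip M N u u) \<le> \<delta> \<and> cpos y" by (metis norm_minus_cancel)
  qed
qed

definition fnorm :: "('x, 'y) formal \<Rightarrow> real" where
  "fnorm u = sqrt (norm (formal_ip M N u u))"

lemma fnorm_nonneg [simp]: "0 \<le> fnorm u"
  by (simp add: fnorm_def)

lemma fnorm_sq: "(fnorm u)\<^sup>2 = norm (formal_ip M N u u)"
  by (simp add: fnorm_def)

lemma norm_formal_ip:
  assumes u: "u \<in> formals M N" and v: "v \<in> formals M N"
  shows "norm (formal_ip M N u v) \<le> fnorm u * fnorm v"
proof -
  have "(norm (formal_ip M N u v))\<^sup>2 \<le> norm (formal_ip M N u u) * norm (formal_ip M N v v)"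
  proof (rule cauchy_schwarz_cpos[OF formal_ip_cpos[OF u]])
    fix n :: real
    define a z where "a = formal_ip M N u v" and "z = formal_ract u a @ formal_smult M (complex_of_real (- n)) v"
    have vu: "formal_ip M N v u = star a" by (simp add: a_def formal_ip_star u v)
    have "cpos (formal_ip M N z z)" by (rule formal_ip_cpos) (simp add: z_def u v)
    moreover have "formal_ip M N z z = star a * formal_ip M N u u * a - (2 * n) *\<^sub>R (star a * a) + (n * n) *\<^sub>R formal_ip M N v v"
      unfolding z_def
      by (simp add: formal_ip_append_left formal_ip_append_right formal_ip_ract_left formal_ip_ract_right
          formal_ip_smult_left formal_ip_smult_right u v vu a_def[symmetric] scaleC_of_real algebra_simps
          flip: of_real_minus scaleR_add_left)
    ultimately show "cpos (star (formal_ip M N u v) * formal_ip M N u u * formal_ip M N u v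
        - (2 * n) *\<^sub>R (star (formal_ip M N u v) * formal_ip M N u v) + (n * n) *\<^sub>R formal_ip M N v v)"
      by (simp add: a_def)
  qed
  then have "(norm (formal_ip M N u v))\<^sup>2 \<le> (fnorm u * fnorm v)\<^sup>2" by (simp add: power_mult_distrib fnorm_sq)
  then show ?thesis by (rule power2_le_imp_le) simp
qed

lemma fnorm_append: assumes u: "u \<in> formals M N" and v: "v \<in> formals M N" shows "fnorm (u @ v) \<le> fnorm u + fnorm v"
proof (rule power2_le_imp_le)
  have "(fnorm (u @ v))\<^sup>2 = norm ((formal_ip M N u u + formal_ip M N v v) + (formal_ip M N u v + formal_ip M N v u))"
    by (simp add: fnorm_sq formal_ip_append_left formal_ip_append_right algebra_simps)
  also have "\<dots> \<le> (norm (formal_ip M N u u) + norm (formal_ip M N v v)) + (norm (formal_ip M N u v) + norm (formal_ip M N v u))"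
    by (rule norm_triangle_le[OF add_mono[OF norm_triangle_ineq norm_triangle_ineq]])
  also have "\<dots> \<le> (fnorm u + fnorm v)\<^sup>2"
    using norm_formal_ip[OF u v] norm_formal_ip[OF v u] by (simp add: power2_sum algebra_simps flip: fnorm_sq)
  finally show "(fnorm (u @ v))\<^sup>2 \<le> (fnorm u + fnorm v)\<^sup>2" .
qed simp

abbreviation fminus :: "('x, 'y) formal \<Rightarrow> ('x, 'y) formal \<Rightarrow> ('x, 'y) formal" where
  "fminus u v \<equiv> u @ formal_smult M (-1) v"

lemma formal_dist_fnorm: "formal_dist M N u v = fnorm (fminus u v)"
  by (simp add: formal_dist_def fnorm_def Let_def)

lemma formal_ip_fminus:
  "u \<in> formals M N \<Longrightarrow> v \<in> formals M N \<Longrightarrow> w \<in> formals M N \<Longrightarrow>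
    formal_ip M N w (fminus u v) = formal_ip M N w u - formal_ip M N w v"
  "u \<in> formals M N \<Longrightarrow> v \<in> formals M N \<Longrightarrow> w \<in> formals M N \<Longrightarrow>
    formal_ip M N (fminus u v) w = formal_ip M N u w - formal_ip M N v w"
  by (simp_all add: formal_ip_append_left formal_ip_append_right formal_ip_smult_right formal_ip_smult_left)

lemma formal_dist_triangle:
  assumes "u \<in> formals M N" "v \<in> formals M N" "w \<in> formals M N"
  shows "formal_dist M N u w \<le> formal_dist M N u v + formal_dist M N v w"
proof -
  have "fnorm (fminus u w) = fnorm (fminus u v @ fminus v w)"
    unfolding fnorm_def using assms
    by (simp add: formal_ip_append_left formal_ip_append_right formal_ip_smult_right formal_ip_smult_left)
  then show ?thesis using assms fnorm_append[of "fminus u v" "fminus v w"] by (simp add: formal_dist_fnorm)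
qed

lemma formal_dist_commute:
  "u \<in> formals M N \<Longrightarrow> v \<in> formals M N \<Longrightarrow> formal_dist M N u v = formal_dist M N v u"
  by (simp add: formal_dist_fnorm fnorm_def formal_ip_append_left formal_ip_append_right formal_ip_smult_right
      formal_ip_smult_left algebra_simps)

lemma formal_dist_self: "u \<in> formals M N \<Longrightarrow> formal_dist M N u u = 0"
  by (simp add: formal_dist_fnorm fnorm_def formal_ip_append_left formal_ip_append_right formal_ip_smult_right
      formal_ip_smult_left)

lemma formal_dist_nonneg [simp]: "0 \<le> formal_dist M N u v"
  by (simp add: formal_dist_fnorm)

lemma formal_dist_append:
  assumes "u \<in> formals M N" "v \<in> formals M N" "u' \<in> formals M N" "v' \<in> formals M N"
  shows "formal_dist M N (u @ v) (u' @ v') \<le> formal_dist M N u u' + formal_dist M N v v'"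
proof -
  have "fnorm (fminus (u @ v) (u' @ v')) = fnorm (fminus u u' @ fminus v v')"
    unfolding fnorm_def using assms
    by (simp add: formal_ip_append_left formal_ip_append_right formal_ip_smult_right formal_ip_smult_left algebra_simps)
  then show ?thesis using assms fnorm_append[of "fminus u u'" "fminus v v'"] by (simp add: formal_dist_fnorm)
qed

lemma norm_formal_ip_diff:
  assumes "u \<in> formals M N" "v \<in> formals M N" "u' \<in> formals M N" "v' \<in> formals M N"
  shows "norm (formal_ip M N u v - formal_ip M N u' v') \<le> formal_dist M N u u' * fnorm v + fnorm u' * formal_dist M N v v'"
proof -
  have "formal_ip M N u v - formal_ip M N u' v' = formal_ip M N (fminus u u') v + formal_ip M N u' (fminus v v')"
    using assms by (simp add: formal_ip_fminus)
  then have "norm (formal_ip M N u v - formal_ip M N u' v')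
      \<le> norm (formal_ip M N (fminus u u') v) + norm (formal_ip M N u' (fminus v v'))"
    by (simp only: norm_triangle_ineq)
  also have "\<dots> \<le> fnorm (fminus u u') * fnorm v + fnorm u' * fnorm (fminus v v')"
    using assms by (intro add_mono norm_formal_ip) simp_all
  finally show ?thesis by (simp only: formal_dist_fnorm)
qed

section \<open>The completion of the formal sums\<close>

lemma tensor_cauchy_const: "u \<in> formals M N \<Longrightarrow> (\<lambda>n. u) \<in> tensor_cauchy M N"
  by (simp add: tensor_cauchy_def formal_dist_self)

lemma tensor_cauchy_formals: "s \<in> tensor_cauchy M N \<Longrightarrow> s n \<in> formals M N"
  by (simp add: tensor_cauchy_def)

lemma tensor_cauchyE:
  assumes "s \<in> tensor_cauchy M N" "\<epsilon> > 0"
  obtains k where "\<And>m n. m \<ge> k \<Longrightarrow> n \<ge> k \<Longrightarrow> formal_dist M N (s m) (s n) < \<epsilon>"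
proof -
  have "\<forall>\<epsilon>>0. \<exists>k. \<forall>m\<ge>k. \<forall>n\<ge>k. formal_dist M N (s m) (s n) < \<epsilon>"
    using assms(1) by (simp add: tensor_cauchy_def)
  from this[rule_format, OF assms(2)] show thesis using that by blast
qed

lemma tensor_cauchy_append:
  assumes s: "s \<in> tensor_cauchy M N" and t: "t \<in> tensor_cauchy M N"
  shows "(\<lambda>n. s n @ t n) \<in> tensor_cauchy M N"
  unfolding tensor_cauchy_def
proof (intro CollectI conjI allI impI)
  show "s n @ t n \<in> formals M N" for n using s t by (simp add: tensor_cauchy_formals)
  fix \<epsilon> :: real assume "\<epsilon> > 0"
  then have "\<epsilon> / 2 > 0" by simp
  note \<epsilon>2 = this
  obtain k where k: "\<And>m n. m \<ge> k \<Longrightarrow> n \<ge> k \<Longrightarrow> formal_dist M N (s m) (s n) < \<epsilon> / 2"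
    using tensor_cauchyE[OF s \<epsilon>2] by metis
  obtain l where l: "\<And>m n. m \<ge> l \<Longrightarrow> n \<ge> l \<Longrightarrow> formal_dist M N (t m) (t n) < \<epsilon> / 2"
    using tensor_cauchyE[OF t \<epsilon>2] by metis
  have "formal_dist M N (s m @ t m) (s n @ t n) < \<epsilon>" if "m \<ge> max k l" "n \<ge> max k l" for m n
    using k[of m n] l[of m n] that
      formal_dist_append[OF tensor_cauchy_formals[OF s] tensor_cauchy_formals[OF t] tensor_cauchy_formals[OF s] tensor_cauchy_formals[OF t], of m m n n]
    by simp
  then show "\<exists>k. \<forall>m\<ge>k. \<forall>n\<ge>k. formal_dist M N (s m @ t m) (s n @ t n) < \<epsilon>" by blast
qed

lemma tensor_rel_equiv: "equiv (tensor_cauchy M N) (tensor_rel M N)"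
proof (rule equivI)
  show "tensor_rel M N \<subseteq> tensor_cauchy M N \<times> tensor_cauchy M N" by (auto simp: tensor_rel_def)
  show "refl_on (tensor_cauchy M N) (tensor_rel M N)"
    by (rule refl_onI) (simp add: tensor_rel_def formal_dist_self tensor_cauchy_formals)
  show "sym (tensor_rel M N)"
  proof (rule symI)
    fix s t assume "(s, t) \<in> tensor_rel M N"
    then show "(t, s) \<in> tensor_rel M N"
      by (auto simp: tensor_rel_def formal_dist_commute[OF tensor_cauchy_formals tensor_cauchy_formals, of t s])
  qed
  show "trans (tensor_rel M N)"
  proof (rule transI)
    fix r s t assume rs: "(r, s) \<in> tensor_rel M N" and st: "(s, t) \<in> tensor_rel M N"
    have c: "r \<in> tensor_cauchy M N" "s \<in> tensor_cauchy M N" "t \<in> tensor_cauchy M N"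
      using rs st by (auto simp: tensor_rel_def)
    have "(\<lambda>n. formal_dist M N (r n) (s n) + formal_dist M N (s n) (t n)) \<longlonglongrightarrow> 0 + 0"
      using rs st by (intro tendsto_add) (auto simp: tensor_rel_def)
    then have lim: "(\<lambda>n. formal_dist M N (r n) (s n) + formal_dist M N (s n) (t n)) \<longlonglongrightarrow> 0" by simp
    have "(\<lambda>n. formal_dist M N (r n) (t n)) \<longlonglongrightarrow> 0"
      by (rule Lim_null_comparison[OF always_eventually[OF allI] lim])
        (simp add: formal_dist_triangle c[THEN tensor_cauchy_formals])
    then show "(r, t) \<in> tensor_rel M N" using c by (simp add: tensor_rel_def)
  qed
qed

lemma fnorm_bounded:
  assumes s: "s \<in> tensor_cauchy M N"
  obtains B where "B > 0" "\<And>n. fnorm (s n) \<le> B"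
proof -
  obtain k where k: "\<And>m n. m \<ge> k \<Longrightarrow> n \<ge> k \<Longrightarrow> formal_dist M N (s m) (s n) < 1"
    using tensor_cauchyE[OF s zero_less_one] by metis
  define B where "B = Max ((\<lambda>n. fnorm (s n)) ` {..k}) + 1"
  have le: "fnorm (s n) \<le> B - 1" if "n \<le> k" for n
    using that by (auto simp: B_def intro!: Max_ge)
  have "fnorm (s n) \<le> B" for n
  proof (cases "n \<le> k")
    case False
    have "fnorm (s n) = fnorm (s k @ fminus (s n) (s k))"
      unfolding fnorm_def
      by (simp add: formal_ip_append_left formal_ip_append_right formal_ip_smult_right formal_ip_smult_left
          tensor_cauchy_formals[OF s])
    also have "\<dots> \<le> fnorm (s k) + formal_dist M N (s n) (s k)"
      unfolding formal_dist_fnorm by (rule fnorm_append) (simp_all add: tensor_cauchy_formals[OF s])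
    also have "\<dots> \<le> B" using le[of k] k[of n k] False by simp
    finally show ?thesis .
  next
    case True
    then show ?thesis using le[of n] by simp
  qed
  moreover have "B > 0" using le[of 0] fnorm_nonneg[of "s 0"] by linarith
  ultimately show thesis using that by blast
qed

lemma formal_ip_same_limit:
  assumes "(s, s') \<in> tensor_rel M N" "(t, t') \<in> tensor_rel M N"
  shows "(\<lambda>n. formal_ip M N (s n) (t n) - formal_ip M N (s' n) (t' n)) \<longlonglongrightarrow> 0"
proof -
  have c: "s \<in> tensor_cauchy M N" "s' \<in> tensor_cauchy M N" "t \<in> tensor_cauchy M N" "t' \<in> tensor_cauchy M N"
    and lim: "(\<lambda>n. formal_dist M N (s n) (s' n)) \<longlonglongrightarrow> 0" "(\<lambda>n. formal_dist M N (t n) (t' n)) \<longlonglongrightarrow> 0"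
    using assms by (auto simp: tensor_rel_def)
  obtain B where B: "\<And>n. fnorm (t n) \<le> B" using fnorm_bounded[OF c(3)] by blast
  obtain B' where B': "\<And>n. fnorm (s' n) \<le> B'" using fnorm_bounded[OF c(2)] by blast
  have "(\<lambda>n. formal_dist M N (s n) (s' n) * B + B' * formal_dist M N (t n) (t' n)) \<longlonglongrightarrow> 0 * B + B' * 0"
    by (intro tendsto_intros lim)
  then have lim': "(\<lambda>n. formal_dist M N (s n) (s' n) * B + B' * formal_dist M N (t n) (t' n)) \<longlonglongrightarrow> 0" by simp
  have "norm (formal_ip M N (s n) (t n) - formal_ip M N (s' n) (t' n))
      \<le> formal_dist M N (s n) (s' n) * B + B' * formal_dist M N (t n) (t' n)" for n
    by (rule order_trans[OF norm_formal_ip_diff add_mono[OF mult_left_mono[OF B] mult_right_mono[OF B']]])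
      (simp_all add: c[THEN tensor_cauchy_formals])
  then show ?thesis by (intro Lim_null_comparison[OF always_eventually[OF allI] lim'])
qed

lemma formal_ip_convergent:
  assumes s: "s \<in> tensor_cauchy M N" and t: "t \<in> tensor_cauchy M N"
  shows "convergent (\<lambda>n. formal_ip M N (s n) (t n))"
proof (rule Cauchy_convergent, rule CauchyI)
  obtain B where B: "B > 0" "\<And>n. fnorm (t n) \<le> B" using fnorm_bounded[OF t] by blast
  obtain B' where B': "B' > 0" "\<And>n. fnorm (s n) \<le> B'" using fnorm_bounded[OF s] by blast
  fix e :: real assume e: "e > 0"
  have e2: "e / (2 * B) > 0" "e / (2 * B') > 0" using e B(1) B'(1) by simp_all
  obtain k where k: "\<And>m n. m \<ge> k \<Longrightarrow> n \<ge> k \<Longrightarrow> formal_dist M N (s m) (s n) < e / (2 * B)"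
    using tensor_cauchyE[OF s e2(1)] by metis
  obtain l where l: "\<And>m n. m \<ge> l \<Longrightarrow> n \<ge> l \<Longrightarrow> formal_dist M N (t m) (t n) < e / (2 * B')"
    using tensor_cauchyE[OF t e2(2)] by metis
  have "norm (formal_ip M N (s m) (t m) - formal_ip M N (s n) (t n)) < e" if "m \<ge> max k l" "n \<ge> max k l" for m n
  proof -
    have "norm (formal_ip M N (s m) (t m) - formal_ip M N (s n) (t n))
        \<le> formal_dist M N (s m) (s n) * fnorm (t m) + fnorm (s n) * formal_dist M N (t m) (t n)"
      by (rule norm_formal_ip_diff) (simp_all add: tensor_cauchy_formals s t)
    also have "\<dots> \<le> formal_dist M N (s m) (s n) * B + B' * formal_dist M N (t m) (t n)"
      by (rule add_mono[OF mult_left_mono[OF B(2)] mult_right_mono[OF B'(2)]]) simp_all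
    also have "\<dots> < (e / (2 * B)) * B + B' * (e / (2 * B'))"
      by (rule add_strict_mono[OF mult_strict_right_mono[OF k B(1)] mult_strict_left_mono[OF l B'(1)]])
        (use that in simp_all)
    also have "\<dots> = e" using B(1) B'(1) by simp
    finally show ?thesis .
  qed
  then show "\<exists>k. \<forall>m\<ge>k. \<forall>n\<ge>k. norm (formal_ip M N (s m) (t m) - formal_ip M N (s n) (t n)) < e" by blast
qed

abbreviation tclass :: "(nat \<Rightarrow> ('x, 'y) formal) \<Rightarrow> (nat \<Rightarrow> ('x, 'y) formal) set" where
  "tclass s \<equiv> tensor_rel M N `` {s}"

lemma tclass_carrier: "s \<in> tensor_cauchy M N \<Longrightarrow> tclass s \<in> carrier (tensor_product M N)"
  by (simp add: tensor_product_def quotientI)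

lemma some_tclass: assumes "s \<in> tensor_cauchy M N" shows "(s, SOME t. t \<in> tclass s) \<in> tensor_rel M N"
proof -
  have "s \<in> tclass s" using assms by (rule equiv_class_self[OF tensor_rel_equiv])
  then have "(SOME t. t \<in> tclass s) \<in> tclass s" by (rule someI[of "\<lambda>t. t \<in> tclass s"])
  then show ?thesis by simp
qed

text \<open>The inner product of classes is a limit along chosen representatives; a change of
  representatives alters the sequence only by a null sequence.\<close>

lemma tensor_ip_tendsto:
  assumes s: "s \<in> tensor_cauchy M N" and t: "t \<in> tensor_cauchy M N"
  shows "(\<lambda>n. formal_ip M N (s n) (t n)) \<longlonglongrightarrow> ip (tensor_product M N) (tclass s) (tclass t)"
proof -
  define s' t' where "s' = (SOME s'. s' \<in> tclass s)" and "t' = (SOME t'. t' \<in> tclass t)"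
  obtain l where l: "(\<lambda>n. formal_ip M N (s n) (t n)) \<longlonglongrightarrow> l"
    using formal_ip_convergent[OF s t] by (auto simp: convergent_def)
  have "(\<lambda>n. formal_ip M N (s n) (t n) - formal_ip M N (s' n) (t' n)) \<longlonglongrightarrow> 0"
    unfolding s'_def t'_def by (rule formal_ip_same_limit[OF some_tclass[OF s] some_tclass[OF t]])
  from tendsto_diff[OF l this] have "(\<lambda>n. formal_ip M N (s' n) (t' n)) \<longlonglongrightarrow> l" by simp
  then have "lim (\<lambda>n. formal_ip M N (s' n) (t' n)) = l" by (rule limI)
  then show ?thesis using l by (simp add: tensor_product_def s'_def t'_def)
qed

lemma tensor_add:
  assumes s: "s \<in> tensor_cauchy M N" and t: "t \<in> tensor_cauchy M N"
  shows "tclass s \<oplus>\<^bsub>tensor_product M N\<^esub> tclass t = tclass (\<lambda>n. s n @ t n)"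
proof -
  have eq: "tclass (\<lambda>n. s' n @ t' n) = tclass (\<lambda>n. s n @ t n)" if "s' \<in> tclass s" "t' \<in> tclass t" for s' t'
  proof -
    have c: "s' \<in> tensor_cauchy M N" "t' \<in> tensor_cauchy M N"
      and lim: "(\<lambda>n. formal_dist M N (s n) (s' n)) \<longlonglongrightarrow> 0" "(\<lambda>n. formal_dist M N (t n) (t' n)) \<longlonglongrightarrow> 0"
      using that by (auto simp: tensor_rel_def)
    have lim': "(\<lambda>n. formal_dist M N (s n) (s' n) + formal_dist M N (t n) (t' n)) \<longlonglongrightarrow> 0"
      using tendsto_add[OF lim] by simp
    have "(\<lambda>n. formal_dist M N (s n @ t n) (s' n @ t' n)) \<longlonglongrightarrow> 0"
      by (rule Lim_null_comparison[OF always_eventually[OF allI] lim'])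
        (simp add: formal_dist_append tensor_cauchy_formals s t c)
    then have "((\<lambda>n. s n @ t n), (\<lambda>n. s' n @ t' n)) \<in> tensor_rel M N"
      by (simp add: tensor_rel_def tensor_cauchy_append s t c)
    from equiv_class_eq[OF tensor_rel_equiv this] show ?thesis by simp
  qed
  have ne: "s \<in> tclass s" "t \<in> tclass t"
    by (rule equiv_class_self[OF tensor_rel_equiv s], rule equiv_class_self[OF tensor_rel_equiv t])
  have "tclass s \<oplus>\<^bsub>tensor_product M N\<^esub> tclass t = (\<Union>s'\<in>tclass s. \<Union>t'\<in>tclass t. tclass (\<lambda>n. s' n @ t' n))"
    by (simp add: tensor_product_def)
  also have "\<dots> = (\<Union>s'\<in>tclass s. \<Union>t'\<in>tclass t. tclass (\<lambda>n. s n @ t n))"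
    by (intro SUP_cong refl eq)
  also have "\<dots> = tclass (\<lambda>n. s n @ t n)" using ne by blast
  finally show ?thesis .
qed

end

section \<open>What an isomorphism with the tensor product gives: inner products and density\<close>

locale tensor_iso = bimodule_pair M N + R: right_hilbert_bimodule R
  for M :: "('a::cstar_algebra, 'x) bimodule" and N :: "('a, 'y) bimodule" and R :: "('a, 'z) bimodule" +
  fixes f and mul
  assumes iso: "bimodule_iso (tensor_product M N) R f"
    and simple: "\<And>x y. x \<in> carrier M \<Longrightarrow> y \<in> carrier N \<Longrightarrow> f (simple_tensor M N x y) = mul x y"
begin

abbreviation F :: "('x, 'y) formal \<Rightarrow> 'z" where
  "F u \<equiv> lsum R (map (\<lambda>(x, y). mul x y) u)"

lemma f_carrier: "s \<in> tensor_cauchy M N \<Longrightarrow> f (tclass s) \<in> carrier R"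
  using iso tclass_carrier[of s] by (auto simp: bimodule_iso_def bij_betw_def)

lemma f_append:
  assumes "u \<in> formals M N" "v \<in> formals M N"
  shows "f (tclass (\<lambda>n. u @ v)) = f (tclass (\<lambda>n. u)) \<oplus>\<^bsub>R\<^esub> f (tclass (\<lambda>n. v))"
proof -
  have "f (tclass (\<lambda>n. u) \<oplus>\<^bsub>tensor_product M N\<^esub> tclass (\<lambda>n. v)) = f (tclass (\<lambda>n. u)) \<oplus>\<^bsub>R\<^esub> f (tclass (\<lambda>n. v))"
    using iso assms tclass_carrier[OF tensor_cauchy_const] unfolding bimodule_iso_def by blast
  then show ?thesis by (simp add: tensor_add tensor_cauchy_const assms)
qed

lemma f_formal: "u \<in> formals M N \<Longrightarrow> f (tclass (\<lambda>n. u)) = F u"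
proof (induction u)
  case Nil
  have c: "f (tclass (\<lambda>n. [])) \<in> carrier R" by (intro f_carrier tensor_cauchy_const) simp
  have "f (tclass (\<lambda>n. [])) = f (tclass (\<lambda>n. [])) \<oplus>\<^bsub>R\<^esub> f (tclass (\<lambda>n. []))" using f_append[of "[]" "[]"] by simp
  then have "f (tclass (\<lambda>n. [])) = \<zero>\<^bsub>R\<^esub>" using c by (metis R.M.add.l_cancel_one')
  then show ?case by simp
next
  case (Cons p u)
  obtain x y where p: "p = (x, y)" by (cases p)
  have "f (tclass (\<lambda>n. [(x, y)])) = mul x y"
    using simple[of x y] Cons.prems by (simp add: p simple_tensor_def)
  then show ?case using f_append[of "[p]" u] Cons by (simp add: p)
qed

lemma ip_F:
  assumes u: "u \<in> formals M N" and v: "v \<in> formals M N"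
  shows "ip R (F u) (F v) = formal_ip M N u v"
proof -
  have "ip R (f (tclass (\<lambda>n. u))) (f (tclass (\<lambda>n. v))) = ip (tensor_product M N) (tclass (\<lambda>n. u)) (tclass (\<lambda>n. v))"
    using iso tclass_carrier[OF tensor_cauchy_const] u v unfolding bimodule_iso_def by blast
  also have "\<dots> = formal_ip M N u v"
    using tensor_ip_tendsto[OF tensor_cauchy_const[OF u] tensor_cauchy_const[OF v]] by (simp add: LIMSEQ_const_iff)
  finally show ?thesis by (simp only: f_formal u v)
qed

text \<open>A vector of \<open>R\<close> comes from a class of Cauchy sequences, and a late term of
  such a sequence, seen as a constant sequence, is close to the class.\<close>

lemma F_dense:
  assumes z: "z \<in> carrier R" and \<epsilon>: "\<epsilon> > 0"
  shows "\<exists>u\<in>formals M N. mnorm R (z \<ominus>\<^bsub>R\<^esub> F u) \<le> \<epsilon>"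
proof -
  obtain C where C: "C \<in> carrier (tensor_product M N)" "z = f C"
    using iso z unfolding bimodule_iso_def bij_betw_def by blast
  obtain s where s: "s \<in> tensor_cauchy M N" "C = tclass s"
    using C(1) by (auto simp: tensor_product_def elim: quotientE)
  obtain k where k: "\<And>m n. m \<ge> k \<Longrightarrow> n \<ge> k \<Longrightarrow> formal_dist M N (s m) (s n) < \<epsilon>"
    using tensor_cauchyE[OF s(1) \<epsilon>] by metis
  define u where "u = s k"
  have u: "u \<in> formals M N" unfolding u_def by (rule tensor_cauchy_formals[OF s(1)])
  note uc = tensor_cauchy_const[OF u]
  have Fu: "F u = f (tclass (\<lambda>n. u))" by (rule f_formal[OF u, symmetric])
  have Fc: "F u \<in> carrier R" unfolding Fu by (rule f_carrier[OF uc])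
  have ips: "ip R (f (tclass a)) (f (tclass b)) = ip (tensor_product M N) (tclass a) (tclass b)"
    if "a \<in> tensor_cauchy M N" "b \<in> tensor_cauchy M N" for a b
    using iso tclass_carrier that unfolding bimodule_iso_def by blast
  have "ip R (z \<ominus>\<^bsub>R\<^esub> F u) (z \<ominus>\<^bsub>R\<^esub> F u) = ip R z z - ip R z (F u) - (ip R (F u) z - ip R (F u) (F u))"
    using z Fc by (simp add: R.ip_simps)
  also have "\<dots> = ip (tensor_product M N) (tclass s) (tclass s) - ip (tensor_product M N) (tclass s) (tclass (\<lambda>n. u))
      - (ip (tensor_product M N) (tclass (\<lambda>n. u)) (tclass s) - ip (tensor_product M N) (tclass (\<lambda>n. u)) (tclass (\<lambda>n. u)))"
    by (simp only: Fu C(2) s(2) ips s(1) uc)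
  finally have e: "ip R (z \<ominus>\<^bsub>R\<^esub> F u) (z \<ominus>\<^bsub>R\<^esub> F u) = \<dots>" .
  have "(\<lambda>n. formal_ip M N (s n) (s n) - formal_ip M N (s n) u - (formal_ip M N u (s n) - formal_ip M N u u))
      \<longlonglongrightarrow> ip R (z \<ominus>\<^bsub>R\<^esub> F u) (z \<ominus>\<^bsub>R\<^esub> F u)"
    unfolding e
    by (intro tendsto_diff tensor_ip_tendsto[OF s(1) s(1)] tensor_ip_tendsto[OF s(1) uc]
        tensor_ip_tendsto[OF uc s(1)] tensor_ip_tendsto[OF uc uc])
  moreover have "formal_ip M N (s n) (s n) - formal_ip M N (s n) u - (formal_ip M N u (s n) - formal_ip M N u u)
      = formal_ip M N (fminus (s n) u) (fminus (s n) u)" for n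
    using u tensor_cauchy_formals[OF s(1), of n] by (simp add: formal_ip_fminus)
  ultimately have lim: "(\<lambda>n. norm (formal_ip M N (fminus (s n) u) (fminus (s n) u))) \<longlonglongrightarrow> norm (ip R (z \<ominus>\<^bsub>R\<^esub> F u) (z \<ominus>\<^bsub>R\<^esub> F u))"
    by (simp only: tendsto_norm)
  have le: "norm (formal_ip M N (fminus (s n) u) (fminus (s n) u)) \<le> \<epsilon>\<^sup>2" if "n \<ge> k" for n
  proof -
    have "fnorm (fminus (s n) u) \<le> \<epsilon>" using k[OF that, of k] by (simp add: u_def formal_dist_fnorm)
    then show ?thesis unfolding fnorm_sq[symmetric] by (rule power_mono) simp
  qed
  have "norm (ip R (z \<ominus>\<^bsub>R\<^esub> F u) (z \<ominus>\<^bsub>R\<^esub> F u)) \<le> \<epsilon>\<^sup>2"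
    by (rule LIMSEQ_le_const2[OF lim]) (use le in blast)
  then have "mnorm R (z \<ominus>\<^bsub>R\<^esub> F u) \<le> \<epsilon>" unfolding mnorm_sq[symmetric] by (rule power2_le_imp_le) (use \<epsilon> in simp)
  then show ?thesis using u by blast
qed

end


subsection \<open>Compact operators on a product\<close>

text \<open>
  The situation of two fibres and their product: \<open>mul\<close> need not have dense span, so that the
  case of the identity fibre on the left is included.
\<close>

locale hilbert_product = bimodule_pair M N + R: right_hilbert_bimodule R
  for M :: "('a::cstar_algebra, 'x) bimodule" and N :: "('a, 'y) bimodule" and R :: "('a, 'z) bimodule" +
  fixes mul :: "'x \<Rightarrow> 'y \<Rightarrow> 'z"
  assumes mul_closed [simp]: "x \<in> carrier M \<Longrightarrow> y \<in> carrier N \<Longrightarrow> mul x y \<in> carrier R"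
    and ip_mul: "\<lbrakk>x \<in> carrier M; y \<in> carrier N; x' \<in> carrier M; y' \<in> carrier N\<rbrakk> \<Longrightarrow>
      ip R (mul x y) (mul x' y') = ip N y (lact N (ip M x x') y')"
    and mul_ract_left: "\<lbrakk>x \<in> carrier M; y \<in> carrier N\<rbrakk> \<Longrightarrow> mul (ract M x a) y = mul x (lact N a y)"
    and mul_ract: "\<lbrakk>x \<in> carrier M; y \<in> carrier N\<rbrakk> \<Longrightarrow> mul x (ract N y a) = ract R (mul x y) a"
begin

lemma ip_lact_simps:
  "y \<in> carrier N \<Longrightarrow> y' \<in> carrier N \<Longrightarrow> ip N y (lact N (a + b) y') = ip N y (lact N a y') + ip N y (lact N b y')"
  "y \<in> carrier N \<Longrightarrow> y' \<in> carrier N \<Longrightarrow> ip N y (lact N (a - b) y') = ip N y (lact N a y') - ip N y (lact N b y')"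
proof -
  have add: "ip N y (lact N (a + b) y') = ip N y (lact N a y') + ip N y (lact N b y')"
    if "y \<in> carrier N" "y' \<in> carrier N" for a b y y' using that by (simp add: N.lact_add N.ip_add)
  show "ip N y (lact N (a + b) y') = ip N y (lact N a y') + ip N y (lact N b y')"
    if "y \<in> carrier N" "y' \<in> carrier N" using add[OF that] .
  show "ip N y (lact N (a - b) y') = ip N y (lact N a y') - ip N y (lact N b y')"
    if "y \<in> carrier N" "y' \<in> carrier N" using add[OF that, of "a - b" b] by simp
qed

text \<open>Biadditivity of \<open>mul\<close> is not assumed in the locale. It follows from
  \<open>ip_mul\<close>, since the difference of the two sides has inner square 0.\<close>

lemma R_eqI: "z \<in> carrier R \<Longrightarrow> z' \<in> carrier R \<Longrightarrow> ip R (z \<ominus>\<^bsub>R\<^esub> z') (z \<ominus>\<^bsub>R\<^esub> z') = 0 \<Longrightarrow> z = z'"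
  using R.ip_eq_zero[of "z \<ominus>\<^bsub>R\<^esub> z'"] R.diff_eq_zero_iff[of z z'] by simp

lemma mul_add_right:
  assumes "x \<in> carrier M" "y \<in> carrier N" "y' \<in> carrier N"
  shows "mul x (y \<oplus>\<^bsub>N\<^esub> y') = mul x y \<oplus>\<^bsub>R\<^esub> mul x y'"
  by (rule R_eqI) (use assms in \<open>simp_all add: R.ip_simps ip_mul N.ip_add N.ip_add_left N.lact_add_right\<close>)

lemma mul_diff_right:
  assumes "x \<in> carrier M" "y \<in> carrier N" "y' \<in> carrier N"
  shows "mul x (y \<ominus>\<^bsub>N\<^esub> y') = mul x y \<ominus>\<^bsub>R\<^esub> mul x y'"
proof -
  have l: "lact N a (y \<ominus>\<^bsub>N\<^esub> y') = lact N a y \<ominus>\<^bsub>N\<^esub> lact N a y'" for a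
    using assms by (simp add: N.minus_eq N.lact_add_right N.lact_smult_right)
  show ?thesis
    by (rule R_eqI) (use assms in \<open>simp_all add: R.ip_simps ip_mul N.ip_diff N.ip_diff_left l\<close>)
qed

lemma mul_add_left:
  assumes "x \<in> carrier M" "x' \<in> carrier M" "y \<in> carrier N"
  shows "mul (x \<oplus>\<^bsub>M\<^esub> x') y = mul x y \<oplus>\<^bsub>R\<^esub> mul x' y"
  by (rule R_eqI) (use assms in \<open>simp_all add: R.ip_simps ip_mul M.ip_add M.ip_add_left ip_lact_simps\<close>)

lemma mul_diff_left:
  assumes "x \<in> carrier M" "x' \<in> carrier M" "y \<in> carrier N"
  shows "mul (x \<ominus>\<^bsub>M\<^esub> x') y = mul x y \<ominus>\<^bsub>R\<^esub> mul x' y"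
  by (rule R_eqI) (use assms in \<open>simp_all add: R.ip_simps ip_mul M.ip_diff M.ip_diff_left ip_lact_simps\<close>)

lemma mul_zero [simp]: "x \<in> carrier M \<Longrightarrow> mul x \<zero>\<^bsub>N\<^esub> = \<zero>\<^bsub>R\<^esub>" "y \<in> carrier N \<Longrightarrow> mul \<zero>\<^bsub>M\<^esub> y = \<zero>\<^bsub>R\<^esub>"
  by (rule R_eqI; simp add: R.ip_simps ip_mul)+

lemma mnorm_mul:
  assumes x: "x \<in> carrier M" and y: "y \<in> carrier N"
  shows "mnorm R (mul x y) \<le> mnorm M x * mnorm N y"
proof (rule power2_le_imp_le)
  have "(mnorm R (mul x y))\<^sup>2 = norm (ip N y (lact N (ip M x x) y))" using x y by (simp add: mnorm_sq ip_mul)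
  also have "\<dots> \<le> mnorm N y * mnorm N (lact N (ip M x x) y)" using y by (intro N.norm_ip) simp_all
  also have "\<dots> \<le> mnorm N y * (norm (ip M x x) * mnorm N y)" using y by (intro mult_left_mono N.mnorm_lact) simp_all
  also have "\<dots> = (mnorm M x * mnorm N y)\<^sup>2"
    by (simp add: power_mult_distrib flip: mnorm_sq) (simp add: power2_eq_square)
  finally show "(mnorm R (mul x y))\<^sup>2 \<le> (mnorm M x * mnorm N y)\<^sup>2" .
qed simp

definition mul_sum :: "('x \<times> 'y) list \<Rightarrow> 'z" where
  "mul_sum u = lsum R (map (\<lambda>(x, y). mul x y) u)"

lemma mul_sum_simps [simp]: "mul_sum [] = \<zero>\<^bsub>R\<^esub>" "mul_sum ((x, y) # u) = mul x y \<oplus>\<^bsub>R\<^esub> mul_sum u"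
  by (simp_all add: mul_sum_def)

lemma mul_sum_closed [simp]: "u \<in> formals M N \<Longrightarrow> mul_sum u \<in> carrier R"
  by (induction u) auto

text \<open>S \<otimes> 1 on formal sums. It stays a map of lists, because it is not known in
  advance to respect equality in \<open>R\<close>.\<close>

definition act :: "('x \<Rightarrow> 'x) \<Rightarrow> ('x \<times> 'y) list \<Rightarrow> ('x \<times> 'y) list" where
  "act S u = map (\<lambda>(x, y). (S x, y)) u"

lemma act_simps [simp]: "act S [] = []" "act S ((x, y) # u) = (S x, y) # act S u"
  by (simp_all add: act_def)

lemma act_closed: assumes "\<And>x. x \<in> carrier M \<Longrightarrow> S x \<in> carrier M" "u \<in> formals M N" shows "act S u \<in> formals M N"
  using assms(2) by (induction u) (auto simp: assms(1))

lemma ip_mul_sum_adjoint: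
  assumes S: "\<And>x. x \<in> carrier M \<Longrightarrow> S x \<in> carrier M" and T: "\<And>x. x \<in> carrier M \<Longrightarrow> T x \<in> carrier M"
    and adj: "is_adjoint M S T" and u: "u \<in> formals M N" and v: "v \<in> formals M N"
  shows "ip R (mul_sum (act S u)) (mul_sum v) = ip R (mul_sum u) (mul_sum (act T v))"
  using u
proof (induction u)
  case Nil
  then show ?case using v act_closed[of T v] T by simp
next
  case (Cons p u)
  obtain x y where p: "p = (x, y)" by (cases p)
  have xy: "x \<in> carrier M" "y \<in> carrier N" "u \<in> formals M N" using Cons.prems by (simp_all add: p)
  have "ip R (mul (S x) y) (mul_sum v) = ip R (mul x y) (mul_sum (act T v))"
    using v
  proof (induction v)
    case Nil
    then show ?case using xy S by simp
  next
    case (Cons q v)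
    obtain x' y' where q: "q = (x', y')" by (cases q)
    have q': "x' \<in> carrier M" "y' \<in> carrier N" "v \<in> formals M N" using Cons.prems by (simp_all add: q)
    have "ip M (S x) x' = ip M x (T x')" using adj xy q' by (simp add: is_adjoint_def)
    then show ?case using Cons.IH[OF q'(3)] xy q' S T act_closed[of T v] by (simp add: q R.ip_add ip_mul)
  qed
  then show ?case using Cons.IH[OF xy(3)] xy S T v act_closed[of T v] act_closed[of S u] by (simp add: p R.ip_add_left)
qed

lemma mnorm_mul_sum_le: "u \<in> formals M N \<Longrightarrow> mnorm R (mul_sum u) \<le> (\<Sum>(x, y)\<leftarrow>u. mnorm M x * mnorm N y)"
proof (induction u)
  case (Cons p u)
  obtain x y where p: "p = (x, y)" by (cases p)
  have xy: "x \<in> carrier M" "y \<in> carrier N" "u \<in> formals M N" using Cons.prems by (simp_all add: p)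
  have "mnorm R (mul_sum (p # u)) \<le> mnorm R (mul x y) + mnorm R (mul_sum u)" using xy by (simp add: p R.mnorm_triangle)
  also have "\<dots> \<le> mnorm M x * mnorm N y + (\<Sum>(x, y)\<leftarrow>u. mnorm M x * mnorm N y)"
    by (rule add_mono[OF mnorm_mul[OF xy(1,2)] Cons.IH[OF xy(3)]])
  finally show ?case by (simp add: p)
qed simp

text \<open>
  For selfadjoint \<open>S\<close> the norms of \<open>mul_sum (S\<^sup>n u)\<close> form a log-convex sequence growing at most like \<open>k\<^sup>n\<close>,
  so already its first quotient is at most \<open>k\<close>.
\<close>

lemma mnorm_mul_sum_act_selfadjoint:
  assumes S: "\<And>x. x \<in> carrier M \<Longrightarrow> S x \<in> carrier M" and adj: "is_adjoint M S S"
    and bd: "op_bound M S k" and k: "k \<ge> 0" and u: "u \<in> formals M N"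
  shows "mnorm R (mul_sum (act S u)) \<le> k * mnorm R (mul_sum u)"
proof -
  define b where "b n = mnorm R (mul_sum ((act S ^^ n) u))" for n
  have cl: "(act S ^^ n) u \<in> formals M N" for n by (induction n) (simp_all add: u act_closed S)
  have pw: "(S ^^ n) x \<in> carrier M \<and> mnorm M ((S ^^ n) x) \<le> k ^ n * mnorm M x" if x: "x \<in> carrier M" for n x
  proof (induction n)
    case (Suc n)
    have "mnorm M (S ((S ^^ n) x)) \<le> k * mnorm M ((S ^^ n) x)" using bd Suc by (simp add: op_bound_def)
    also have "\<dots> \<le> k * (k ^ n * mnorm M x)" using Suc k by (intro mult_left_mono) simp_all
    finally show ?case using Suc S by (simp add: mult.assoc)
  qed (simp add: x)
  have act_pw: "(act S ^^ n) u = map (\<lambda>(x, y). ((S ^^ n) x, y)) u" for n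
    by (induction n) (simp_all add: act_def case_prod_unfold)
  define C where "C = (\<Sum>(x, y)\<leftarrow>u. mnorm M x * mnorm N y)"
  have up: "b n \<le> C * k ^ n" for n
  proof -
    have "b n \<le> (\<Sum>(x, y)\<leftarrow>(act S ^^ n) u. mnorm M x * mnorm N y)" unfolding b_def by (rule mnorm_mul_sum_le[OF cl])
    also have "\<dots> = (\<Sum>(x, y)\<leftarrow>u. mnorm M ((S ^^ n) x) * mnorm N y)"
      by (simp add: act_pw case_prod_unfold comp_def)
    also have "\<dots> \<le> (\<Sum>(x, y)\<leftarrow>u. (k ^ n * mnorm M x) * mnorm N y)"
      using u pw by (intro sum_list_mono) (auto simp: formals_def intro!: mult_right_mono)
    also have "\<dots> = C * k ^ n" by (simp add: C_def sum_list_const_mult case_prod_unfold mult.assoc mult.commute[of _ "k ^ n"])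
    finally show ?thesis .
  qed
  \<comment> \<open>Cauchy-Schwarz after moving one \<open>S\<close> across the inner product: the
    square of the norm at n + 1 is the norm of the pairing of S^n u with S^(n+2) u.\<close>
  have conv: "(b (Suc n))\<^sup>2 \<le> b n * b (Suc (Suc n))" for n
  proof -
    have "(b (Suc n))\<^sup>2 = norm (ip R (mul_sum (act S ((act S ^^ n) u))) (mul_sum (act S ((act S ^^ n) u))))"
      by (simp add: b_def mnorm_sq)
    also have "\<dots> = norm (ip R (mul_sum ((act S ^^ n) u)) (mul_sum (act S (act S ((act S ^^ n) u)))))"
      by (subst ip_mul_sum_adjoint[OF S S adj]) (simp_all add: cl act_closed S)
    also have "\<dots> \<le> b n * b (Suc (Suc n))" unfolding b_def by (simp add: R.norm_ip cl act_closed S)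
    finally show ?thesis .
  qed
  have bn: "b n \<ge> 0" for n by (simp add: b_def)
  have "b 1 \<le> k * b 0"
  proof (cases "b 0 = 0")
    case True
    then show ?thesis using conv[of 0] by simp
  next
    case False
    then have b0: "b 0 > 0" using bn[of 0] by linarith
    define t where "t = b 1 / b 0"
    have t0: "t \<ge> 0" using bn b0 by (simp add: t_def)
    \<comment> \<open>Log-convexity makes the quotients of successive terms nondecreasing. They are
      written as products, since some \<open>b n\<close> may vanish.\<close>
    have step: "t * b n \<le> b (Suc n)" for n
    proof (induction n)
      case (Suc n)
      show ?case
      proof (cases "b n = 0")
        case True
        then have "b (Suc n) = 0" using conv[of n] by simp
        then show ?thesis using bn by simp
      next
        case False
        then have pos: "b n > 0" using bn[of n] by linarith
        have "b n * (t * b (Suc n)) = (t * b n) * b (Suc n)" by simp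
        also have "\<dots> \<le> b (Suc n) * b (Suc n)" by (rule mult_right_mono[OF Suc.IH bn])
        also have "\<dots> \<le> b n * b (Suc (Suc n))" using conv[of n] by (simp only: power2_eq_square)
        finally show ?thesis using pos by (simp only: mult_le_cancel_left_pos)
      qed
    qed (use b0 in \<open>simp add: t_def\<close>)
    have "t ^ n * b 0 \<le> b n" for n
    proof (induction n)
      case (Suc n)
      have "t ^ Suc n * b 0 = t * (t ^ n * b 0)" by simp
      also have "\<dots> \<le> t * b n" by (rule mult_left_mono[OF Suc.IH t0])
      also have "\<dots> \<le> b (Suc n)" by (rule step)
      finally show ?case .
    qed simp
    then have "t ^ n * b 0 \<le> C * k ^ n" for n using up order_trans by blast
    then have "t \<le> k" by (rule power_growth_le[OF t0 k b0])
    then show ?thesis using b0 by (simp add: t_def field_simps)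
  qed
  then show ?thesis by (simp add: b_def)
qed

text \<open>The bound norm (S \<otimes> 1) \<le> norm S. The inner square of S u is the pairing of
  \<open>u\<close> with S* S u, and the selfadjoint case applies to S* S with the bound k^2.\<close>

lemma mnorm_mul_sum_act:
  assumes S: "\<And>x. x \<in> carrier M \<Longrightarrow> S x \<in> carrier M" and T: "\<And>x. x \<in> carrier M \<Longrightarrow> T x \<in> carrier M"
    and adj: "is_adjoint M S T" and bd: "op_bound M S k" and k: "k \<ge> 0" and u: "u \<in> formals M N"
  shows "mnorm R (mul_sum (act S u)) \<le> k * mnorm R (mul_sum u)"
proof -
  have adj': "is_adjoint M T S" using M.is_adjoint_sym[OF adj] S T by blast
  have bd': "op_bound M T k" using M.op_bound_adjoint[OF adj bd k] S T by blast
  have TS: "act (\<lambda>x. T (S x)) u = act T (act S u)" by (simp add: act_def case_prod_unfold)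
  have "mnorm R (mul_sum (act (\<lambda>x. T (S x)) u)) \<le> (k * k) * mnorm R (mul_sum u)"
  proof (rule mnorm_mul_sum_act_selfadjoint)
    show "is_adjoint M (\<lambda>x. T (S x)) (\<lambda>x. T (S x))" using adj adj' S T by (simp add: is_adjoint_def)
    show "op_bound M (\<lambda>x. T (S x)) (k * k)"
      unfolding op_bound_def
    proof
      fix x assume x: "x \<in> carrier M"
      have "mnorm M (T (S x)) \<le> k * mnorm M (S x)" using bd' S x by (simp add: op_bound_def)
      also have "\<dots> \<le> k * (k * mnorm M x)" using bd x k by (intro mult_left_mono) (simp_all add: op_bound_def)
      finally show "mnorm M (T (S x)) \<le> k * k * mnorm M x" by (simp only: mult.assoc)
    qed
  qed (use S T k u in simp_all)
  note TSle = this[unfolded TS]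
  have cl: "act S u \<in> formals M N" "act T (act S u) \<in> formals M N" using act_closed S T u by auto
  have "(mnorm R (mul_sum (act S u)))\<^sup>2 = norm (ip R (mul_sum u) (mul_sum (act T (act S u))))"
  proof -
    have "ip R (mul_sum (act S u)) (mul_sum (act S u)) = ip R (mul_sum u) (mul_sum (act T (act S u)))"
      by (rule ip_mul_sum_adjoint) (use S T adj u cl in simp_all)
    then show ?thesis by (simp only: mnorm_sq)
  qed
  also have "\<dots> \<le> mnorm R (mul_sum u) * mnorm R (mul_sum (act T (act S u)))" using u cl by (intro R.norm_ip) simp_all
  also have "\<dots> \<le> mnorm R (mul_sum u) * (k * k * mnorm R (mul_sum u))" by (rule mult_left_mono[OF TSle]) simp
  also have "\<dots> = (k * mnorm R (mul_sum u))\<^sup>2" by (simp add: power2_eq_square)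
  finally show ?thesis by (rule power2_le_imp_le) (simp add: k)
qed

text \<open>The adjoint of the creation operator v \<mapsto> y v. In these terms the amplified
  rank-one operator of \<open>x\<close> and \<open>y\<close> is creation by \<open>x\<close> after
  \<open>coact y\<close>.\<close>

definition coact :: "'x \<Rightarrow> ('x \<times> 'y) list \<Rightarrow> 'y" where
  "coact y u = lsum N (map (\<lambda>(z, w). lact N (ip M y z) w) u)"

lemma coact_simps [simp]: "coact y [] = \<zero>\<^bsub>N\<^esub>" "coact y ((z, w) # u) = lact N (ip M y z) w \<oplus>\<^bsub>N\<^esub> coact y u"
  by (simp_all add: coact_def)

lemma coact_closed [simp]: "u \<in> formals M N \<Longrightarrow> coact y u \<in> carrier N"
  by (induction u) auto

lemma ip_mul_mul_sum: "y \<in> carrier M \<Longrightarrow> v \<in> carrier N \<Longrightarrow> u \<in> formals M N \<Longrightarrow> ip R (mul y v) (mul_sum u) = ip N v (coact y u)"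
  by (induction u) (auto simp: R.ip_add N.ip_add ip_mul)

lemma mul_sum_act_rank_one:
  "x \<in> carrier M \<Longrightarrow> y \<in> carrier M \<Longrightarrow> u \<in> formals M N \<Longrightarrow> mul_sum (act (rank_one M x y) u) = mul x (coact y u)"
  by (induction u) (auto simp: rank_one_def mul_ract_left mul_add_right)

lemma mnorm_coact:
  assumes y: "y \<in> carrier M" and u: "u \<in> formals M N"
  shows "mnorm N (coact y u) \<le> mnorm M y * mnorm R (mul_sum u)"
proof -
  define w where "w = coact y u"
  have w: "w \<in> carrier N" using u by (simp add: w_def)
  have "(mnorm N w)\<^sup>2 = norm (ip R (mul y w) (mul_sum u))"
    by (simp add: mnorm_sq ip_mul_mul_sum[OF y w u] flip: w_def)
  also have "\<dots> \<le> mnorm R (mul y w) * mnorm R (mul_sum u)" using y w u by (intro R.norm_ip) simp_all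
  also have "\<dots> \<le> (mnorm M y * mnorm N w) * mnorm R (mul_sum u)" by (intro mult_right_mono mnorm_mul y w) simp
  finally have "mnorm N w * mnorm N w \<le> (mnorm M y * mnorm R (mul_sum u)) * mnorm N w"
    by (simp add: power2_eq_square mult_ac)
  then show ?thesis
    unfolding w_def[symmetric] using mult_right_le_imp_le[of "mnorm N w" "mnorm N w" "mnorm M y * mnorm R (mul_sum u)"]
    by (cases "mnorm N w = 0") (simp_all add: order.strict_iff_order)
qed

lemma mul_sum_act_add:
  assumes S: "\<And>x. x \<in> carrier M \<Longrightarrow> S x \<in> carrier M" and T: "\<And>x. x \<in> carrier M \<Longrightarrow> T x \<in> carrier M"
    and u: "u \<in> formals M N"
  shows "mul_sum (act (\<lambda>x. S x \<oplus>\<^bsub>M\<^esub> T x) u) = mul_sum (act S u) \<oplus>\<^bsub>R\<^esub> mul_sum (act T u)"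
  using u
proof (induction u)
  case (Cons p u)
  obtain x y where p: "p = (x, y)" by (cases p)
  have xy: "x \<in> carrier M" "y \<in> carrier N" "u \<in> formals M N" using Cons.prems by (simp_all add: p)
  have c: "mul (S x) y \<in> carrier R" "mul (T x) y \<in> carrier R" "mul_sum (act S u) \<in> carrier R" "mul_sum (act T u) \<in> carrier R"
    using xy S T by (simp_all add: act_closed)
  show ?case
    using Cons.IH[OF xy(3)] xy S T c
    by (simp add: p mul_add_left R.M.a_ac)
qed simp

lemma mul_sum_act_diff:
  assumes S: "\<And>x. x \<in> carrier M \<Longrightarrow> S x \<in> carrier M" and T: "\<And>x. x \<in> carrier M \<Longrightarrow> T x \<in> carrier M"
    and u: "u \<in> formals M N"
  shows "mul_sum (act (\<lambda>x. S x \<ominus>\<^bsub>M\<^esub> T x) u) = mul_sum (act S u) \<ominus>\<^bsub>R\<^esub> mul_sum (act T u)"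
proof -
  have c: "mul_sum (act (\<lambda>x. S x \<ominus>\<^bsub>M\<^esub> T x) u) \<in> carrier R" "mul_sum (act T u) \<in> carrier R"
    using u S T by (simp_all add: act_closed)
  have "act S u = act (\<lambda>x. (S x \<ominus>\<^bsub>M\<^esub> T x) \<oplus>\<^bsub>M\<^esub> T x) u"
    unfolding act_def
  proof (rule map_cong)
    fix p assume "p \<in> set u"
    then obtain x y where p: "p = (x, y)" "x \<in> carrier M" using u by (cases p) (auto simp: formals_def)
    have "S x = (S x \<ominus>\<^bsub>M\<^esub> T x) \<oplus>\<^bsub>M\<^esub> T x"
      by (rule M.ip_eqI) (use p S T in \<open>simp_all add: M.ip_simps\<close>)
    then show "(case p of (x, y) \<Rightarrow> (S x, y)) = (case p of (x, y) \<Rightarrow> ((S x \<ominus>\<^bsub>M\<^esub> T x) \<oplus>\<^bsub>M\<^esub> T x, y))" by (simp add: p)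
  qed simp
  then have "mul_sum (act S u) = mul_sum (act (\<lambda>x. S x \<ominus>\<^bsub>M\<^esub> T x) u) \<oplus>\<^bsub>R\<^esub> mul_sum (act T u)"
    using mul_sum_act_add[of "\<lambda>x. S x \<ominus>\<^bsub>M\<^esub> T x" T u] S T u by simp
  then show ?thesis using c by (intro R.ip_eqI) (simp_all add: R.ip_simps)
qed

lemma lift_pairs: "K \<in> pairs N \<Longrightarrow> x \<in> carrier M \<Longrightarrow> y \<in> carrier M \<Longrightarrow> map (\<lambda>(a, b). (mul x a, mul y b)) K \<in> pairs R"
  by (induction K) auto

text \<open>A finite-rank operator of \<open>N\<close> between creation by \<open>x\<close> and the
  adjoint of creation by \<open>y\<close> is a finite-rank operator of \<open>R\<close>.\<close>

lemma fin_op_lift: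
  assumes "K \<in> pairs N" "x \<in> carrier M" "y \<in> carrier M" "u \<in> formals M N"
  shows "fin_op R (map (\<lambda>(a, b). (mul x a, mul y b)) K) (mul_sum u) = mul x (fin_op N K (coact y u))"
  using assms(1)
proof (induction K)
  case (Cons p K)
  obtain a b where p: "p = (a, b)" by (cases p)
  show ?case
    using Cons assms
    by (simp add: p ip_mul_mul_sum mul_add_right N.fin_op_carrier mul_ract)
qed (use assms in \<open>simp del: N.fin_op_Nil R.fin_op_Nil\<close>)

end

text \<open>Density excludes the identity fibre as left factor, where A N need not be dense.
  Compactness of the left action on \<open>N\<close> makes amplified operators compact, and
  covariance there leaves their images unchanged.\<close>

locale hilbert_product_rep = hilbert_product M N R mul +
    MR: module_rep M \<sigma> \<alpha> + NR: module_rep N \<sigma> \<beta> + RR: module_rep R \<sigma> \<gamma>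
  for M :: "('a::cstar_algebra, 'x) bimodule" and N :: "('a, 'y) bimodule" and R :: "('a, 'z) bimodule"
    and mul :: "'x \<Rightarrow> 'y \<Rightarrow> 'z" and \<sigma> :: "'a \<Rightarrow> 'b::cstar_algebra" and \<alpha> :: "'x \<Rightarrow> 'b" and \<beta> :: "'y \<Rightarrow> 'b"
    and \<gamma> :: "'z \<Rightarrow> 'b" +
  assumes rep_mul: "x \<in> carrier M \<Longrightarrow> y \<in> carrier N \<Longrightarrow> \<gamma> (mul x y) = \<alpha> x * \<beta> y"
    and dense: "\<And>z \<epsilon>. z \<in> carrier R \<Longrightarrow> \<epsilon> > 0 \<Longrightarrow> \<exists>u\<in>formals M N. mnorm R (z \<ominus>\<^bsub>R\<^esub> mul_sum u) \<le> \<epsilon>"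
    and phi_compact: "phi N a \<in> compacts N"
    and covariant: "psi_compacts N \<beta> (phi N a) = \<sigma> a"
begin

lemma rep_lift:
  "K \<in> pairs N \<Longrightarrow> x \<in> carrier M \<Longrightarrow> y \<in> carrier M \<Longrightarrow>
    RR.rep (map (\<lambda>(a, b). (mul x a, mul y b)) K) = \<alpha> x * NR.rep K * star (\<alpha> y)"
  by (induction K) (auto simp: rep_mul star_mult algebra_simps)

text \<open>
  If \<open>x a\<close> is close to \<open>x\<close> and \<open>\<phi> a\<close> close to \<open>\<Sum> a\<^sub>i \<otimes> b\<^sub>i\<^sup>*\<close>, then \<open>(x \<otimes> y\<^sup>*) \<otimes> 1\<close> is close to \<open>\<Sum> x a\<^sub>i \<otimes> (y b\<^sub>i)\<^sup>*\<close>.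
\<close>

lemma rank_one_lift:
  assumes x: "x \<in> carrier M" and y: "y \<in> carrier M" and \<epsilon>: "\<epsilon> > 0"
  shows "\<exists>L\<in>pairs R. (\<forall>u\<in>formals M N. mnorm R (mul_sum (act (rank_one M x y) u) \<ominus>\<^bsub>R\<^esub> fin_op R L (mul_sum u)) \<le> \<epsilon> * mnorm R (mul_sum u)) \<and>
    norm (RR.rep L - \<alpha> x * star (\<alpha> y)) \<le> \<epsilon>"
proof -
  \<comment> \<open>Approximating \<open>x\<close> by x a costs \<delta> mnorm y, and approximating
    phi a by the operator of \<open>K\<close> costs \<delta> mnorm x mnorm y, both for the operators
    and for their images.\<close>
  define B where "B = (1 + mnorm M x) * mnorm M y"
  define \<delta> where "\<delta> = \<epsilon> / (B + 1)"
  have B: "B \<ge> 0" by (simp add: B_def)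
  have \<delta>: "\<delta> > 0" "\<delta> * B \<le> \<epsilon>" using B \<epsilon> by (simp_all add: \<delta>_def field_simps)
  obtain a where a: "mnorm M (x \<ominus>\<^bsub>M\<^esub> ract M x a) \<le> \<delta>" using M.ract_approx[OF x \<delta>(1)] by blast
  obtain K where K: "K \<in> pairs N" "op_near N (phi N a) (fin_op N K) \<delta>"
    using phi_compact[of a] \<delta>(1) unfolding N.compacts_iff by blast
  define L where "L = map (\<lambda>(a, b). (mul x a, mul y b)) K"
  have L: "L \<in> pairs R" unfolding L_def by (rule lift_pairs[OF K(1) x y])
  have "mnorm R (mul_sum (act (rank_one M x y) u) \<ominus>\<^bsub>R\<^esub> fin_op R L (mul_sum u)) \<le> \<epsilon> * mnorm R (mul_sum u)" if u: "u \<in> formals M N" for u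
  proof -
    define w where "w = coact y u"
    have w: "w \<in> carrier N" "mnorm N w \<le> mnorm M y * mnorm R (mul_sum u)"
      using u mnorm_coact[OF y u] by (simp_all add: w_def)
    have Kw: "fin_op N K w \<in> carrier N" by (rule N.fin_op_carrier[OF K(1) w(1)])
    have "mul_sum (act (rank_one M x y) u) \<ominus>\<^bsub>R\<^esub> fin_op R L (mul_sum u) = mul x w \<ominus>\<^bsub>R\<^esub> mul x (fin_op N K w)"
      unfolding L_def w_def by (simp only: fin_op_lift[OF K(1) x y u] mul_sum_act_rank_one[OF x y u])
    also have "mnorm R \<dots> \<le> mnorm R (mul x w \<ominus>\<^bsub>R\<^esub> mul (ract M x a) w) + mnorm R (mul (ract M x a) w \<ominus>\<^bsub>R\<^esub> mul x (fin_op N K w))"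
      using x w Kw by (intro R.mnorm_minus_triangle) simp_all
    also have "mul x w \<ominus>\<^bsub>R\<^esub> mul (ract M x a) w = mul (x \<ominus>\<^bsub>M\<^esub> ract M x a) w"
      using x w by (simp add: mul_diff_left)
    \<comment> \<open>Balancing turns x a into phi a acting on \<open>w\<close>; here compactness of
      phi a enters.\<close>
    also have "mul (ract M x a) w \<ominus>\<^bsub>R\<^esub> mul x (fin_op N K w) = mul x (phi N a w \<ominus>\<^bsub>N\<^esub> fin_op N K w)"
      using x w Kw by (simp add: mul_ract_left mul_diff_right phi_def)
    also have "mnorm R (mul (x \<ominus>\<^bsub>M\<^esub> ract M x a) w) \<le> \<delta> * mnorm N w"
      using x w a by (intro order_trans[OF mnorm_mul] mult_right_mono) simp_all
    also have "mnorm R (mul x (phi N a w \<ominus>\<^bsub>N\<^esub> fin_op N K w)) \<le> mnorm M x * (\<delta> * mnorm N w)"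
      using x w Kw K(2) by (intro order_trans[OF mnorm_mul] mult_left_mono) (simp_all add: op_near_def phi_def)
    also have "\<delta> * mnorm N w + mnorm M x * (\<delta> * mnorm N w) = (\<delta> * (1 + mnorm M x)) * mnorm N w"
      by (simp add: algebra_simps)
    also have "\<dots> \<le> (\<delta> * (1 + mnorm M x)) * (mnorm M y * mnorm R (mul_sum u))"
      using w(2) \<delta>(1) by (intro mult_left_mono) simp_all
    also have "\<dots> = (\<delta> * B) * mnorm R (mul_sum u)" by (simp add: B_def)
    also have "\<dots> \<le> \<epsilon> * mnorm R (mul_sum u)" using \<delta>(2) by (intro mult_right_mono) simp_all
    finally show ?thesis by simp
  qed
  moreover have "norm (RR.rep L - \<alpha> x * star (\<alpha> y)) \<le> \<epsilon>"
  proof -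
    have n1: "norm (NR.rep K - \<sigma> a) \<le> \<delta>"
      using NR.psi_compacts_near[OF phi_compact N.fin_op_compact[OF K(1)] K(2)] \<delta>(1)
      by (simp add: covariant NR.psi_compacts_fin_op[OF K(1)] norm_minus_commute)
    have "\<alpha> (x \<ominus>\<^bsub>M\<^esub> ract M x a) = \<alpha> x - \<alpha> x * \<sigma> a"
      using x by (simp add: M.minus_eq MR.psi_add MR.psi_smult MR.psi_ract)
    then have n2: "norm (\<alpha> x - \<alpha> x * \<sigma> a) \<le> \<delta>" using MR.norm_psi[of "x \<ominus>\<^bsub>M\<^esub> ract M x a"] x a by simp
    have "RR.rep L - \<alpha> x * star (\<alpha> y) = \<alpha> x * (NR.rep K - \<sigma> a) * star (\<alpha> y) - (\<alpha> x - \<alpha> x * \<sigma> a) * star (\<alpha> y)"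
      unfolding L_def rep_lift[OF K(1) x y] by (simp add: algebra_simps)
    then have "norm (RR.rep L - \<alpha> x * star (\<alpha> y)) \<le>
        norm (\<alpha> x * (NR.rep K - \<sigma> a) * star (\<alpha> y)) + norm ((\<alpha> x - \<alpha> x * \<sigma> a) * star (\<alpha> y))"
      by (simp only: norm_triangle_ineq4)
    also have "\<dots> \<le> (mnorm M x * \<delta>) * mnorm M y + \<delta> * mnorm M y"
    proof (rule add_mono)
      have "norm (\<alpha> x * (NR.rep K - \<sigma> a)) \<le> mnorm M x * \<delta>"
        by (rule order_trans[OF norm_mult_ineq mult_mono]) (use n1 MR.norm_psi[OF x] in simp_all)
      then show "norm (\<alpha> x * (NR.rep K - \<sigma> a) * star (\<alpha> y)) \<le> (mnorm M x * \<delta>) * mnorm M y"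
        by (rule order_trans[OF norm_mult_ineq mult_mono]) (use MR.norm_psi[OF y] \<delta>(1) in simp_all)
      show "norm ((\<alpha> x - \<alpha> x * \<sigma> a) * star (\<alpha> y)) \<le> \<delta> * mnorm M y"
        by (rule order_trans[OF norm_mult_ineq mult_mono]) (use n2 MR.norm_psi[OF y] \<delta>(1) in simp_all)
    qed
    also have "\<dots> = \<delta> * B" by (simp add: B_def algebra_simps)
    finally show ?thesis using \<delta>(2) by linarith
  qed
  ultimately show ?thesis using L by blast
qed

lemma fin_op_approx:
  assumes "L \<in> pairs M"
  shows "\<epsilon> > 0 \<Longrightarrow> \<exists>K\<in>pairs R. (\<forall>u\<in>formals M N. mnorm R (mul_sum (act (fin_op M L) u) \<ominus>\<^bsub>R\<^esub> fin_op R K (mul_sum u)) \<le> \<epsilon> * mnorm R (mul_sum u)) \<and>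
    norm (RR.rep K - MR.rep L) \<le> \<epsilon>"
  using assms
proof (induction L arbitrary: \<epsilon>)
  case Nil
  have "mnorm R (mul_sum (act (fin_op M []) u) \<ominus>\<^bsub>R\<^esub> fin_op R [] (mul_sum u)) = 0" if u: "u \<in> formals M N" for u
  proof -
    have "mul_sum (act (fin_op M []) u) = \<zero>\<^bsub>R\<^esub>" using u by (induction u) (auto simp del: M.fin_op_Nil)
    then show ?thesis using u by (simp add: R.minus_eq del: R.fin_op_Nil)
  qed
  then show ?case using Nil by (intro bexI[of _ "[]"]) (simp_all del: R.fin_op_Nil M.fin_op_Nil)
next
  case (Cons p L)
  obtain x y where p: "p = (x, y)" by (cases p)
  have xy: "x \<in> carrier M" "y \<in> carrier M" "L \<in> pairs M" using Cons.prems by (simp_all add: p)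
  have \<epsilon>2: "\<epsilon> / 2 > 0" using Cons.prems by simp
  obtain K where K: "K \<in> pairs R" "norm (RR.rep K - MR.rep L) \<le> \<epsilon> / 2"
    "\<And>u. u \<in> formals M N \<Longrightarrow> mnorm R (mul_sum (act (fin_op M L) u) \<ominus>\<^bsub>R\<^esub> fin_op R K (mul_sum u)) \<le> \<epsilon> / 2 * mnorm R (mul_sum u)"
    using Cons.IH[OF \<epsilon>2 xy(3)] by blast
  obtain K' where K': "K' \<in> pairs R" "norm (RR.rep K' - \<alpha> x * star (\<alpha> y)) \<le> \<epsilon> / 2"
    "\<And>u. u \<in> formals M N \<Longrightarrow> mnorm R (mul_sum (act (rank_one M x y) u) \<ominus>\<^bsub>R\<^esub> fin_op R K' (mul_sum u)) \<le> \<epsilon> / 2 * mnorm R (mul_sum u)"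
    using rank_one_lift[OF xy(1,2) \<epsilon>2] by blast
  have r1: "rank_one M x y z \<in> carrier M" if "z \<in> carrier M" for z using that xy by (simp add: rank_one_def)
  have fc: "fin_op M L z \<in> carrier M" if "z \<in> carrier M" for z using M.fin_op_carrier[OF xy(3) that] .
  have "mnorm R (mul_sum (act (fin_op M (p # L)) u) \<ominus>\<^bsub>R\<^esub> fin_op R (K' @ K) (mul_sum u)) \<le> \<epsilon> * mnorm R (mul_sum u)" if u: "u \<in> formals M N" for u
  proof -
    have "act (fin_op M (p # L)) u = act (\<lambda>z. rank_one M x y z \<oplus>\<^bsub>M\<^esub> fin_op M L z) u"
      unfolding act_def
    proof (rule map_cong)
      fix q assume "q \<in> set u"
      then obtain z w where q: "q = (z, w)" "z \<in> carrier M" using u by (cases q) (auto simp: formals_def)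
      then show "(case q of (z, w) \<Rightarrow> (fin_op M (p # L) z, w)) = (case q of (z, w) \<Rightarrow> (rank_one M x y z \<oplus>\<^bsub>M\<^esub> fin_op M L z, w))"
        by (simp add: p rank_one_def)
    qed simp
    then have e: "mul_sum (act (fin_op M (p # L)) u) = mul_sum (act (rank_one M x y) u) \<oplus>\<^bsub>R\<^esub> mul_sum (act (fin_op M L) u)"
      using mul_sum_act_add[OF r1 fc u] by simp
    have c: "mul_sum (act (rank_one M x y) u) \<in> carrier R" "mul_sum (act (fin_op M L) u) \<in> carrier R"
      "fin_op R K (mul_sum u) \<in> carrier R" "fin_op R K' (mul_sum u) \<in> carrier R"
      using u r1 fc K K' by (simp_all add: act_closed R.fin_op_carrier)
    have "mul_sum (act (fin_op M (p # L)) u) \<ominus>\<^bsub>R\<^esub> fin_op R (K' @ K) (mul_sum u)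
      = (mul_sum (act (rank_one M x y) u) \<ominus>\<^bsub>R\<^esub> fin_op R K' (mul_sum u)) \<oplus>\<^bsub>R\<^esub> (mul_sum (act (fin_op M L) u) \<ominus>\<^bsub>R\<^esub> fin_op R K (mul_sum u))"
      unfolding e R.fin_op_append[OF K'(1) K(1) mul_sum_closed[OF u]]
      by (rule R.ip_eqI) (use c in \<open>simp_all add: R.ip_simps\<close>)
    then have "mnorm R (mul_sum (act (fin_op M (p # L)) u) \<ominus>\<^bsub>R\<^esub> fin_op R (K' @ K) (mul_sum u))
      \<le> mnorm R (mul_sum (act (rank_one M x y) u) \<ominus>\<^bsub>R\<^esub> fin_op R K' (mul_sum u)) + mnorm R (mul_sum (act (fin_op M L) u) \<ominus>\<^bsub>R\<^esub> fin_op R K (mul_sum u))"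
      using c by (simp add: R.mnorm_triangle)
    also have "\<dots> \<le> \<epsilon> / 2 * mnorm R (mul_sum u) + \<epsilon> / 2 * mnorm R (mul_sum u)" by (rule add_mono[OF K'(3)[OF u] K(3)[OF u]])
    finally show ?thesis by (simp add: algebra_simps)
  qed
  moreover have "norm (RR.rep (K' @ K) - MR.rep (p # L)) \<le> \<epsilon>"
  proof -
    have "RR.rep (K' @ K) - MR.rep (p # L) = (RR.rep K' - \<alpha> x * star (\<alpha> y)) + (RR.rep K - MR.rep L)" by (simp add: p)
    then have "norm (RR.rep (K' @ K) - MR.rep (p # L)) \<le> norm (RR.rep K' - \<alpha> x * star (\<alpha> y)) + norm (RR.rep K - MR.rep L)"
      by (simp only: norm_triangle_ineq)
    then show ?thesis using K(2) K'(2) by linarith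
  qed
  ultimately show ?case using K(1) K'(1) by (intro bexI[of _ "K' @ K"]) (simp_all del: RR.rep_simps)
qed

text \<open>\<open>S\<close> minus its finite-rank approximant is small on \<open>M\<close>, and
  \<open>mnorm_mul_sum_act\<close> keeps it small after amplification, so the finite-rank case
  suffices.\<close>

lemma compact_approx:
  assumes S: "S \<in> compacts M" and \<epsilon>: "\<epsilon> > 0"
  shows "\<exists>K\<in>pairs R. (\<forall>u\<in>formals M N. mnorm R (mul_sum (act S u) \<ominus>\<^bsub>R\<^esub> fin_op R K (mul_sum u)) \<le> \<epsilon> * mnorm R (mul_sum u)) \<and>
    norm (RR.rep K - psi_compacts M \<alpha> S) \<le> \<epsilon>"
proof -
  have \<epsilon>2: "\<epsilon> / 2 > 0" using \<epsilon> by simp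
  note Sa = compacts_adjointables[OF S]
  note Sc = adjointables_carrier[OF Sa]
  obtain L where L: "L \<in> pairs M" "op_near M S (fin_op M L) (\<epsilon> / 2)"
    using S \<epsilon>2 unfolding M.compacts_iff by blast
  note Lc = M.fin_op_carrier[OF L(1)]
  obtain K where K: "K \<in> pairs R" "norm (RR.rep K - MR.rep L) \<le> \<epsilon> / 2"
    "\<And>u. u \<in> formals M N \<Longrightarrow> mnorm R (mul_sum (act (fin_op M L) u) \<ominus>\<^bsub>R\<^esub> fin_op R K (mul_sum u)) \<le> \<epsilon> / 2 * mnorm R (mul_sum u)"
    using fin_op_approx[OF L(1) \<epsilon>2] by blast
  obtain S' where S': "S' \<in> adjointables M" "is_adjoint M S S'" using M.adjointableE[OF Sa] by blast
  define L' where "L' = map prod.swap L"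
  have L': "L' \<in> pairs M" unfolding L'_def by (rule M.pairs_swap[OF L(1)])
  have adj: "is_adjoint M (\<lambda>x. S x \<ominus>\<^bsub>M\<^esub> fin_op M L x) (\<lambda>x. S' x \<ominus>\<^bsub>M\<^esub> fin_op M L' x)"
    using S'(2) M.fin_op_swap[OF L(1)] Sc Lc adjointables_carrier[OF S'(1)] M.fin_op_carrier[OF L']
    by (simp add: is_adjoint_def M.ip_diff M.ip_diff_left L'_def)
  have "mnorm R (mul_sum (act S u) \<ominus>\<^bsub>R\<^esub> fin_op R K (mul_sum u)) \<le> \<epsilon> * mnorm R (mul_sum u)" if u: "u \<in> formals M N" for u
  proof -
    have c: "mul_sum (act S u) \<in> carrier R" "mul_sum (act (fin_op M L) u) \<in> carrier R" "fin_op R K (mul_sum u) \<in> carrier R"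
      using u Sc Lc K(1) by (simp_all add: act_closed R.fin_op_carrier)
    have "mnorm R (mul_sum (act (\<lambda>x. S x \<ominus>\<^bsub>M\<^esub> fin_op M L x) u)) \<le> \<epsilon> / 2 * mnorm R (mul_sum u)"
    proof (rule mnorm_mul_sum_act[OF _ _ adj _ _ u])
      show "op_bound M (\<lambda>x. S x \<ominus>\<^bsub>M\<^esub> fin_op M L x) (\<epsilon> / 2)" using L(2) by (simp add: op_near_def op_bound_def)
    qed (use \<epsilon> Sc Lc adjointables_carrier[OF S'(1)] M.fin_op_carrier[OF L'] in simp_all)
    then have "mnorm R (mul_sum (act S u) \<ominus>\<^bsub>R\<^esub> mul_sum (act (fin_op M L) u)) \<le> \<epsilon> / 2 * mnorm R (mul_sum u)"
      by (simp only: mul_sum_act_diff[OF Sc Lc u])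
    then show ?thesis using R.mnorm_minus_triangle[OF c] K(3)[OF u] by linarith
  qed
  moreover have "norm (RR.rep K - psi_compacts M \<alpha> S) \<le> \<epsilon>"
  proof -
    have "norm (psi_compacts M \<alpha> S - MR.rep L) \<le> \<epsilon> / 2"
      using MR.psi_compacts_near[OF S M.fin_op_compact[OF L(1)] L(2)] \<epsilon>2 by (simp add: MR.psi_compacts_fin_op[OF L(1)])
    then show ?thesis using K(2) norm_triangle_ineq4[of "RR.rep K - MR.rep L" "psi_compacts M \<alpha> S - MR.rep L"] by simp
  qed
  ultimately show ?thesis using K(1) by blast
qed

text \<open>Compact operators are bounded, so an estimate on the dense set of sums of products
  extends to all of \<open>R\<close>; \<open>d\<close> is small against both bounds and
  \<open>k\<close>.\<close>

lemma dense_near: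
  assumes S: "S \<in> compacts R" and T: "T \<in> compacts R" and k: "k \<ge> 0"
    and near: "\<And>u. u \<in> formals M N \<Longrightarrow> mnorm R (S (mul_sum u) \<ominus>\<^bsub>R\<^esub> T (mul_sum u)) \<le> k * mnorm R (mul_sum u)"
  shows "op_near R S T k"
  unfolding op_near_def
proof
  note Sa = compacts_adjointables[OF S] and Ta = compacts_adjointables[OF T]
  note Sc = adjointables_carrier[OF Sa] and Tc = adjointables_carrier[OF Ta]
  fix z assume z: "z \<in> carrier R"
  obtain a where a: "a \<ge> 0" "op_bound R S a" using R.compact_bounded[OF S] by blast
  obtain b where b: "b \<ge> 0" "op_bound R T b" using R.compact_bounded[OF T] by blast
  show "mnorm R (S z \<ominus>\<^bsub>R\<^esub> T z) \<le> k * mnorm R z"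
  proof (rule field_le_epsilon)
    fix e :: real assume e: "e > 0"
    define d where "d = e / (a + b + k + 1)"
    have s: "a + b + k + 1 > 0" using a b k by linarith
    have d: "d > 0" "(a + b + k) * d \<le> e" using e s by (simp_all add: d_def field_simps)
    obtain u where u: "u \<in> formals M N" "mnorm R (z \<ominus>\<^bsub>R\<^esub> mul_sum u) \<le> d" using dense[OF z d(1)] by blast
    define w where "w = mul_sum u"
    have w: "w \<in> carrier R" using u by (simp add: w_def)
    have zw: "mnorm R (w \<ominus>\<^bsub>R\<^esub> z) \<le> d" "mnorm R (z \<ominus>\<^bsub>R\<^esub> w) \<le> d"
      using u(2) R.mnorm_minus_commute[OF z w] by (simp_all add: w_def)
    have "mnorm R (S (z \<ominus>\<^bsub>R\<^esub> w)) \<le> a * mnorm R (z \<ominus>\<^bsub>R\<^esub> w)" using a(2) z w by (simp add: op_bound_def)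
    also have "\<dots> \<le> a * d" by (rule mult_left_mono[OF zw(2) a(1)])
    finally have 1: "mnorm R (S z \<ominus>\<^bsub>R\<^esub> S w) \<le> a * d" by (simp only: R.adjoint_minus[OF Sa z w])
    have "mnorm R (T (w \<ominus>\<^bsub>R\<^esub> z)) \<le> b * mnorm R (w \<ominus>\<^bsub>R\<^esub> z)" using b(2) z w by (simp add: op_bound_def)
    also have "\<dots> \<le> b * d" by (rule mult_left_mono[OF zw(1) b(1)])
    finally have 2: "mnorm R (T w \<ominus>\<^bsub>R\<^esub> T z) \<le> b * d" by (simp only: R.adjoint_minus[OF Ta w z])
    have "mnorm R w \<le> d + mnorm R z" using R.mnorm_le_diff[OF w z] zw(1) by linarith
    then have "k * mnorm R w \<le> k * (d + mnorm R z)" using k by (rule mult_left_mono)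
    then have 3: "mnorm R (S w \<ominus>\<^bsub>R\<^esub> T w) \<le> k * (d + mnorm R z)" using near[OF u(1)] unfolding w_def[symmetric] by linarith
    have "mnorm R (S z \<ominus>\<^bsub>R\<^esub> T z) \<le> mnorm R (S z \<ominus>\<^bsub>R\<^esub> S w) + mnorm R (S w \<ominus>\<^bsub>R\<^esub> T z)"
      using R.mnorm_minus_triangle[OF Sc[OF z] Sc[OF w] Tc[OF z]] .
    also have "mnorm R (S w \<ominus>\<^bsub>R\<^esub> T z) \<le> mnorm R (S w \<ominus>\<^bsub>R\<^esub> T w) + mnorm R (T w \<ominus>\<^bsub>R\<^esub> T z)"
      using R.mnorm_minus_triangle[OF Sc[OF w] Tc[OF w] Tc[OF z]] .
    finally have "mnorm R (S z \<ominus>\<^bsub>R\<^esub> T z) \<le> a * d + (k * (d + mnorm R z) + b * d)" using 1 2 3 by linarith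
    also have "\<dots> = k * mnorm R z + (a + b + k) * d" by (simp add: algebra_simps)
    finally show "mnorm R (S z \<ominus>\<^bsub>R\<^esub> T z) \<le> k * mnorm R z + e" using d(2) by linarith
  qed
qed

text \<open>The finite-rank operators of the lists \<open>K n\<close> approximate S \<otimes> 1 on
  the same dense set, so they form a Cauchy sequence on \<open>R\<close>. Their limit exists by
  \<open>compacts_complete\<close>, which supplies the adjoint and compactness together.\<close>

lemma lift_compact:
  assumes S: "S \<in> compacts M"
  shows "\<exists>T\<in>compacts R. (\<forall>x\<in>carrier M. \<forall>y\<in>carrier N. T (mul x y) = mul (S x) y) \<and>
    psi_compacts R \<gamma> T = psi_compacts M \<alpha> S"
proof -
  note Sc = adjointables_carrier[OF compacts_adjointables[OF S]]
  define e where "e n = 1 / real (Suc n)" for n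
  have e0: "e n > 0" for n by (simp add: e_def)
  have elim: "\<exists>N. \<forall>n\<ge>N. e n < d" if "d > 0" for d
    using order_tendstoD(2)[OF LIMSEQ_Suc[OF lim_inverse_n'] that] unfolding e_def eventually_sequentially .
  have "\<exists>K. K \<in> pairs R \<and> (\<forall>u\<in>formals M N. mnorm R (mul_sum (act S u) \<ominus>\<^bsub>R\<^esub> fin_op R K (mul_sum u)) \<le> e n * mnorm R (mul_sum u)) \<and>
    norm (RR.rep K - psi_compacts M \<alpha> S) \<le> e n" for n
    using compact_approx[OF S e0[of n]] by blast
  then obtain K where K: "\<And>n. K n \<in> pairs R" "\<And>n. norm (RR.rep (K n) - psi_compacts M \<alpha> S) \<le> e n"
    "\<And>n u. u \<in> formals M N \<Longrightarrow> mnorm R (mul_sum (act S u) \<ominus>\<^bsub>R\<^esub> fin_op R (K n) (mul_sum u)) \<le> e n * mnorm R (mul_sum u)"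
    by metis
  note Kc = R.fin_op_compact[OF K(1)]
  have near: "op_near R (fin_op R (K m)) (fin_op R (K n)) (e m + e n)" for m n
  proof (rule dense_near[OF Kc Kc])
    show "e m + e n \<ge> 0" using e0[of m] e0[of n] by linarith
    fix u assume u: "u \<in> formals M N"
    have c: "mul_sum (act S u) \<in> carrier R" "fin_op R (K i) (mul_sum u) \<in> carrier R" for i
      using u K(1) Sc by (simp_all add: act_closed R.fin_op_carrier)
    show "mnorm R (fin_op R (K m) (mul_sum u) \<ominus>\<^bsub>R\<^esub> fin_op R (K n) (mul_sum u)) \<le> (e m + e n) * mnorm R (mul_sum u)"
      using R.mnorm_minus_triangle[OF c(2)[of m] c(1) c(2)[of n]] R.mnorm_minus_commute[OF c(2)[of m] c(1)] K(3)[OF u, of m] K(3)[OF u, of n]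
      unfolding distrib_right by linarith
  qed
  have cau: "\<exists>N. \<forall>m\<ge>N. \<forall>n\<ge>N. op_near R (fin_op R (K m)) (fin_op R (K n)) d" if d: "d > 0" for d
  proof -
    obtain N where N: "\<And>n. n \<ge> N \<Longrightarrow> e n < d / 2" using elim[of "d / 2"] d by auto
    have "op_near R (fin_op R (K m)) (fin_op R (K n)) d" if "m \<ge> N" "n \<ge> N" for m n
      unfolding op_near_def
    proof
      fix x assume "x \<in> carrier R"
      then have "mnorm R (fin_op R (K m) x \<ominus>\<^bsub>R\<^esub> fin_op R (K n) x) \<le> (e m + e n) * mnorm R x"
        using near[of m n] by (simp add: op_near_def)
      also have "\<dots> \<le> d * mnorm R x" by (rule mult_right_mono) (use N[OF that(1)] N[OF that(2)] in simp_all)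
      finally show "mnorm R (fin_op R (K m) x \<ominus>\<^bsub>R\<^esub> fin_op R (K n) x) \<le> d * mnorm R x" .
    qed
    then show ?thesis by blast
  qed
  obtain T where T: "T \<in> compacts R" and lim: "\<And>d. d > 0 \<Longrightarrow> \<exists>N. \<forall>n\<ge>N. op_near R T (fin_op R (K n)) d"
    using R.compacts_complete[OF Kc cau] by blast
  note Tc = adjointables_carrier[OF compacts_adjointables[OF T]]
  have close: "\<exists>n. e n < d \<and> op_near R T (fin_op R (K n)) d" if d: "d > 0" for d
  proof -
    obtain N N' where "\<forall>n\<ge>N. e n < d" "\<forall>n\<ge>N'. op_near R T (fin_op R (K n)) d" using elim[OF d] lim[OF d] by auto
    then show ?thesis by (intro exI[of _ "max N N'"]) simp
  qed
  have TF: "T (mul_sum u) = mul_sum (act S u)" if u: "u \<in> formals M N" for u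
  proof -
    define c where "c = mnorm R (mul_sum u)"
    have c0: "c \<ge> 0" by (simp add: c_def)
    have "mnorm R (T (mul_sum u) \<ominus>\<^bsub>R\<^esub> mul_sum (act S u)) \<le> 0 + d" if d: "d > 0" for d
    proof -
      define \<delta> where "\<delta> = d / (2 * c + 1)"
      have \<delta>: "\<delta> > 0" "2 * (\<delta> * c) \<le> d" using d c0 by (simp_all add: \<delta>_def field_simps)
      obtain n where n: "e n < \<delta>" "op_near R T (fin_op R (K n)) \<delta>" using close[OF \<delta>(1)] by blast
      have cc: "T (mul_sum u) \<in> carrier R" "fin_op R (K n) (mul_sum u) \<in> carrier R" "mul_sum (act S u) \<in> carrier R"
        using u K(1) Sc Tc by (simp_all add: act_closed R.fin_op_carrier)
      have 1: "mnorm R (T (mul_sum u) \<ominus>\<^bsub>R\<^esub> fin_op R (K n) (mul_sum u)) \<le> \<delta> * c"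
        using n(2) u by (simp add: op_near_def c_def)
      have "mnorm R (mul_sum (act S u) \<ominus>\<^bsub>R\<^esub> fin_op R (K n) (mul_sum u)) \<le> e n * c" using K(3)[OF u] by (simp add: c_def)
      also have "\<dots> \<le> \<delta> * c" using n(1) c0 by (intro mult_right_mono) simp_all
      finally have 2: "mnorm R (fin_op R (K n) (mul_sum u) \<ominus>\<^bsub>R\<^esub> mul_sum (act S u)) \<le> \<delta> * c"
        using R.mnorm_minus_commute[OF cc(2,3)] by simp
      show ?thesis using R.mnorm_minus_triangle[OF cc] 1 2 \<delta>(2) by linarith
    qed
    then have "mnorm R (T (mul_sum u) \<ominus>\<^bsub>R\<^esub> mul_sum (act S u)) \<le> 0" by (rule field_le_epsilon)
    then have "mnorm R (T (mul_sum u) \<ominus>\<^bsub>R\<^esub> mul_sum (act S u)) = 0" using mnorm_nonneg by (rule antisym)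
    then show ?thesis
      using R.mnorm_eq_0_iff[of "T (mul_sum u) \<ominus>\<^bsub>R\<^esub> mul_sum (act S u)"] R.diff_eq_zero_iff[of "T (mul_sum u)" "mul_sum (act S u)"] u Tc Sc
      by (simp add: act_closed)
  qed
  have "T (mul x y) = mul (S x) y" if "x \<in> carrier M" "y \<in> carrier N" for x y
    using TF[of "[(x, y)]"] that Sc by simp
  moreover have "psi_compacts R \<gamma> T = psi_compacts M \<alpha> S"
  proof -
    have "norm (psi_compacts R \<gamma> T - psi_compacts M \<alpha> S) \<le> 0 + d" if d: "d > 0" for d
    proof -
      have d2: "d / 2 > 0" using d by simp
      obtain n where n: "e n < d / 2" "op_near R T (fin_op R (K n)) (d / 2)" using close[OF d2] by blast
      have "norm (psi_compacts R \<gamma> T - RR.rep (K n)) \<le> d / 2"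
        using RR.psi_compacts_near[OF T Kc n(2)] d2 by (simp add: RR.psi_compacts_fin_op[OF K(1)])
      then show ?thesis
        using K(2)[of n] n(1) norm_triangle_ineq[of "psi_compacts R \<gamma> T - RR.rep (K n)" "RR.rep (K n) - psi_compacts M \<alpha> S"]
        by simp
    qed
    then have "norm (psi_compacts R \<gamma> T - psi_compacts M \<alpha> S) \<le> 0" by (rule field_le_epsilon)
    then show ?thesis by simp
  qed
  ultimately show ?thesis using T by blast
qed

end


section \<open>Product systems\<close>

lemma algebra_bimodule_simps:
  "carrier algebra_bimodule = UNIV" "a \<oplus>\<^bsub>algebra_bimodule\<^esub> b = a + b" "c \<odot>\<^bsub>algebra_bimodule\<^esub> a = c *\<^sub>C a"
  "ract algebra_bimodule a b = a * b" "lact algebra_bimodule a b = a * b" "ip algebra_bimodule a b = star a * b"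
  by (simp_all add: algebra_bimodule_def)

text \<open>Turns the pointwise sum occurring in (CP) into one compact operator, to which the
  homomorphism can be applied.\<close>

lemma (in right_hilbert_module) compacts_finsum:
  fixes f :: "_ \<Rightarrow> 'e::cstar_algebra"
  assumes f: "compacts_hom M f" and "finite F" and "\<And>p. p \<in> F \<Longrightarrow> A p \<in> compacts M"
  shows "\<exists>U\<in>compacts M. (\<forall>z\<in>carrier M. U z = finsum M (\<lambda>p. A p z) F) \<and> f U = (\<Sum>p\<in>F. f (A p))"
  using assms(2,3)
proof (induction F)
  case empty
  have c: "op_zero M \<in> compacts M" using fin_op_compact[of "[]"] by simp
  moreover have "\<forall>x\<in>carrier M. mnorm M (op_zero M x) \<le> 0 * mnorm M x" by (simp add: op_zero_def)
  ultimately have "norm (f (op_zero M)) \<le> 0" using f unfolding compacts_hom_def by blast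
  then have "f (op_zero M) = (\<Sum>p\<in>{}. f (A p))" by simp
  moreover have "\<forall>z\<in>carrier M. op_zero M z = finsum M (\<lambda>p. A p z) {}" by (simp add: op_zero_def)
  ultimately show ?case using c by blast
next
  case (insert p F)
  obtain U where U: "U \<in> compacts M" "\<And>z. z \<in> carrier M \<Longrightarrow> U z = finsum M (\<lambda>p. A p z) F" "f U = (\<Sum>p\<in>F. f (A p))"
    using insert.IH insert.prems by auto
  have Ap: "A p \<in> compacts M" using insert.prems by simp
  have Ac: "A q z \<in> carrier M" if "q \<in> insert p F" "z \<in> carrier M" for q z
    by (rule adjointables_carrier[OF compacts_adjointables[OF insert.prems[OF that(1)]] that(2)])
  have "op_add M (A p) U z = finsum M (\<lambda>p. A p z) (insert p F)" if z: "z \<in> carrier M" for z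
    using z insert.hyps Ac U(2) by (simp add: op_add_def Pi_def)
  moreover have "f (op_add M (A p) U) = f (A p) + f U" using f Ap U(1) unfolding compacts_hom_def by blast
  ultimately show ?case
    using op_add_compact[OF Ap U(1)] insert.hyps U(3) by (intro bexI[of _ "op_add M (A p) U"]) simp_all
qed

section \<open>The order and the fibres of a represented product system\<close>

locale represented_product_system =
  fixes P :: "'g::group_add set" and \<X> :: "('g, 'a::cstar_algebra, 'x) prodsys" and \<psi> :: "'x \<Rightarrow> 'b::cstar_algebra"
  assumes ql: "quasi_lattice_ordered P" and ps: "product_system P \<X>"
    and inj_phi: "\<forall>p\<in>P. inj (phi (fibre \<X> p))"
    and phi_compacts: "\<forall>p\<in>P. range (phi (fibre \<X> p)) \<subseteq> compacts (fibre \<X> p)"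
    and rep: "ps_representation P \<X> \<psi>"
begin

lemma zero_P [simp]: "0 \<in> P"
  using ql unfolding quasi_lattice_ordered_def by blast

lemma add_P: "p \<in> P \<Longrightarrow> q \<in> P \<Longrightarrow> p + q \<in> P"
  using ql unfolding quasi_lattice_ordered_def by blast

lemma qle_refl [simp]: "qle P p p"
  by (simp add: qle_def)

lemma qle_0 [simp]: "qle P 0 p \<longleftrightarrow> p \<in> P"
  by (simp add: qle_def)

lemma qle_trans: "qle P p q \<Longrightarrow> qle P q r \<Longrightarrow> qle P p r"
  using add_P[of "- p + q" "- q + r"] by (simp add: qle_def add.assoc)

lemma qle_antisym:
  assumes "qle P p q" "qle P q p" shows "p = q"
proof -
  have "- p + q \<in> P" "- (- p + q) \<in> P" using assms by (simp_all add: qle_def minus_add)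
  then have "- p + q \<in> P \<inter> uminus ` P" by (metis IntI image_eqI minus_minus)
  then have "- p + q = 0" using ql unfolding quasi_lattice_ordered_def by blast
  then show ?thesis by (metis add.right_neutral add_minus_cancel)
qed

lemma least_ub_eq: assumes "is_least_ub P p q r" shows "least_ub P p q = r"
  unfolding least_ub_def using assms by (rule the_equality) (use assms qle_antisym in \<open>auto simp: is_least_ub_def\<close>)

lemma bim: "p \<in> P \<Longrightarrow> right_hilbert_bimodule (fibre \<X> p)"
  using ps[unfolded product_system_def, THEN conjunct1] by blast

lemma hmod: "p \<in> P \<Longrightarrow> right_hilbert_module (fibre \<X> p)"
  by (rule right_hilbert_bimodule.axioms(1)[OF bim])

lemma pmult_closed: "p \<in> P \<Longrightarrow> q \<in> P \<Longrightarrow> x \<in> carrier (fibre \<X> p) \<Longrightarrow> y \<in> carrier (fibre \<X> q) \<Longrightarrow>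
    pmult \<X> x y \<in> carrier (fibre \<X> (p + q))"
  using ps[unfolded product_system_def, THEN conjunct2, THEN conjunct2, THEN conjunct1] by blast

lemma pmult_assoc: "p \<in> P \<Longrightarrow> q \<in> P \<Longrightarrow> r \<in> P \<Longrightarrow> x \<in> carrier (fibre \<X> p) \<Longrightarrow> y \<in> carrier (fibre \<X> q) \<Longrightarrow>
    z \<in> carrier (fibre \<X> r) \<Longrightarrow> pmult \<X> (pmult \<X> x y) z = pmult \<X> x (pmult \<X> y z)"
  using ps[unfolded product_system_def, THEN conjunct2, THEN conjunct2, THEN conjunct2, THEN conjunct1] by blast

lemma emb_iso: "bimodule_iso algebra_bimodule (fibre \<X> 0) (emb \<X>)"
  using ps[unfolded product_system_def, THEN conjunct2, THEN conjunct2, THEN conjunct2, THEN conjunct2, THEN conjunct1] .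

lemma tensor_isoE:
  assumes "p \<in> P" "q \<in> P" "p \<noteq> 0" "q \<noteq> 0"
  obtains f where "tensor_iso (fibre \<X> p) (fibre \<X> q) (fibre \<X> (p + q)) f (pmult \<X>)"
proof -
  obtain f where "bimodule_iso (tensor_product (fibre \<X> p) (fibre \<X> q)) (fibre \<X> (p + q)) f"
    "\<forall>x\<in>carrier (fibre \<X> p). \<forall>y\<in>carrier (fibre \<X> q). f (simple_tensor (fibre \<X> p) (fibre \<X> q) x y) = pmult \<X> x y"
    using ps[unfolded product_system_def, THEN conjunct2, THEN conjunct2, THEN conjunct2, THEN conjunct2, THEN conjunct2,
        THEN conjunct1] assms by blast
  then show thesis
    using assms bim add_P
    by (intro that[of f] tensor_iso.intro bimodule_pair.intro tensor_iso_axioms.intro) simp_all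
qed

lemma pmult_emb:
  "p \<in> P \<Longrightarrow> x \<in> carrier (fibre \<X> p) \<Longrightarrow> pmult \<X> (emb \<X> a) x = lact (fibre \<X> p) a x"
  "p \<in> P \<Longrightarrow> x \<in> carrier (fibre \<X> p) \<Longrightarrow> pmult \<X> x (emb \<X> a) = ract (fibre \<X> p) x a"
  using ps[unfolded product_system_def, THEN conjunct2, THEN conjunct2, THEN conjunct2, THEN conjunct2, THEN conjunct2,
      THEN conjunct2] by blast+

lemma emb_bij: "bij_betw (emb \<X>) UNIV (carrier (fibre \<X> 0))"
  using emb_iso by (simp add: bimodule_iso_def algebra_bimodule_simps)

lemma emb_carrier [simp]: "emb \<X> a \<in> carrier (fibre \<X> 0)"
  using emb_bij by (auto simp: bij_betw_def)

lemma emb_cases: assumes "z \<in> carrier (fibre \<X> 0)" obtains a where "z = emb \<X> a"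
  using emb_bij assms by (auto simp: bij_betw_def)

lemma emb_simps:
  "emb \<X> (a + b) = emb \<X> a \<oplus>\<^bsub>fibre \<X> 0\<^esub> emb \<X> b" "emb \<X> (c *\<^sub>C a) = c \<odot>\<^bsub>fibre \<X> 0\<^esub> emb \<X> a"
  "ract (fibre \<X> 0) (emb \<X> a) b = emb \<X> (a * b)" "lact (fibre \<X> 0) a (emb \<X> b) = emb \<X> (a * b)"
  "ip (fibre \<X> 0) (emb \<X> a) (emb \<X> b) = star a * b"
  using emb_iso unfolding bimodule_iso_def algebra_bimodule_simps by (metis UNIV_I)+

lemma mnorm_emb: "mnorm (fibre \<X> 0) (emb \<X> a) = norm a"
  by (simp add: mnorm_def emb_simps cstar_identity)

lemma psi_mult: "p \<in> P \<Longrightarrow> q \<in> P \<Longrightarrow> x \<in> carrier (fibre \<X> p) \<Longrightarrow> y \<in> carrier (fibre \<X> q) \<Longrightarrow> \<psi> (pmult \<X> x y) = \<psi> x * \<psi> y"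
  using rep unfolding ps_representation_def by blast

lemma psi_add: "p \<in> P \<Longrightarrow> x \<in> carrier (fibre \<X> p) \<Longrightarrow> y \<in> carrier (fibre \<X> p) \<Longrightarrow> \<psi> (x \<oplus>\<^bsub>fibre \<X> p\<^esub> y) = \<psi> x + \<psi> y"
  using rep unfolding ps_representation_def by blast

lemma psi_smult: "p \<in> P \<Longrightarrow> x \<in> carrier (fibre \<X> p) \<Longrightarrow> \<psi> (c \<odot>\<^bsub>fibre \<X> p\<^esub> x) = c *\<^sub>C \<psi> x"
  using rep unfolding ps_representation_def by blast

lemma psi_emb_mult: "\<psi> (emb \<X> (a * b)) = \<psi> (emb \<X> a) * \<psi> (emb \<X> b)"
  using rep unfolding ps_representation_def by blast

lemma psi_emb_star: "\<psi> (emb \<X> (star a)) = star (\<psi> (emb \<X> a))"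
  using rep unfolding ps_representation_def by blast

lemma psi_emb_add: "\<psi> (emb \<X> (a + b)) = \<psi> (emb \<X> a) + \<psi> (emb \<X> b)"
  by (simp add: emb_simps(1) psi_add[OF zero_P])

lemma psi_emb_scaleC: "\<psi> (emb \<X> (c *\<^sub>C a)) = c *\<^sub>C \<psi> (emb \<X> a)"
  by (simp add: emb_simps(2) psi_smult[OF zero_P])

lemma psi_emb_contractive: "norm (\<psi> (emb \<X> a)) \<le> norm a"
  by (rule star_hom_contractive[of "\<lambda>a. \<psi> (emb \<X> a)"])
    (rule psi_emb_add psi_emb_scaleC psi_emb_mult psi_emb_star)+

lemma module_rep_fibre: assumes p: "p \<in> P" shows "module_rep (fibre \<X> p) (\<lambda>a. \<psi> (emb \<X> a)) \<psi>"
proof (intro module_rep.intro module_rep_axioms.intro)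
  show "right_hilbert_module (fibre \<X> p)" by (rule hmod[OF p])
  fix x y assume x: "x \<in> carrier (fibre \<X> p)" and y: "y \<in> carrier (fibre \<X> p)"
  show "\<psi> (x \<oplus>\<^bsub>fibre \<X> p\<^esub> y) = \<psi> x + \<psi> y" using p x y by (rule psi_add)
  show "\<psi> (emb \<X> (ip (fibre \<X> p) x y)) = star (\<psi> x) * \<psi> y"
    using rep p x y unfolding ps_representation_def by blast
next
  fix x a assume x: "x \<in> carrier (fibre \<X> p)"
  show "\<psi> (c \<odot>\<^bsub>fibre \<X> p\<^esub> x) = c *\<^sub>C \<psi> x" for c using p x by (rule psi_smult)
  show "\<psi> (ract (fibre \<X> p) x a) = \<psi> x * \<psi> (emb \<X> a)"
    using psi_mult[OF p zero_P x emb_carrier, of a] by (simp add: pmult_emb(2)[OF p x])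
qed (rule psi_emb_contractive)

text \<open>The tensor isomorphism is given only for \<open>p\<close> and \<open>q\<close> different
  from the identity; with an identity factor the formula is that for the left or right action of
  A.\<close>

lemma ip_pmult:
  assumes p: "p \<in> P" and q: "q \<in> P"
    and x: "x \<in> carrier (fibre \<X> p)" "x' \<in> carrier (fibre \<X> p)" and y: "y \<in> carrier (fibre \<X> q)" "y' \<in> carrier (fibre \<X> q)"
  shows "ip (fibre \<X> (p + q)) (pmult \<X> x y) (pmult \<X> x' y') = ip (fibre \<X> q) y (lact (fibre \<X> q) (ip (fibre \<X> p) x x') y')"
proof -
  interpret M: right_hilbert_bimodule "fibre \<X> p" by (rule bim[OF p])
  interpret N: right_hilbert_bimodule "fibre \<X> q" by (rule bim[OF q])
  consider "p = 0" | "q = 0" | "p \<noteq> 0" "q \<noteq> 0" by blast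
  then show ?thesis
  proof cases
    case 1
    obtain a b where "x = emb \<X> a" "x' = emb \<X> b" using x 1 emb_cases by metis
    then show ?thesis using 1 y by (simp add: pmult_emb(1)[OF q] emb_simps N.lact_adjoint N.lact_mult)
  next
    case 2
    obtain a b where "y = emb \<X> a" "y' = emb \<X> b" using y 2 emb_cases by metis
    then show ?thesis using 2 x by (simp add: pmult_emb(2)[OF p] emb_simps M.ip_simps mult.assoc)
  next
    case 3
    obtain f where "tensor_iso (fibre \<X> p) (fibre \<X> q) (fibre \<X> (p + q)) f (pmult \<X>)"
      using tensor_isoE[OF p q 3] by blast
    then interpret T: tensor_iso "fibre \<X> p" "fibre \<X> q" "fibre \<X> (p + q)" f "pmult \<X>" .
    have "pmult \<X> x y \<in> carrier (fibre \<X> (p + q))" "pmult \<X> x' y' \<in> carrier (fibre \<X> (p + q))"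
      using pmult_closed[OF p q] x y by simp_all
    then show ?thesis using T.ip_F[of "[(x, y)]" "[(x', y')]"] x y by (simp add: formal_ip_single)
  qed
qed

lemma hilbert_product_fibre:
  assumes p: "p \<in> P" and q: "q \<in> P"
  shows "hilbert_product (fibre \<X> p) (fibre \<X> q) (fibre \<X> (p + q)) (pmult \<X>)"
proof (intro hilbert_product.intro bimodule_pair.intro hilbert_product_axioms.intro)
  show "right_hilbert_bimodule (fibre \<X> p)" "right_hilbert_bimodule (fibre \<X> q)" "right_hilbert_bimodule (fibre \<X> (p + q))"
    using bim p q add_P by simp_all
  fix x y a assume x: "x \<in> carrier (fibre \<X> p)" and y: "y \<in> carrier (fibre \<X> q)"
  show xy: "pmult \<X> x y \<in> carrier (fibre \<X> (p + q))" by (rule pmult_closed[OF p q x y])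
  show "pmult \<X> (ract (fibre \<X> p) x a) y = pmult \<X> x (lact (fibre \<X> q) a y)"
    using pmult_assoc[OF p zero_P q x emb_carrier y, of a] by (simp add: pmult_emb(2)[OF p x] pmult_emb(1)[OF q y])
  show "pmult \<X> x (ract (fibre \<X> q) y a) = ract (fibre \<X> (p + q)) (pmult \<X> x y) a"
    using pmult_assoc[OF p q zero_P x y emb_carrier, of a] by (simp add: pmult_emb(2)[OF q y] pmult_emb(2)[OF add_P[OF p q] xy])
  fix x' y' assume "x' \<in> carrier (fibre \<X> p)" "y' \<in> carrier (fibre \<X> q)"
  then show "ip (fibre \<X> (p + q)) (pmult \<X> x y) (pmult \<X> x' y') = ip (fibre \<X> q) y (lact (fibre \<X> q) (ip (fibre \<X> p) x x') y')"
    using ip_pmult[OF p q] x y by blast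
qed

text \<open>For q = e a vector \<open>z\<close> is approximated by z a, which is a product. The case
  p = e is left out, as the left action of A may be degenerate.\<close>

lemma pmult_dense:
  assumes p: "p \<in> P" "p \<noteq> 0" and q: "q \<in> P" and z: "z \<in> carrier (fibre \<X> (p + q))" and \<epsilon>: "\<epsilon> > 0"
  shows "\<exists>u\<in>formals (fibre \<X> p) (fibre \<X> q).
    mnorm (fibre \<X> (p + q)) (z \<ominus>\<^bsub>fibre \<X> (p + q)\<^esub> lsum (fibre \<X> (p + q)) (map (\<lambda>(x, y). pmult \<X> x y) u)) \<le> \<epsilon>"
proof (cases "q = 0")
  case True
  interpret M: right_hilbert_bimodule "fibre \<X> p" by (rule bim[OF p(1)])
  have z': "z \<in> carrier (fibre \<X> p)" using z True by simp
  obtain a where "mnorm (fibre \<X> p) (z \<ominus>\<^bsub>fibre \<X> p\<^esub> ract (fibre \<X> p) z a) \<le> \<epsilon>" using M.ract_approx[OF z' \<epsilon>] by blast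
  then show ?thesis
    using True z' p by (intro bexI[of _ "[(z, emb \<X> a)]"]) (simp_all add: pmult_emb(2)[OF p(1) z'])
next
  case False
  obtain f where "tensor_iso (fibre \<X> p) (fibre \<X> q) (fibre \<X> (p + q)) f (pmult \<X>)"
    using tensor_isoE[OF p(1) q p(2) False] by blast
  then interpret T: tensor_iso "fibre \<X> p" "fibre \<X> q" "fibre \<X> (p + q)" f "pmult \<X>" .
  show ?thesis by (rule T.F_dense[OF z \<epsilon>])
qed

text \<open>\<open>iota\<close> is a definite description, so this amounts to uniqueness of
  adjointable operators with given values on products. No bound on such operators is at hand;
  instead their adjoints are compared, by pairing the difference of the values with a dense set of
  vectors.\<close>

lemma iota_eqI:
  assumes p: "p \<in> P" "p \<noteq> 0" and q: "q \<in> P" and T: "T \<in> adjointables (fibre \<X> (p + q))"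
    and TS: "\<And>x y. x \<in> carrier (fibre \<X> p) \<Longrightarrow> y \<in> carrier (fibre \<X> q) \<Longrightarrow> T (pmult \<X> x y) = pmult \<X> (S x) y"
  shows "iota P \<X> p (p + q) S = T"
proof -
  let ?R = "fibre \<X> (p + q)"
  interpret R: right_hilbert_module ?R by (rule hmod[OF add_P[OF p(1) q]])
  have uniq: "T' = T" if T': "T' \<in> adjointables ?R"
    and TS': "\<And>x y. x \<in> carrier (fibre \<X> p) \<Longrightarrow> y \<in> carrier (fibre \<X> q) \<Longrightarrow> T' (pmult \<X> x y) = pmult \<X> (S x) y" for T'
  proof -
    obtain A where A: "A \<in> adjointables ?R" "is_adjoint ?R A T" using R.adjointableE[OF T] by blast
    obtain A' where A': "A' \<in> adjointables ?R" "is_adjoint ?R A' T'" using R.adjointableE[OF T'] by blast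
    have "A w = A' w" if w: "w \<in> carrier ?R" for w
    proof -
      have c: "A w \<in> carrier ?R" "A' w \<in> carrier ?R" using A A' w by (auto intro: adjointables_carrier)
      define d where "d = A w \<ominus>\<^bsub>?R\<^esub> A' w"
      have d: "d \<in> carrier ?R" using c by (simp add: d_def)
      have "norm (ip ?R d d) \<le> 0 + e" if e: "e > 0" for e
      proof -
        define \<delta> where "\<delta> = e / (mnorm ?R d + 1)"
        have m: "mnorm ?R d + 1 > 0" by (simp add: add_nonneg_pos)
        have \<delta>: "\<delta> > 0" "mnorm ?R d * \<delta> \<le> e" using e m by (simp_all add: \<delta>_def field_simps)
        obtain u where u: "u \<in> formals (fibre \<X> p) (fibre \<X> q)"
          "mnorm ?R (d \<ominus>\<^bsub>?R\<^esub> lsum ?R (map (\<lambda>(x, y). pmult \<X> x y) u)) \<le> \<delta>"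
          using pmult_dense[OF p q d \<delta>(1)] by blast
        define v where "v = lsum ?R (map (\<lambda>(x, y). pmult \<X> x y) u)"
        have vc: "set (map (\<lambda>(x, y). pmult \<X> x y) u) \<subseteq> carrier ?R"
          using u(1) pmult_closed[OF p(1) q] by (auto simp: formals_def)
        have "map T (map (\<lambda>(x, y). pmult \<X> x y) u) = map T' (map (\<lambda>(x, y). pmult \<X> x y) u)"
          using u(1) TS TS' by (auto simp: formals_def)
        then have "T v = T' v" unfolding v_def R.adjoint_lsum[OF T vc] R.adjoint_lsum[OF T' vc] by (rule arg_cong)
        moreover have v: "v \<in> carrier ?R" unfolding v_def by (rule R.lsum_carrier[OF vc])
        \<comment> \<open>Moved to the other side, this is the pairing of \<open>w\<close> with T v
          - T' v, which vanishes because \<open>v\<close> is a sum of products.\<close>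
        ultimately have "ip ?R d v = 0"
          using A(2) A'(2) w c unfolding d_def by (simp add: R.ip_diff_left is_adjoint_def)
        then have "ip ?R d d = ip ?R d (d \<ominus>\<^bsub>?R\<^esub> v)" using d v by (simp add: R.ip_diff)
        then have "norm (ip ?R d d) \<le> mnorm ?R d * mnorm ?R (d \<ominus>\<^bsub>?R\<^esub> v)"
          using R.norm_ip[of d "d \<ominus>\<^bsub>?R\<^esub> v"] d v by simp
        also have "\<dots> \<le> mnorm ?R d * \<delta>" using u(2) by (intro mult_left_mono) (simp_all add: v_def)
        finally show ?thesis using \<delta>(2) by simp
      qed
      then have "norm (ip ?R d d) \<le> 0" by (rule field_le_epsilon)
      then have "d = \<zero>\<^bsub>?R\<^esub>" using R.ip_eq_zero[OF d] by simp
      then show ?thesis using R.diff_eq_zero_iff[OF c] by (simp add: d_def)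
    qed
    note AA = this
    show ?thesis
    proof (rule extensionalityI[OF adjointables_ext[OF T'] adjointables_ext[OF T]])
      fix z assume z: "z \<in> carrier ?R"
      show "T' z = T z"
      proof (rule R.ip_eqI)
        fix w assume w: "w \<in> carrier ?R"
        show "ip ?R w (T' z) = ip ?R w (T z)"
          using A(2) A'(2) w z AA[OF w] unfolding is_adjoint_def by metis
      qed (use adjointables_carrier[OF T] adjointables_carrier[OF T'] z in auto)
    qed
  qed
  have "qle P p (p + q)" using q by (simp add: qle_def)
  then have "iota P \<X> p (p + q) S = (THE T. T \<in> adjointables ?R \<and>
      (\<forall>x\<in>carrier (fibre \<X> p). \<forall>y\<in>carrier (fibre \<X> q). T (pmult \<X> x y) = pmult \<X> (S x) y))"
    using p(2) by (simp add: iota_def)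
  also have "\<dots> = T"
  proof (rule the_equality)
    show "T \<in> adjointables ?R \<and>
      (\<forall>x\<in>carrier (fibre \<X> p). \<forall>y\<in>carrier (fibre \<X> q). T (pmult \<X> x y) = pmult \<X> (S x) y)"
      using T TS by blast
  qed (use uniq in blast)
  finally show ?thesis .
qed

lemma phi_compact: "p \<in> P \<Longrightarrow> phi (fibre \<X> p) a \<in> compacts (fibre \<X> p)"
  using phi_compacts by blast

lemma iota_phi:
  assumes p: "p \<in> P" "p \<noteq> 0" and q: "q \<in> P"
  shows "iota P \<X> p (p + q) (phi (fibre \<X> p) a) = phi (fibre \<X> (p + q)) a"
proof (rule iota_eqI[OF p q])
  note pq = add_P[OF p(1) q]
  show "phi (fibre \<X> (p + q)) a \<in> adjointables (fibre \<X> (p + q))"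
    by (rule compacts_adjointables[OF phi_compact[OF pq]])
  fix x y assume x: "x \<in> carrier (fibre \<X> p)" and y: "y \<in> carrier (fibre \<X> q)"
  note xy = pmult_closed[OF p(1) q x y]
  show "phi (fibre \<X> (p + q)) a (pmult \<X> x y) = pmult \<X> (phi (fibre \<X> p) a x) y"
    using pmult_assoc[OF zero_P p(1) q emb_carrier x y, of a]
    by (simp add: phi_def x y xy pmult_emb(1)[OF pq xy] pmult_emb(1)[OF p(1) x])
qed

section \<open>The identity fibre: its compact operators are the left multiplications by A\<close>

lemma the_phi_0: "(THE b. phi (fibre \<X> 0) a = phi (fibre \<X> 0) b) = a"
  by (rule the_equality) (use inj_phi zero_P in \<open>auto dest: injD\<close>)

lemma iota_0: "r \<in> P \<Longrightarrow> iota P \<X> 0 r (phi (fibre \<X> 0) a) = phi (fibre \<X> r) a"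
  by (simp add: iota_def the_phi_0)

text \<open>The representation of the identity fibre in \<open>A\<close> itself recovers \<open>a\<close> from \<open>phi a\<close>.\<close>

definition unemb :: "'x \<Rightarrow> 'a" where
  "unemb = inv_into UNIV (emb \<X>)"

lemma unemb_emb [simp]: "unemb (emb \<X> a) = a"
  unfolding unemb_def using emb_bij by (simp add: bij_betw_def)

lemma module_rep_unemb: "module_rep (fibre \<X> 0) (\<lambda>a. a) unemb"
proof (intro module_rep.intro module_rep_axioms.intro)
  show "right_hilbert_module (fibre \<X> 0)" by (rule hmod) simp
  fix x y assume "x \<in> carrier (fibre \<X> 0)" "y \<in> carrier (fibre \<X> 0)"
  then obtain a b where xy: "x = emb \<X> a" "y = emb \<X> b" by (metis emb_cases)
  show "unemb (x \<oplus>\<^bsub>fibre \<X> 0\<^esub> y) = unemb x + unemb y" by (simp add: xy flip: emb_simps(1))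
  show "ip (fibre \<X> 0) x y = star (unemb x) * unemb y" by (simp add: xy emb_simps)
next
  fix x a c assume "x \<in> carrier (fibre \<X> 0)"
  then obtain b where x: "x = emb \<X> b" by (rule emb_cases)
  show "unemb (c \<odot>\<^bsub>fibre \<X> 0\<^esub> x) = c *\<^sub>C unemb x" by (simp add: x flip: emb_simps(2))
  show "unemb (ract (fibre \<X> 0) x a) = unemb x * a" by (simp add: x emb_simps)
qed simp

text \<open>On A the finite-rank operator of pairs s, t is left multiplication by the sum of the
  products s t*, and \<open>\<psi>\<close> sends this sum to the image of the list.\<close>

lemma fin_op_0:
  assumes "L \<in> pairs (fibre \<X> 0)"
  shows "fin_op (fibre \<X> 0) L = phi (fibre \<X> 0) (module_rep.rep unemb L) \<and>
    module_rep.rep \<psi> L = \<psi> (emb \<X> (module_rep.rep unemb L))"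
proof -
  interpret N: right_hilbert_bimodule "fibre \<X> 0" by (rule bim) simp
  interpret E: module_rep "fibre \<X> 0" "\<lambda>a. a" unemb by (rule module_rep_unemb)
  interpret V: module_rep "fibre \<X> 0" "\<lambda>a. \<psi> (emb \<X> a)" \<psi> by (rule module_rep_fibre) simp
  have "(\<forall>z\<in>carrier (fibre \<X> 0). fin_op (fibre \<X> 0) L z = lact (fibre \<X> 0) (E.rep L) z) \<and> V.rep L = \<psi> (emb \<X> (E.rep L))"
    using assms
  proof (induction L)
    case Nil
    have "\<psi> (emb \<X> 0) = 0" using psi_emb_scaleC[of 0 0] by simp
    then show ?case by (simp del: N.fin_op_Nil)
  next
    case (Cons r L)
    obtain x y where r: "r = (x, y)" by (cases r)
    then have "x \<in> carrier (fibre \<X> 0)" "y \<in> carrier (fibre \<X> 0)" using Cons.prems by simp_all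
    then obtain s t where st: "x = emb \<X> s" "y = emb \<X> t" by (metis emb_cases)
    have "fin_op (fibre \<X> 0) (r # L) z = lact (fibre \<X> 0) (E.rep (r # L)) z" if z: "z \<in> carrier (fibre \<X> 0)" for z
    proof -
      obtain c where c: "z = emb \<X> c" using emb_cases[OF z] .
      have "fin_op (fibre \<X> 0) (r # L) z = emb \<X> (s * (star t * c)) \<oplus>\<^bsub>fibre \<X> 0\<^esub> lact (fibre \<X> 0) (E.rep L) z"
        using Cons z by (simp add: r st c emb_simps)
      also have "\<dots> = lact (fibre \<X> 0) (E.rep (r # L)) z"
        by (simp add: r st c emb_simps(4) distrib_right mult.assoc flip: emb_simps(1))
      finally show ?thesis .
    qed
    moreover have "V.rep (r # L) = \<psi> (emb \<X> (E.rep (r # L)))"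
      using Cons by (simp add: r st psi_emb_add psi_emb_mult psi_emb_star)
    ultimately show ?case by blast
  qed
  moreover from this have "fin_op (fibre \<X> 0) L = phi (fibre \<X> 0) (E.rep L)"
    by (intro extensionalityI[where A = "carrier (fibre \<X> 0)"]) (simp_all add: N.fin_op_extensional phi_def)
  ultimately show ?thesis by blast
qed

text \<open>A compact \<open>S\<close> is a limit of left multiplications by elements of A. The
  representation in A is contractive, so these elements converge to the image of \<open>S\<close>,
  and multiplication by that image is \<open>S\<close>. The value of \<open>psi_compacts\<close>
  follows from the same approximation.\<close>

lemma psi_compacts_phi_0: "psi_compacts (fibre \<X> 0) \<psi> (phi (fibre \<X> 0) a) = \<psi> (emb \<X> a)"
  and compact_0: "S \<in> compacts (fibre \<X> 0) \<Longrightarrow> \<exists>a. S = phi (fibre \<X> 0) a"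
proof -
  let ?M = "fibre \<X> 0"
  interpret N: right_hilbert_bimodule ?M by (rule bim) simp
  interpret E: module_rep ?M "\<lambda>a. a" unemb by (rule module_rep_unemb)
  interpret V: module_rep ?M "\<lambda>a. \<psi> (emb \<X> a)" \<psi> by (rule module_rep_fibre) simp
  have diff: "phi ?M b (emb \<X> c) \<ominus>\<^bsub>?M\<^esub> phi ?M a (emb \<X> c) = emb \<X> ((b - a) * c)" for a b c
  proof -
    have "emb \<X> ((b - a) * c) = emb \<X> (b * c + (-1) *\<^sub>C (a * c))" by (simp add: algebra_simps)
    also have "\<dots> = emb \<X> (b * c) \<ominus>\<^bsub>?M\<^esub> emb \<X> (a * c)" by (simp only: emb_simps(1,2) N.minus_eq emb_carrier)
    finally show ?thesis by (simp add: phi_def emb_simps(4))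
  qed
  have main: "S = phi ?M (psi_compacts ?M unemb S)" if S: "S \<in> compacts ?M" for S
  proof (rule extensionalityI[OF adjointables_ext[OF compacts_adjointables[OF S]]])
    define a where "a = psi_compacts ?M unemb S"
    fix z assume z: "z \<in> carrier ?M"
    obtain c where c: "z = emb \<X> c" using emb_cases[OF z] .
    have Sz: "S z \<in> carrier ?M" using adjointables_carrier[OF compacts_adjointables[OF S] z] .
    have pc: "phi ?M b z \<in> carrier ?M" for b using z by (simp add: phi_def)
    have "mnorm ?M (S z \<ominus>\<^bsub>?M\<^esub> phi ?M a z) \<le> 0 + e" if e: "e > 0" for e
    proof -
      define d where "d = e / (2 * norm c + 1)"
      have "2 * norm c + 1 > 0" by (simp add: add_nonneg_pos)
      then have d: "d > 0" "2 * (d * norm c) \<le> e" using e by (simp_all add: d_def field_simps)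
      obtain L where L: "L \<in> pairs ?M" "op_near ?M S (fin_op ?M L) d" using S d(1) unfolding N.compacts_iff by blast
      define b where "b = E.rep L"
      have Lb: "fin_op ?M L = phi ?M b" using fin_op_0[OF L(1)] by (simp add: b_def)
      have "norm (a - b) \<le> d"
        using E.psi_compacts_near[OF S N.fin_op_compact[OF L(1)] L(2)] d(1)
        by (simp add: a_def b_def E.psi_compacts_fin_op[OF L(1)])
      then have "norm (b - a) \<le> d" by (simp only: norm_minus_commute)
      then have "norm ((b - a) * c) \<le> d * norm c"
        by (rule order_trans[OF norm_mult_ineq mult_right_mono]) simp
      then have 1: "mnorm ?M (phi ?M b z \<ominus>\<^bsub>?M\<^esub> phi ?M a z) \<le> d * norm c" by (simp only: c diff mnorm_emb)
      have "mnorm ?M (S z \<ominus>\<^bsub>?M\<^esub> phi ?M b z) \<le> d * mnorm ?M z" using L(2) z unfolding Lb op_near_def by blast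
      then have 2: "mnorm ?M (S z \<ominus>\<^bsub>?M\<^esub> phi ?M b z) \<le> d * norm c" by (simp add: c mnorm_emb)
      show ?thesis using N.mnorm_minus_triangle[OF Sz pc[of b] pc[of a]] 1 2 d(2) by linarith
    qed
    then have "mnorm ?M (S z \<ominus>\<^bsub>?M\<^esub> phi ?M a z) \<le> 0" by (rule field_le_epsilon)
    then have "mnorm ?M (S z \<ominus>\<^bsub>?M\<^esub> phi ?M a z) = 0" using mnorm_nonneg by (rule antisym)
    then show "S z = phi ?M (psi_compacts ?M unemb S) z"
      using N.mnorm_eq_0_iff[OF N.minus_carrier[OF Sz pc]] N.diff_eq_zero_iff[OF Sz pc] by (simp add: a_def)
  qed (simp add: phi_def)
  then show "S \<in> compacts ?M \<Longrightarrow> \<exists>a. S = phi ?M a" by blast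
  have pa: "phi ?M a \<in> compacts ?M" by (rule phi_compact) simp
  \<comment> \<open>By injectivity of the left action the element found for phi a is
    \<open>a\<close> itself.\<close>
  have Ea: "psi_compacts ?M unemb (phi ?M a) = a"
    using main[OF pa] inj_phi zero_P by (metis injD)
  have "norm (psi_compacts ?M \<psi> (phi ?M a) - \<psi> (emb \<X> a)) \<le> 0 + e" if e: "e > 0" for e
  proof -
    have e2: "e / 2 > 0" using e by simp
    obtain L where L: "L \<in> pairs ?M" "op_near ?M (phi ?M a) (fin_op ?M L) (e / 2)"
      using pa e2 unfolding N.compacts_iff by blast
    define b where "b = E.rep L"
    have Vb: "V.rep L = \<psi> (emb \<X> b)" using fin_op_0[OF L(1)] by (simp add: b_def)
    have "norm (a - b) \<le> e / 2"
      using E.psi_compacts_near[OF pa N.fin_op_compact[OF L(1)] L(2)] e2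
      by (simp add: Ea b_def E.psi_compacts_fin_op[OF L(1)])
    then have ba: "norm (b - a) \<le> e / 2" by (simp only: norm_minus_commute)
    have "\<psi> (emb \<X> (b - a)) = \<psi> (emb \<X> b) - \<psi> (emb \<X> a)"
      using psi_emb_add[of "b - a" a] by simp
    then have 1: "norm (\<psi> (emb \<X> b) - \<psi> (emb \<X> a)) \<le> e / 2"
      using psi_emb_contractive[of "b - a"] ba by simp
    have "norm (psi_compacts ?M \<psi> (phi ?M a) - \<psi> (emb \<X> b)) \<le> e / 2"
      using V.psi_compacts_near[OF pa N.fin_op_compact[OF L(1)] L(2)] e2 by (simp add: V.psi_compacts_fin_op[OF L(1)] Vb)
    then show ?thesis
      using 1 norm_triangle_ineq[of "psi_compacts ?M \<psi> (phi ?M a) - \<psi> (emb \<X> b)" "\<psi> (emb \<X> b) - \<psi> (emb \<X> a)"] by simp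
  qed
  then have "norm (psi_compacts ?M \<psi> (phi ?M a) - \<psi> (emb \<X> a)) \<le> 0" by (rule field_le_epsilon)
  then show "psi_compacts ?M \<psi> (phi ?M a) = \<psi> (emb \<X> a)" by simp
qed

section \<open>From (CP) to covariance\<close>

lemma kernel_ideal_trivial:
  assumes "p \<in> P" "p \<noteq> 0" "c \<in> kernel_ideal P \<X> p" shows "c = 0"
proof -
  interpret N: right_hilbert_bimodule "fibre \<X> p" by (rule bim[OF assms(1)])
  \<comment> \<open>The index r = p belongs to the intersection that defines the ideal.\<close>
  have "phi (fibre \<X> p) c = op_zero (fibre \<X> p)" using assms by (auto simp: kernel_ideal_def)
  also have "\<dots> = phi (fibre \<X> p) 0" by (auto simp: op_zero_def phi_def)
  finally show ?thesis using inj_phi assms(1) by (meson injD)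
qed

lemma zero_kernel_ideal: "0 \<in> kernel_ideal P \<X> p"
proof -
  have "phi (fibre \<X> r) 0 = op_zero (fibre \<X> r)" if "r \<in> P" for r
  proof -
    interpret N: right_hilbert_bimodule "fibre \<X> r" by (rule bim[OF that])
    show ?thesis by (auto simp: op_zero_def phi_def)
  qed
  then show ?thesis by (simp add: kernel_ideal_def)
qed

lemma covariant_of_CP:
  assumes lub: "\<forall>p\<in>P. \<forall>q\<in>P. \<exists>r. is_least_ub P p q r" and CP: "satisfies_CP P \<X> \<psi>" and p: "p \<in> P"
  shows "psi_compacts (fibre \<X> p) \<psi> (phi (fibre \<X> p) a) = \<psi> (emb \<X> a)"
proof (cases "p = 0")
  case True
  then show ?thesis by (simp add: psi_compacts_phi_0)
next
  case False
  \<comment> \<open>Only the indices 0 and \<open>p\<close> are used: phi a at \<open>p\<close>,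
    balanced by -a in the identity fibre.\<close>
  define T where "T q = (if q = 0 then phi (fibre \<X> 0) (- a) else phi (fibre \<X> p) a)" for q :: 'g
  have T0: "T 0 = phi (fibre \<X> 0) (- a)" and Tp: "T p = phi (fibre \<X> p) a" using False by (simp_all add: T_def)
  have zero: "finsum (fibre \<X> r) (\<lambda>q. tilde_iota P \<X> q s (T q) x r) {0, p} = \<zero>\<^bsub>fibre \<X> r\<^esub>"
    if s: "s \<in> P" "qle P p s" and x: "x \<in> tilde_carrier P \<X> s" and r: "r \<in> below P s" for s x r
  proof -
    have rP: "r \<in> P" "qle P r s" using r by (simp_all add: below_def)
    interpret R: right_hilbert_bimodule "fibre \<X> r" by (rule bim[OF rP(1)])
    have xr: "x r \<in> submodule_of_ideal (fibre \<X> r) (kernel_ideal P \<X> (- r + s))"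
      using x r by (auto simp: tilde_carrier_def PiE_def)
    then obtain y c where y: "x r = ract (fibre \<X> r) y c" "y \<in> carrier (fibre \<X> r)" "c \<in> kernel_ideal P \<X> (- r + s)"
      by (auto simp: submodule_of_ideal_def)
    have xc: "x r \<in> carrier (fibre \<X> r)" using y by simp
    have le: "iota P \<X> p r (phi (fibre \<X> p) a) = phi (fibre \<X> r) a" if "qle P p r"
    proof -
      have "- p + r \<in> P" "p + (- p + r) = r" using that by (simp_all add: qle_def add.assoc[symmetric])
      then show ?thesis using iota_phi[OF p False, of "- p + r" a] by simp
    qed
    have g0: "tilde_iota P \<X> 0 s (T 0) x r = lact (fibre \<X> r) (- a) (x r)"
    proof -
      have "tilde_iota P \<X> 0 s (T 0) = tilde_phi P \<X> s (- a)"
        unfolding T0 by (simp add: tilde_iota_def the_phi_0)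
      then show ?thesis using x r xc by (simp add: tilde_phi_def phi_def)
    qed
    have gp: "tilde_iota P \<X> p s (T p) x r = iota P \<X> p r (phi (fibre \<X> p) a) (x r)"
      using x r False by (simp add: tilde_iota_def Tp)
    have "iota P \<X> p r (phi (fibre \<X> p) a) (x r) = lact (fibre \<X> r) a (x r)"
    proof (cases "qle P p r")
      case True
      then show ?thesis using le xc by (simp add: phi_def)
    next
      \<comment> \<open>Here \<open>iota\<close> is 0, so agreement with the left action must come
        from the vector. Since p \<le> s, such an \<open>r\<close> differs from \<open>s\<close>,
        and the component at \<open>r\<close> is 0 because its ideal is.\<close>
      case nle: False
      then have "r \<noteq> s" using s(2) by blast
      then have "- r + s \<noteq> 0" by (metis add.right_neutral add_minus_cancel)
      then have "c = 0" using kernel_ideal_trivial[of "- r + s" c] rP(2) y(3) by (simp add: qle_def)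
      then have x0: "x r = \<zero>\<^bsub>fibre \<X> r\<^esub>" using y by simp
      show ?thesis using nle by (simp add: x0 iota_def op_zero_def)
    qed
    note gp' = gp[unfolded this]
    have "finsum (fibre \<X> r) (\<lambda>q. tilde_iota P \<X> q s (T q) x r) {0, p}
        = lact (fibre \<X> r) (- a) (x r) \<oplus>\<^bsub>fibre \<X> r\<^esub> lact (fibre \<X> r) a (x r)"
      using False xc by (subst R.M.finsum_insert) (simp_all add: g0 gp')
    also have "\<dots> = lact (fibre \<X> r) (- a + a) (x r)" by (simp only: R.lact_add[OF xc])
    finally show ?thesis using xc by simp
  qed
  have "for_large P (\<lambda>s. \<forall>x\<in>tilde_carrier P \<X> s. \<forall>r\<in>below P s.
      finsum (fibre \<X> r) (\<lambda>q. tilde_iota P \<X> q s (T q) x r) {0, p} = \<zero>\<^bsub>fibre \<X> r\<^esub>)"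
    unfolding for_large_def
  proof
    fix q assume q: "q \<in> P"
    \<comment> \<open>From the least upper bound of \<open>p\<close> and \<open>q\<close> on, every
      s lies above \<open>p\<close>, as \<open>zero\<close> asks.\<close>
    obtain r where "is_least_ub P p q r" using lub p q by blast
    then have r: "r \<in> P" "qle P p r" "qle P q r" by (auto simp: is_least_ub_def common_ub_def)
    then show "\<exists>r\<in>P. qle P q r \<and> (\<forall>s\<in>P. qle P r s \<longrightarrow> (\<forall>x\<in>tilde_carrier P \<X> s. \<forall>r\<in>below P s.
        finsum (fibre \<X> r) (\<lambda>q. tilde_iota P \<X> q s (T q) x r) {0, p} = \<zero>\<^bsub>fibre \<X> r\<^esub>))"
      using zero qle_trans[OF r(2)] by blast
  qed
  moreover have "\<forall>q\<in>{0, p}. T q \<in> compacts (fibre \<X> q)" using p phi_compact False by (simp add: T_def)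
  moreover have "finite {0, p}" "{0, p} \<subseteq> P" using p by simp_all
  ultimately have "(\<Sum>q\<in>{0, p}. psi_compacts (fibre \<X> q) \<psi> (T q)) = 0"
    using CP unfolding satisfies_CP_def by blast
  then have "\<psi> (emb \<X> (- a)) + psi_compacts (fibre \<X> p) \<psi> (phi (fibre \<X> p) a) = 0"
    using False by (simp add: T0 Tp psi_compacts_phi_0)
  moreover have "\<psi> (emb \<X> (- a)) = - \<psi> (emb \<X> a)" using psi_emb_scaleC[of "-1" a] by simp
  ultimately show ?thesis by simp
qed

end

section \<open>From covariance to Nica covariance and (CP)\<close>

locale covariant_product_system = represented_product_system +
  assumes cov: "\<forall>p\<in>P. \<forall>a. psi_compacts (fibre \<X> p) \<psi> (phi (fibre \<X> p) a) = \<psi> (emb \<X> a)"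
begin

text \<open>For p = e both sides are the value of \<open>\<psi>\<close> at an element of A, by
  covariance at \<open>r\<close> and at e. Otherwise a compact lift of \<open>S\<close> exists by
  \<open>lift_compact\<close>, and uniqueness identifies it with \<open>iota\<close>.\<close>

lemma iota_compact:
  assumes p: "p \<in> P" and r: "r \<in> P" "qle P p r" and S: "S \<in> compacts (fibre \<X> p)"
  shows "iota P \<X> p r S \<in> compacts (fibre \<X> r) \<and>
    psi_compacts (fibre \<X> r) \<psi> (iota P \<X> p r S) = psi_compacts (fibre \<X> p) \<psi> S"
proof (cases "p = 0")
  case True
  obtain a where "S = phi (fibre \<X> 0) a" using compact_0 S True by blast
  then show ?thesis using True r cov by (simp add: iota_0 phi_compact)
next
  case False
  define q where "q = - p + r"
  have q: "q \<in> P" "r = p + q" using r by (simp_all add: qle_def q_def add.assoc[symmetric])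
  interpret H: hilbert_product "fibre \<X> p" "fibre \<X> q" "fibre \<X> (p + q)" "pmult \<X>"
    by (rule hilbert_product_fibre[OF p q(1)])
  have "hilbert_product_rep (fibre \<X> p) (fibre \<X> q) (fibre \<X> (p + q)) (pmult \<X>) (\<lambda>a. \<psi> (emb \<X> a)) \<psi> \<psi> \<psi>"
  proof (intro hilbert_product_rep.intro hilbert_product_rep_axioms.intro)
    show "hilbert_product (fibre \<X> p) (fibre \<X> q) (fibre \<X> (p + q)) (pmult \<X>)" by (rule H.hilbert_product_axioms)
    show "module_rep (fibre \<X> p) (\<lambda>a. \<psi> (emb \<X> a)) \<psi>" "module_rep (fibre \<X> q) (\<lambda>a. \<psi> (emb \<X> a)) \<psi>"
      "module_rep (fibre \<X> (p + q)) (\<lambda>a. \<psi> (emb \<X> a)) \<psi>"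
      using module_rep_fibre p q add_P by blast+
    show "\<psi> (pmult \<X> x y) = \<psi> x * \<psi> y" if "x \<in> carrier (fibre \<X> p)" "y \<in> carrier (fibre \<X> q)" for x y
      using psi_mult[OF p q(1) that] .
    show "\<exists>u\<in>formals (fibre \<X> p) (fibre \<X> q). mnorm (fibre \<X> (p + q)) (z \<ominus>\<^bsub>fibre \<X> (p + q)\<^esub> H.mul_sum u) \<le> \<epsilon>"
      if "z \<in> carrier (fibre \<X> (p + q))" "\<epsilon> > 0" for z \<epsilon>
      unfolding H.mul_sum_def by (rule pmult_dense[OF p False q(1) that])
    show "phi (fibre \<X> q) a \<in> compacts (fibre \<X> q)" for a by (rule phi_compact[OF q(1)])
    show "psi_compacts (fibre \<X> q) \<psi> (phi (fibre \<X> q) a) = \<psi> (emb \<X> a)" for a using cov q(1) by blast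
  qed
  note rep_pq = this
  obtain T where T: "T \<in> compacts (fibre \<X> (p + q))"
    "\<And>x y. x \<in> carrier (fibre \<X> p) \<Longrightarrow> y \<in> carrier (fibre \<X> q) \<Longrightarrow> T (pmult \<X> x y) = pmult \<X> (S x) y"
    "psi_compacts (fibre \<X> (p + q)) \<psi> T = psi_compacts (fibre \<X> p) \<psi> S"
    using hilbert_product_rep.lift_compact[OF rep_pq S] by blast
  have "iota P \<X> p (p + q) S = T" by (rule iota_eqI[OF p False q(1) compacts_adjointables[OF T(1)] T(2)])
  then show ?thesis using T q(2) by simp
qed

text \<open>Both operators move to the fibre over the least upper bound without changing their
  images, and there the homomorphism is multiplicative. The alternative 0 never occurs, because
  common upper bounds exist.\<close>

lemma nica_of_covariant:
  assumes lub: "\<forall>p\<in>P. \<forall>q\<in>P. \<exists>r. is_least_ub P p q r"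
  shows "nica_covariant P \<X> \<psi>"
  unfolding nica_covariant_def
proof (intro ballI)
  fix p q S T assume p: "p \<in> P" and q: "q \<in> P" and S: "S \<in> compacts (fibre \<X> p)" and T: "T \<in> compacts (fibre \<X> q)"
  obtain r where r: "is_least_ub P p q r" using lub p q by blast
  have eq: "least_ub P p q = r" by (rule least_ub_eq[OF r])
  have ub: "common_ub P p q r" using r by (simp add: is_least_ub_def)
  then have rP: "r \<in> P" and le: "qle P p r" "qle P q r" by (simp_all add: common_ub_def)
  note iS = iota_compact[OF p rP le(1) S] and iT = iota_compact[OF q rP le(2) T]
  have "compacts_hom (fibre \<X> r) (psi_compacts (fibre \<X> r) \<psi>)"
    by (rule module_rep.psi_compacts_hom[OF module_rep_fibre[OF rP]])
  then have "psi_compacts (fibre \<X> r) \<psi> (op_comp (fibre \<X> r) (iota P \<X> p r S) (iota P \<X> q r T))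
      = psi_compacts (fibre \<X> r) \<psi> (iota P \<X> p r S) * psi_compacts (fibre \<X> r) \<psi> (iota P \<X> q r T)"
    using iS iT unfolding compacts_hom_def by blast
  then have "psi_compacts (fibre \<X> p) \<psi> S * psi_compacts (fibre \<X> q) \<psi> T =
      psi_compacts (fibre \<X> r) \<psi> (op_comp (fibre \<X> r) (iota P \<X> p r S) (iota P \<X> q r T))"
    using iS iT by simp
  moreover have "\<exists>r. common_ub P p q r" using ub by blast
  ultimately show "psi_compacts (fibre \<X> p) \<psi> S * psi_compacts (fibre \<X> q) \<psi> T =
      (if \<exists>r. common_ub P p q r
       then psi_compacts (fibre \<X> (least_ub P p q)) \<psi>
         (op_comp (fibre \<X> (least_ub P p q)) (iota P \<X> p (least_ub P p q) S) (iota P \<X> q (least_ub P p q) T))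
       else 0)"
    by (simp only: eq if_True)
qed

lemma finite_upper_bound:
  assumes lub: "\<forall>p\<in>P. \<forall>q\<in>P. \<exists>r. is_least_ub P p q r" and "finite F" "F \<subseteq> P"
  shows "\<exists>q\<in>P. \<forall>p\<in>F. qle P p q"
  using assms(2,3)
proof (induction F)
  case (insert p F)
  then obtain q where q: "q \<in> P" "\<forall>p\<in>F. qle P p q" by auto
  obtain r where "is_least_ub P p q r" using lub q(1) insert.prems by blast
  then have "r \<in> P" "qle P p r" "qle P q r" by (auto simp: is_least_ub_def common_ub_def)
  then show ?case using q(2) qle_trans by blast
qed (use zero_P in blast)

text \<open>
  All components of an element of \<open>X\<close>-tilde can be chosen to vanish except the last one, which
  ranges over the dense submodule \<open>X\<^sub>s A\<close>; so evaluating there one sees the operators \<open>\<iota> (T p)\<close> on \<open>X\<^sub>s\<close>.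
\<close>

lemma CP_of_covariant:
  assumes lub: "\<forall>p\<in>P. \<forall>q\<in>P. \<exists>r. is_least_ub P p q r"
  shows "satisfies_CP P \<X> \<psi>"
  unfolding satisfies_CP_def
proof (intro allI impI)
  fix F T
  assume F: "finite F" "F \<subseteq> P" and T: "\<forall>p\<in>F. T p \<in> compacts (fibre \<X> p)"
    and large: "for_large P (\<lambda>s. \<forall>x\<in>tilde_carrier P \<X> s. \<forall>r\<in>below P s.
      finsum (fibre \<X> r) (\<lambda>p. tilde_iota P \<X> p s (T p) x r) F = \<zero>\<^bsub>fibre \<X> r\<^esub>)"
  obtain q where q: "q \<in> P" "\<forall>p\<in>F. qle P p q" using finite_upper_bound[OF lub F] by blast
  \<comment> \<open>The vanishing is used at the threshold \<open>s\<close> itself, which lies above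
    an upper bound of \<open>F\<close>.\<close>
  obtain s where s: "s \<in> P" "qle P q s" and all: "\<forall>t\<in>P. qle P s t \<longrightarrow> (\<forall>x\<in>tilde_carrier P \<X> t. \<forall>r\<in>below P t.
      finsum (fibre \<X> r) (\<lambda>p. tilde_iota P \<X> p t (T p) x r) F = \<zero>\<^bsub>fibre \<X> r\<^esub>)"
    using large[unfolded for_large_def, rule_format, OF q(1)] by blast
  let ?R = "fibre \<X> s"
  interpret R: right_hilbert_bimodule ?R by (rule bim[OF s(1)])
  have hom: "compacts_hom ?R (psi_compacts ?R \<psi>)"
    by (rule module_rep.psi_compacts_hom[OF module_rep_fibre[OF s(1)]])
  define A where "A p = iota P \<X> p s (T p)" for p
  have A: "A p \<in> compacts ?R" "psi_compacts ?R \<psi> (A p) = psi_compacts (fibre \<X> p) \<psi> (T p)" if "p \<in> F" for p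
    using iota_compact[of p s "T p"] that F(2) T s(1) q(2) qle_trans[OF _ s(2)] unfolding A_def by blast+
  obtain U where U: "U \<in> compacts ?R" "\<And>z. z \<in> carrier ?R \<Longrightarrow> U z = finsum ?R (\<lambda>p. A p z) F"
    "psi_compacts ?R \<psi> U = (\<Sum>p\<in>F. psi_compacts ?R \<psi> (A p))"
    using R.compacts_finsum[where A = A, OF hom F(1) A(1)] by blast
  note Ua = compacts_adjointables[OF U(1)]
  have sb: "s \<in> below P s" using s(1) by (simp add: below_def)
  have U0: "U (ract ?R z a) = \<zero>\<^bsub>?R\<^esub>" if z: "z \<in> carrier ?R" for z a
  proof -
    \<comment> \<open>The ideal attached to r = s is that of the identity, hence all of A; this is
      why z a is an admissible last component.\<close>
    define x where "x = (\<lambda>r\<in>below P s. if r = s then ract ?R z a else \<zero>\<^bsub>fibre \<X> r\<^esub>)"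
    have xs: "x s = ract ?R z a" using sb by (simp add: x_def)
    have xt: "x \<in> tilde_carrier P \<X> s"
      unfolding tilde_carrier_def
    proof (intro CollectI conjI PiE_I)
      fix r assume r: "r \<in> below P s"
      have rP: "r \<in> P" using r by (simp add: below_def)
      interpret Q: right_hilbert_bimodule "fibre \<X> r" by (rule bim[OF rP])
      show "x r \<in> submodule_of_ideal (fibre \<X> r) (kernel_ideal P \<X> (- r + s))"
      proof (cases "r = s")
        case True
        then show ?thesis using z r by (auto simp: x_def submodule_of_ideal_def kernel_ideal_def)
      next
        case False
        have "\<zero>\<^bsub>fibre \<X> r\<^esub> = ract (fibre \<X> r) \<zero>\<^bsub>fibre \<X> r\<^esub> 0" by simp
        then have "\<zero>\<^bsub>fibre \<X> r\<^esub> \<in> submodule_of_ideal (fibre \<X> r) (kernel_ideal P \<X> (- r + s))"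
          unfolding submodule_of_ideal_def using zero_kernel_ideal Q.M.zero_closed by blast
        then show ?thesis using False r by (simp add: x_def)
      qed
    next
      have z0: "ip (fibre \<X> r) (x r) (x r) = 0" if "r \<in> below P s - {s}" for r
      proof -
        have rP: "r \<in> P" using that by (simp add: below_def)
        interpret Q: right_hilbert_bimodule "fibre \<X> r" by (rule bim[OF rP])
        show ?thesis using that by (simp add: x_def)
      qed
      have "(\<lambda>p. ip (fibre \<X> p) (x p) (x p)) summable_on {s}" by (rule summable_on_finite) simp
      moreover have "(\<lambda>p. ip (fibre \<X> p) (x p) (x p)) summable_on {s} \<longleftrightarrow>
          (\<lambda>p. ip (fibre \<X> p) (x p) (x p)) summable_on below P s"
        by (rule summable_on_cong_neutral) (use z0 sb in auto)
      ultimately show "(\<lambda>p. ip (fibre \<X> p) (x p) (x p)) summable_on below P s" by blast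
    qed (simp add: x_def)
    have "tilde_iota P \<X> p s (T p) x s = A p (ract ?R z a)" for p
      using xt sb xs s(1) by (simp add: tilde_iota_def tilde_phi_def A_def iota_def[of P \<X> 0])
    then have "finsum ?R (\<lambda>p. A p (ract ?R z a)) F = \<zero>\<^bsub>?R\<^esub>"
      using all[rule_format, OF s(1) qle_refl xt sb] by simp
    then show ?thesis using U(2) z by simp
  qed
  \<comment> \<open>\<open>U\<close> commutes with the right action, so (U z) a = U (z a) = 0, while
    (U z) a approximates U z.\<close>
  have "U z = \<zero>\<^bsub>?R\<^esub>" if z: "z \<in> carrier ?R" for z
  proof -
    have Uz: "U z \<in> carrier ?R" by (rule adjointables_carrier[OF Ua z])
    have "mnorm ?R (U z) \<le> 0 + e" if e: "e > 0" for e
    proof -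
      obtain a where a: "mnorm ?R (U z \<ominus>\<^bsub>?R\<^esub> ract ?R (U z) a) \<le> e" using R.ract_approx[OF Uz e] by blast
      have "ract ?R (U z) a = \<zero>\<^bsub>?R\<^esub>" using R.adjoint_ract[OF Ua z, of a] U0[OF z] by simp
      then show ?thesis using a Uz by (simp add: R.minus_eq)
    qed
    then have "mnorm ?R (U z) \<le> 0" by (rule field_le_epsilon)
    then have "mnorm ?R (U z) = 0" using mnorm_nonneg by (rule antisym)
    then show ?thesis using R.mnorm_eq_0_iff[OF Uz] by simp
  qed
  then have "\<forall>x\<in>carrier ?R. mnorm ?R (U x) \<le> 0 * mnorm ?R x" by simp
  then have "norm (psi_compacts ?R \<psi> U) \<le> 0"
    using hom U(1) unfolding compacts_hom_def by blast
  then show "(\<Sum>p\<in>F. psi_compacts (fibre \<X> p) \<psi> (T p)) = 0" using U(3) A(2) by simp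
qed

end

theorem corollary5p2:
  fixes P :: "'g::group_add set"
    and \<X> :: "('g, 'a::cstar_algebra, 'x) prodsys"
    and \<psi> :: "'x \<Rightarrow> 'b::cstar_algebra"
  assumes "quasi_lattice_ordered P"
    and "product_system P \<X>"
    and "compactly_aligned P \<X>"
    and "\<forall>p\<in>P. \<forall>q\<in>P. \<exists>r. is_least_ub P p q r"
    and "\<forall>p\<in>P. inj (phi (fibre \<X> p))"
    and "\<forall>p\<in>P. range (phi (fibre \<X> p)) \<subseteq> compacts (fibre \<X> p)"
    and "ps_representation P \<X> \<psi>"
  shows "CNP_covariant P \<X> \<psi> \<longleftrightarrow>
    (\<forall>p\<in>P. \<forall>a. psi_compacts (fibre \<X> p) \<psi> (phi (fibre \<X> p) a) = \<psi> (emb \<X> a))"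
proof -
  interpret S: represented_product_system P \<X> \<psi>
    using assms(1,2,5,6,7) by (rule represented_product_system.intro)
  show ?thesis
  proof
    assume "CNP_covariant P \<X> \<psi>"
    then show "\<forall>p\<in>P. \<forall>a. psi_compacts (fibre \<X> p) \<psi> (phi (fibre \<X> p) a) = \<psi> (emb \<X> a)"
      using S.covariant_of_CP[OF assms(4)] by (simp add: CNP_covariant_def)
  next
    assume "\<forall>p\<in>P. \<forall>a. psi_compacts (fibre \<X> p) \<psi> (phi (fibre \<X> p) a) = \<psi> (emb \<X> a)"
    then interpret C: covariant_product_system P \<X> \<psi>
      by unfold_locales
    show "CNP_covariant P \<X> \<psi>"
      unfolding CNP_covariant_def using C.nica_of_covariant[OF assms(4)] C.CP_of_covariant[OF assms(4)] by blast
  qed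
qed

end
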